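(* Let $N\ge 1$, $0<s<1$, $\sigma\ge 0$, let $\Omega\subset\mathbb{R}^N$ be a bounded domain and let $H:\mathbb{R}^N\times\mathbb{R}\to\mathbb{R}$, $(x,p)\mapsto H(x,p)$, be continuous. Assume that for each $x\in\Omega$ the function $p\mapsto H(x,p)$ is convex. Let $u_1,u_2:\mathbb{R}^N\to\mathbb{R}$ be bounded on $\mathbb{R}^N$ and continuous on $\overline\Omega$, with $u_1\le u_2$ in $\Omega^c=\mathbb{R}^N\setminus\Omega$. (a) Suppose that $u_1$ and $u_2$ are, respectively, a viscosity sub solution and a viscosity super solution of $$\sigma(-\Delta)^s u+H(x,D_s u)=0\quad\text{in }\Omega .$$ Suppose that there is a modulus of continuity $\omega_1$ such that $$|H(x,D_sv(x))-H(y,D_sv(x))|\le \omega_1\big(|x-y|(1+D_sv(x))\big)$$ for all $x,y\in\Omega$ and all $v\in C^1(\Omega)\cap L^1_w(\mathbb{R}^N)$ (with $D_sv(x)$ finite). Suppose also that there is a function $\rho_1:\mathbb{R}^N\to\mathbb{R}$, bounded on $\mathbb{R}^N$, continuous on $\overline\Omega$ and of class $C^2$ in $\Omega$, such that $\rho_1\le u_1$ in $\mathbb{R}^N$ and $$\sup_{x\in\Omega'}\big[\sigma(-\Delta)^s\rho_1(x)+H(x,D_s\rho_1(x))\big]<0\quad\text{for every }\Omega'\subset\subset\Omega .$$ Then $u_1\le u_2$ in $\Omega$. (b) Let $h:\mathbb{R}^N\to\mathbb{R}$ be a smooth function in $L^1_w(\mathbb{R}^N)$, and suppose that $u_1$ and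 $u_2$ are, respectively, a viscosity sub solution and a viscosity super solution of $$\sigma(-\Delta)^s u+H(x,\mathcal{B}(u,h))=0\quad\text{in }\Omega .$$ Suppose that there is a modulus of continuity $\tilde\omega_1$ such that $$|H(x,\mathcal{B}(v,h_1)(x))-H(y,\mathcal{B}(v,h_2)(y))|\le\tilde\omega_1\big(|x-y|+|\mathcal{B}(v,h_1)(x)-\mathcal{B}(v,h_2)(y)|\big)$$ for all $x,y\in\Omega$, all $v\in C^1(\Omega)\cap L^1_w(\mathbb{R}^N)$ and all smooth $h_1,h_2\in L^1_w(\mathbb{R}^N)$ (for which the quantities involved are well defined and finite). Suppose also that there is a function $\rho_2:\mathbb{R}^N\to\mathbb{R}$, bounded on $\mathbb{R}^N$, continuous on $\overline\Omega$ and of class $C^2$ in $\Omega$, such that $\rho_2\le u_1$ in $\mathbb{R}^N$ and $$\sup_{x\in\Omega'}\big[\sigma(-\Delta)^s\rho_2(x)+H(x,\mathcal{B}(\rho_2,h)(x))\big]<0\quad\text{for every }\Omega'\subset\subset\Omega .$$ Then $u_1\le u_2$ in $\Omega$.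
   Context: Fix $0<s<1$ and let $c_{N,s}>0$ be the normalization constant of the fractional Laplacian, $$(-\Delta)^su(x)=\mathrm{P.V.}\;c_{N,s}\int_{\mathbb{R}^N}\frac{u(x)-u(y)}{|x-y|^{N+2s}}\,dy,$$ chosen so that $(-\Delta)^su\to-\Delta u$ as $s\to1$ for smooth $u$. Define $$\mathcal{B}(u,v)(x)=\frac{c_{N,s}}{2}\int_{\mathbb{R}^N}\frac{(u(x)-u(y))(v(x)-v(y))}{|x-y|^{N+2s}}\,dy,\qquad D_su(x)=\sqrt{\mathcal{B}(u,u)(x)} .$$ Let $w(x)=\frac{1}{1+|x|^{N+2s}}$; $L^1_w(\mathbb{R}^N)$ is the set of functions $u$ on $\mathbb{R}^N$ with $\|uw\|_{L^1(\mathbb{R}^N)}<\infty$. For an open set $\Omega$, $C^k(\Omega)\cap L^1_w(\mathbb{R}^N)$ denotes functions on $\mathbb{R}^N$ that belong to $L^1_w(\mathbb{R}^N)$ and are of class $C^k$ in $\Omega$. $\Omega'\subset\subset\Omega$ means that $\overline{\Omega'}$ is a compact subset of $\Omega$. A modulus of continuity is a continuous nondecreasing function $\omega:[0,\infty)\to[0,\infty)$ with $\omega(0)=0$. Viscosity solutions. Let $\mathcal{G}u(x)$ denote $D_su(x)$ or $\mathcal{B}(u,h)(x)$, according to the equation considered. A function $u:\mathbb{R}^N\to\mathbb{R}$ that is upper (respectively lower) semicontinuous in $\overline\Omega$ is a viscosity sub solution (respectively super solution) of $\sigma(-\Delta)^su+H(x,\mathcal{G}u)=0$ in $\Omega$ if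 for every test function $\varphi\in C^2(\Omega)\cap L^1_w(\mathbb{R}^N)$ and every $x_0\in\Omega$ such that $u-\varphi$ has a global maximum (respectively global minimum) over $\mathbb{R}^N$ at $x_0$ (and $\mathcal{G}\varphi(x_0)$ is well defined and finite) one has $$\sigma(-\Delta)^s\varphi(x_0)+H(x_0,\mathcal{G}\varphi(x_0))\le0\quad(\text{respectively }\ge0).$$ When $\sigma=0$ the test functions are only required to be in $C^1(\Omega)\cap L^1_w(\mathbb{R}^N)$.
   Formalization: The functions u_1, u_2, ρ_1 and ρ_2 are additionally assumed Lebesgue measurable on R^N; for non-measurable exterior data the comparison as literally stated can fail. *)

theory Defs
  imports "HOL-Analysis.Analysis"
begin

primrec Ck_on :: "nat \<Rightarrow> ('a::euclidean_space \<Rightarrow> real) \<Rightarrow> 'a set \<Rightarrow> bool" where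
  "Ck_on 0 f S \<longleftrightarrow> continuous_on S f"
| "Ck_on (Suc k) f S \<longleftrightarrow> f differentiable_on S \<and>
     (\<forall>b\<in>Basis. Ck_on k (\<lambda>x. frechet_derivative f (at x) b) S)"

definition smooth :: "('a::euclidean_space \<Rightarrow> real) \<Rightarrow> bool" where
  "smooth f \<longleftrightarrow> (\<forall>k. Ck_on k f UNIV)"

definition usc_on :: "'a::topological_space set \<Rightarrow> ('a \<Rightarrow> real) \<Rightarrow> bool" where
  "usc_on A u \<longleftrightarrow> (\<forall>x\<in>A. \<forall>c>u x. \<forall>\<^sub>F y in at x within A. u y < c)"

definition lsc_on :: "'a::topological_space set \<Rightarrow> ('a \<Rightarrow> real) \<Rightarrow> bool" where
  "lsc_on A u \<longleftrightarrow> (\<forall>x\<in>A. \<forall>c<u x. \<forall>\<^sub>F y in at x within A. c < u y)"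

definition modulus_of_continuity :: "(real \<Rightarrow> real) \<Rightarrow> bool" where
  "modulus_of_continuity \<omega> \<longleftrightarrow> continuous_on {0..} \<omega> \<and> mono_on {0..} \<omega> \<and>
     (\<forall>t\<ge>0. 0 \<le> \<omega> t) \<and> \<omega> 0 = 0"

definition compactly_contained :: "'a::topological_space set \<Rightarrow> 'a set \<Rightarrow> bool" where
  "compactly_contained A B \<longleftrightarrow> compact (closure A) \<and> closure A \<subseteq> B"

text \<open>Integrals are Lebesgue integrals with respect to the completed Lebesgue measure;
  in particular members of \<open>L1w s\<close> are Lebesgue measurable.\<close>

definition L1w :: "real \<Rightarrow> ('a::euclidean_space \<Rightarrow> real) set" where
  "L1w s = {u. integrable lebesgue (\<lambda>x. u x * (1 / (1 + norm x powr (real DIM('a) + 2 * s))))}"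

text \<open>The closed form of the constant for which \<open>(-\<Delta>)\<^sup>s\<close> is the Fourier multiplier
  \<open>\<bar>\<xi>\<bar>\<^bsup>2s\<^esup>\<close>, equivalently \<open>1 / \<integral> (1 - cos \<zeta>\<^sub>1) / \<bar>\<zeta>\<bar>\<^bsup>N+2s\<^esup> d\<zeta>\<close>.\<close>

definition frac_const :: "nat \<Rightarrow> real \<Rightarrow> real" where
  "frac_const N s = s * 4 powr s * Gamma (real N / 2 + s) / (pi powr (real N / 2) * Gamma (1 - s))"

definition frac_lap :: "real \<Rightarrow> ('a::euclidean_space \<Rightarrow> real) \<Rightarrow> 'a \<Rightarrow> real" where
  "frac_lap s u x = Lim (at_right 0) (\<lambda>\<epsilon>. frac_const DIM('a) s *
     (LINT y:{y. norm (x - y) > \<epsilon>}|lebesgue. (u x - u y) / norm (x - y) powr (real DIM('a) + 2 * s)))"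

definition Bform :: "real \<Rightarrow> ('a::euclidean_space \<Rightarrow> real) \<Rightarrow> ('a \<Rightarrow> real) \<Rightarrow> 'a \<Rightarrow> real" where
  "Bform s u v x = frac_const DIM('a) s / 2 *
     (LINT y|lebesgue. (u x - u y) * (v x - v y) / norm (x - y) powr (real DIM('a) + 2 * s))"

text \<open>\<open>Bform s u v x\<close> is well defined and finite. For \<open>u = v\<close> the integrand is nonnegative,
  so this says that \<open>D\<^sub>s u(x)\<close> is finite.\<close>

definition Bform_finite :: "real \<Rightarrow> ('a::euclidean_space \<Rightarrow> real) \<Rightarrow> ('a \<Rightarrow> real) \<Rightarrow> 'a \<Rightarrow> bool" where
  "Bform_finite s u v x \<longleftrightarrow> integrable lebesgue
     (\<lambda>y. (u x - u y) * (v x - v y) / norm (x - y) powr (real DIM('a) + 2 * s))"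

definition Ds :: "real \<Rightarrow> ('a::euclidean_space \<Rightarrow> real) \<Rightarrow> 'a \<Rightarrow> real" where
  "Ds s u x = sqrt (Bform s u u x)"

definition test_function :: "real \<Rightarrow> real \<Rightarrow> 'a::euclidean_space set \<Rightarrow> ('a \<Rightarrow> real) \<Rightarrow> bool" where
  "test_function s \<sigma> \<Omega> \<phi> \<longleftrightarrow> Ck_on (if \<sigma> = 0 then 1 else 2) \<phi> \<Omega> \<and> \<phi> \<in> L1w s"

text \<open>Viscosity sub/super solutions of \<open>\<sigma>(-\<Delta>)\<^sup>s u + H(x, G u) = 0\<close> in \<open>\<Omega>\<close>. The parameter
  \<open>fin \<phi> x\<close> expresses that \<open>G \<phi> x\<close> is well defined and finite; it is instantiated with
  \<open>Bform_finite\<close> below. The value \<open>frac_lap s \<phi> x0\<close> exists for every \<open>C\<^sup>2\<close> test function, and for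
  \<open>\<sigma> = 0\<close> it is multiplied by zero.\<close>

definition visc_sub ::
  "real \<Rightarrow> real \<Rightarrow> ('a::euclidean_space \<times> real \<Rightarrow> real) \<Rightarrow> (('a \<Rightarrow> real) \<Rightarrow> 'a \<Rightarrow> real) \<Rightarrow>
   (('a \<Rightarrow> real) \<Rightarrow> 'a \<Rightarrow> bool) \<Rightarrow> 'a set \<Rightarrow> ('a \<Rightarrow> real) \<Rightarrow> bool" where
  "visc_sub s \<sigma> H G fin \<Omega> u \<longleftrightarrow> usc_on (closure \<Omega>) u \<and>
     (\<forall>\<phi>. \<forall>x0\<in>\<Omega>. test_function s \<sigma> \<Omega> \<phi> \<and> (\<forall>y. u y - \<phi> y \<le> u x0 - \<phi> x0) \<and> fin \<phi> x0 \<longrightarrow>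
        \<sigma> * frac_lap s \<phi> x0 + H (x0, G \<phi> x0) \<le> 0)"

definition visc_super ::
  "real \<Rightarrow> real \<Rightarrow> ('a::euclidean_space \<times> real \<Rightarrow> real) \<Rightarrow> (('a \<Rightarrow> real) \<Rightarrow> 'a \<Rightarrow> real) \<Rightarrow>
   (('a \<Rightarrow> real) \<Rightarrow> 'a \<Rightarrow> bool) \<Rightarrow> 'a set \<Rightarrow> ('a \<Rightarrow> real) \<Rightarrow> bool" where
  "visc_super s \<sigma> H G fin \<Omega> u \<longleftrightarrow> lsc_on (closure \<Omega>) u \<and>
     (\<forall>\<phi>. \<forall>x0\<in>\<Omega>. test_function s \<sigma> \<Omega> \<phi> \<and> (\<forall>y. u x0 - \<phi> x0 \<le> u y - \<phi> y) \<and> fin \<phi> x0 \<longrightarrow>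
        \<sigma> * frac_lap s \<phi> x0 + H (x0, G \<phi> x0) \<ge> 0)"

abbreviation visc_sub_D where
  "visc_sub_D s \<sigma> H \<equiv> visc_sub s \<sigma> H (Ds s) (\<lambda>\<phi>. Bform_finite s \<phi> \<phi>)"

abbreviation visc_super_D where
  "visc_super_D s \<sigma> H \<equiv> visc_super s \<sigma> H (Ds s) (\<lambda>\<phi>. Bform_finite s \<phi> \<phi>)"

abbreviation visc_sub_B where
  "visc_sub_B s \<sigma> h H \<equiv> visc_sub s \<sigma> H (\<lambda>\<phi>. Bform s \<phi> h) (\<lambda>\<phi>. Bform_finite s \<phi> h)"

abbreviation visc_super_B where
  "visc_super_B s \<sigma> h H \<equiv> visc_super s \<sigma> H (\<lambda>\<phi>. Bform s \<phi> h) (\<lambda>\<phi>. Bform_finite s \<phi> h)"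

end

theory Submission
  imports Defs
begin

text \<open>If \<open>u\<^sub>1 > u\<^sub>2\<close> somewhere, then for \<open>\<mu> < 1\<close> close to \<open>1\<close> also \<open>w = \<mu> u\<^sub>1 + (1 - \<mu>) \<rho>\<close> exceeds \<open>u\<^sub>2\<close>
  somewhere, and convexity of \<open>H\<close> makes \<open>w\<close> a strict subsolution. Maximizing
  \<open>w x - u\<^sub>2 y - k \<bar>x - y\<bar>\<^sup>2\<close> gives points \<open>X, Y\<close> with \<open>\<surd>k \<bar>X - Y\<bar> \<rightarrow> 0\<close>. One function whose increments
  lie between those of \<open>w\<close> at \<open>X\<close> and of \<open>u\<^sub>2\<close> at \<open>Y\<close> serves as test function for both, so the fractional
  Laplacians agree up to \<open>o(1)\<close>, and so do the bilinear forms in part (b). In part (a), tall thin peaks added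
  to the test functions outside \<open>\<Omega>\<close> show that both inequalities hold for every gradient value above
  \<open>O(\<surd>k)\<close>; a common such value is compatible with the modulus of continuity.\<close>

section \<open>Integration with respect to Lebesgue measure\<close>

text \<open>The obstacle in part (a) is that \<open>Ds\<close> is not linear: the gradient values of
  the two test functions at \<open>X\<close> and \<open>Y\<close> need not approach each other,
  while the modulus compares \<open>H\<close> at two points only for one and the same gradient
  value. That value may be as large as a multiple of \<open>sqrt k\<close>, because the modulus
  multiplies it by the distance of \<open>X\<close> and \<open>Y\<close>. A peak of height
  \<open>t\<close> over a set of kernel mass \<open>\<kappa>\<close> costs
  \<open>t * \<kappa>\<close> in the Laplacian but adds \<open>t^2 * \<kappa>\<close> to the energy;
  this gap in homogeneity is why tall and thin is the right shape. The modulus is stated through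
  functions \<open>v\<close>, not through numbers, so every number inserted into \<open>H\<close>
  must also be realized as a gradient or form value of an admissible \<open>v\<close>. Outside the
  closure of \<open>\<Omega>\<close> the data are merely measurable and bounded, yet test functions
  must touch globally. Therefore all estimates are made for functions with a quadratic expansion at
  one point, and the return to genuine \<open>C^2\<close> test functions happens once, by a
  one-sided approximation with uniform constants in the expansion.\<close>

lemma measurable_lebesgue_affine:
  fixes t :: "'a::euclidean_space"
  assumes "c \<noteq> 0"
  shows "(\<lambda>x. t + c *\<^sub>R x) \<in> lebesgue \<rightarrow>\<^sub>M lebesgue"
proof -
  have "(\<lambda>x::'a. t + (\<Sum>j\<in>Basis. (c * (x \<bullet> j)) *\<^sub>R j)) = (\<lambda>x. t + c *\<^sub>R x)"
    by (auto simp: fun_eq_iff scaleR_sum_right[symmetric] euclidean_representation scaleR_scaleR[symmetric]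
        simp del: scaleR_scaleR)
  then show ?thesis
    using lebesgue_affine_measurable[of "\<lambda>_. c" t] assms by simp
qed

lemma lebesgue_isometry:
  fixes t :: "'a::euclidean_space"
  assumes "\<bar>c\<bar> = 1"
  shows "distr lebesgue lebesgue (\<lambda>x. t + c *\<^sub>R x) = lebesgue"
proof -
  have "(\<lambda>x::'a. t + (\<Sum>j\<in>Basis. (c * (x \<bullet> j)) *\<^sub>R j)) = (\<lambda>x. t + c *\<^sub>R x)"
    by (auto simp: fun_eq_iff scaleR_sum_right[symmetric] euclidean_representation scaleR_scaleR[symmetric]
        simp del: scaleR_scaleR)
  then show ?thesis
    using lebesgue_affine_euclidean[of "\<lambda>_. c" t] assms by (auto simp: density_1)
qed

text \<open>The map is inverted by another map of the same form because \<open>c * c = 1\<close>, so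
  measurability of the composition passes back to \<open>f\<close>. If \<open>f\<close> is not
  measurable, neither side is integrable and both integrals have the default value 0; hence
  \<open>f\<close> can be arbitrary.\<close>

lemma
  fixes f :: "'a::euclidean_space \<Rightarrow> real"
  assumes "\<bar>c\<bar> = 1"
  shows integrable_lebesgue_isometry:
      "integrable lebesgue (\<lambda>x. f (t + c *\<^sub>R x)) \<longleftrightarrow> integrable lebesgue f"
    and integral_lebesgue_isometry:
      "(LINT x|lebesgue. f (t + c *\<^sub>R x)) = (LINT x|lebesgue. f x)"
proof -
  have meas: "f \<in> borel_measurable lebesgue" if "(\<lambda>x. f (t + c *\<^sub>R x)) \<in> borel_measurable lebesgue"
  proof -
    have "(\<lambda>x. f (t + c *\<^sub>R (- c *\<^sub>R t + c *\<^sub>R x))) \<in> borel_measurable lebesgue"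
      using measurable_compose[OF measurable_lebesgue_affine[of c "- c *\<^sub>R t"] that] assms by auto
    moreover have "c * c = 1" using assms by (auto simp: abs_if split: if_splits)
    ultimately show ?thesis by (simp add: algebra_simps)
  qed
  have T: "(\<lambda>x. t + c *\<^sub>R x) \<in> lebesgue \<rightarrow>\<^sub>M (lebesgue :: 'a measure)"
    using assms by (intro measurable_lebesgue_affine) auto
  have *: "integrable lebesgue f \<longleftrightarrow> integrable lebesgue (\<lambda>x. f (t + c *\<^sub>R x))"
    if "f \<in> borel_measurable lebesgue"
    using integrable_distr_eq[OF T that] lebesgue_isometry[OF assms, of t] by simp
  then show i: "integrable lebesgue (\<lambda>x. f (t + c *\<^sub>R x)) \<longleftrightarrow> integrable lebesgue f"
    using meas by (meson borel_measurable_integrable)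
  show "(LINT x|lebesgue. f (t + c *\<^sub>R x)) = (LINT x|lebesgue. f x)"
  proof (cases "f \<in> borel_measurable lebesgue")
    case True
    then show ?thesis using integral_distr[OF T True] lebesgue_isometry[OF assms, of t] by simp
  next
    case False
    then have "\<not> integrable lebesgue f" "\<not> integrable lebesgue (\<lambda>x. f (t + c *\<^sub>R x))"
      using i by auto
    then show ?thesis by (simp add: not_integrable_integral_eq)
  qed
qed

lemmas integrable_lebesgue_shift = integrable_lebesgue_isometry[of 1, simplified]
  and integral_lebesgue_shift = integral_lebesgue_isometry[of 1, simplified]
  and integral_lebesgue_reflect = integral_lebesgue_isometry[of "-1" _ 0, simplified]

lemma measurable_lebesgue_shift:
  fixes f :: "'a::euclidean_space \<Rightarrow> real"
  assumes "f \<in> borel_measurable lebesgue"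
  shows "(\<lambda>z. f (x + z)) \<in> borel_measurable lebesgue"
  using measurable_compose[OF measurable_lebesgue_affine[of 1 x] assms] by simp

text \<open>Volumes of balls scale like \<open>r ^ N\<close>, so a cover by balls with level bounds
  \<open>c j\<close> majorizes the integral by a series. With dyadic radii this gives the
  integrability of powers of the norm without polar coordinates.\<close>

lemma integrable_lebesgue_dominated_by_balls:
  fixes f :: "'a::euclidean_space \<Rightarrow> real"
  assumes f: "f \<in> borel_measurable borel" "\<And>x. 0 \<le> f x"
    and r: "\<And>j. 0 \<le> r j" and c: "\<And>j. 0 \<le> c j" and N: "N = DIM('a)"
    and s: "summable (\<lambda>j. c j * r j ^ N)"
    and dom: "\<And>x. x \<noteq> 0 \<Longrightarrow> f x \<noteq> 0 \<Longrightarrow> \<exists>j. x \<in> ball 0 (r j) \<and> f x \<le> c j"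
  shows "integrable lebesgue f"
proof -
  have v: "emeasure lborel (ball (0::'a) (r j)) = ennreal (measure lborel (ball (0::'a) 1) * r j ^ N)" for j
    using content_ball_conv_unit_ball[OF r[of j], of "0::'a"] N emeasure_lborel_ball_finite[of "0::'a" "r j"]
    by (subst emeasure_eq_ennreal_measure) (auto simp: mult.commute)
  let ?V = "measure lborel (ball (0::'a) 1)"
  have "(\<integral>\<^sup>+x. ennreal (f x) \<partial>lborel) \<le> (\<integral>\<^sup>+x. (\<Sum>j. ennreal (c j) * indicator (ball (0::'a) (r j)) x) \<partial>lborel)"
  proof (rule nn_integral_mono_AE)
    have "AE x in lborel. x \<noteq> (0::'a)" by (rule AE_lborel_singleton)
    then show "AE x in lborel. ennreal (f x) \<le> (\<Sum>j. ennreal (c j) * indicator (ball (0::'a) (r j)) x)"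
    proof eventually_elim
      case (elim x)
      show ?case
      proof (cases "f x = 0")
        case False
        then obtain j where j: "x \<in> ball 0 (r j)" "f x \<le> c j" using dom[OF elim] by auto
        have "ennreal (f x) \<le> (\<Sum>i\<in>{j}. ennreal (c i) * indicator (ball (0::'a) (r i)) x)"
          using j by (simp add: ennreal_leI)
        also have "\<dots> \<le> (\<Sum>j. ennreal (c j) * indicator (ball (0::'a) (r j)) x)"
          by (rule sum_le_suminf) auto
        finally show ?thesis .
      qed simp
    qed
  qed
  also have "\<dots> = (\<Sum>j. \<integral>\<^sup>+x. ennreal (c j) * indicator (ball (0::'a) (r j)) x \<partial>lborel)"
    by (rule nn_integral_suminf) (auto intro!: borel_measurable_times_ennreal borel_measurable_indicator)
  also have "\<dots> = (\<Sum>j. ennreal (?V * (c j * r j ^ N)))"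
    using c r by (intro suminf_cong) (simp add: nn_integral_cmult_indicator v ennreal_mult'[symmetric] mult_ac)
  also have "\<dots> = ennreal (\<Sum>j. ?V * (c j * r j ^ N))"
    using c r s by (intro suminf_ennreal2) (auto intro!: summable_mult)
  also have "\<dots> < \<infinity>" by simp
  finally have "integrable lborel f"
    using f by (intro integrableI_nonneg) auto
  then show ?thesis using f by (simp add: integrable_completion)
qed

section \<open>The fractional kernel\<close>

text \<open>The singular kernel in the increment variable \<open>z = y - x\<close>. Division by zero
  makes its value at the origin 0, so integrands need no case distinction there.\<close>

definition frac_kernel :: "real \<Rightarrow> 'a::euclidean_space \<Rightarrow> real" where
  "frac_kernel s z = 1 / norm z powr (real DIM('a) + 2 * s)"

text \<open>This is the weight in \<open>L1w\<close>. It dominates the kernel away from the origin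
  and, unlike the kernel, is comparable with its own translates.\<close>

definition decay :: "real \<Rightarrow> 'a::euclidean_space \<Rightarrow> real" where
  "decay s z = 1 / (1 + norm z powr (real DIM('a) + 2 * s))"

lemma frac_kernel_nonneg [simp]: "0 \<le> frac_kernel s z"
  by (simp add: frac_kernel_def)

lemma frac_kernel_uminus [simp]: "frac_kernel s (- z) = frac_kernel s z"
  by (simp add: frac_kernel_def)

lemma frac_kernel_pos: "z \<noteq> 0 \<Longrightarrow> 0 < frac_kernel s z"
  by (simp add: frac_kernel_def)

lemma decay_pos [simp]: "0 < decay s z"
  by (simp add: decay_def add_pos_nonneg)

lemma borel_measurable_frac_kernel [measurable]: "frac_kernel s \<in> borel_measurable borel"
  unfolding frac_kernel_def by measurable

lemma borel_measurable_decay [measurable]: "decay s \<in> borel_measurable borel"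
  unfolding decay_def by measurable

lemma lebesgue_measurable_frac_kernel [measurable]: "frac_kernel s \<in> borel_measurable lebesgue"
  and lebesgue_measurable_decay [measurable]: "decay s \<in> borel_measurable lebesgue"
  by (auto intro: measurable_completion)

lemma ex_power_of_two_bracket:
  fixes x :: real
  assumes "1 \<le> x"
  shows "\<exists>j. 2 ^ j \<le> x \<and> x < 2 ^ Suc j"
proof -
  obtain n where "x < 2 ^ n" using real_arch_pow[of 2 x] by auto
  then show ?thesis
  proof (induction n)
    case (Suc n)
    then show ?case by (cases "x < 2 ^ n") (auto intro: exI[of _ n])
  qed (use assms in simp)
qed

text \<open>On the ring \<open>2^j \<le> 1 / norm z < 2^(j+1)\<close> the function is at most
  \<open>2^((j+1) N)\<close> times \<open>((1/2) powr (2 - 2 s))^j\<close>, and the volume of the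
  ring is of order \<open>2^(-j N)\<close>. What remains is a geometric series, convergent because
  \<open>s < 1\<close>. The radius has a factor 2 since \<open>norm z\<close> may equal
  \<open>2^(-j)\<close> and the balls are open.\<close>

lemma integrable_kernel_near:
  assumes "s < 1"
  shows "integrable lebesgue (\<lambda>z::'a::euclidean_space. if norm z < 1 then (norm z)\<^sup>2 * frac_kernel s z else 0)"
proof (rule integrable_lebesgue_dominated_by_balls[where r = "\<lambda>j. 2 / 2 ^ j"
      and c = "\<lambda>j. (2 ^ Suc j) ^ DIM('a) * ((1 / 2) powr (2 - 2 * s)) ^ j", OF _ _ _ _ refl])
  have "(1 / 2) powr (2 - 2 * s) < (1 / 2) powr 0"
    using assms by (intro powr_less_mono') auto
  then have q: "(1 / 2 :: real) powr (2 - 2 * s) < 1" by simp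
  have "(\<lambda>j. (2 ^ Suc j) ^ DIM('a) * ((1 / 2) powr (2 - 2 * s)) ^ j * (2 / 2 ^ j) ^ DIM('a))
     = (\<lambda>j. 4 ^ DIM('a) * ((1 / 2 :: real) powr (2 - 2 * s)) ^ j)"
    by (auto simp: fun_eq_iff power_mult_distrib power_divide power_mult[symmetric] power_add field_simps)
      (simp add: power_mult_distrib[symmetric])
  then show "summable (\<lambda>j. (2 ^ Suc j) ^ DIM('a) * ((1 / 2) powr (2 - 2 * s)) ^ j * (2 / 2 ^ j) ^ DIM('a))"
    using q by (auto intro!: summable_mult summable_geometric)
  fix z :: 'a
  assume z: "z \<noteq> 0" and nz: "(if norm z < 1 then (norm z)\<^sup>2 * frac_kernel s z else 0) \<noteq> 0"
  then have z1: "norm z < 1" by (auto split: if_splits)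
  obtain j where j: "2 ^ j \<le> 1 / norm z" "1 / norm z < 2 ^ Suc j"
    using ex_power_of_two_bracket[of "1 / norm z"] z z1 by auto
  have le: "norm z \<le> (1 / 2) ^ j" using j(1) z by (simp add: field_simps)
  have ball: "z \<in> ball 0 (2 / 2 ^ j)"
    using le z by (simp add: field_simps)
  have "(norm z)\<^sup>2 * frac_kernel s z = (1 / norm z) ^ DIM('a) * norm z powr (2 - 2 * s)"
    using z by (simp add: frac_kernel_def powr_add powr_diff powr_realpow field_simps)
  also have "\<dots> \<le> (2 ^ Suc j) ^ DIM('a) * ((1 / 2) ^ j) powr (2 - 2 * s)"
    using j le z assms by (intro mult_mono power_mono powr_mono2) auto
  also have "((1 / 2) ^ j) powr (2 - 2 * s) = ((1 / 2 :: real) powr (2 - 2 * s)) ^ j"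
    by (simp add: powr_realpow[symmetric] powr_powr mult.commute)
  finally have "(if norm z < 1 then (norm z)\<^sup>2 * frac_kernel s z else 0)
      \<le> (2 ^ Suc j) ^ DIM('a) * ((1 / 2) powr (2 - 2 * s)) ^ j"
    using z1 by simp
  with ball show "\<exists>j. z \<in> ball 0 (2 / 2 ^ j) \<and> (if norm z < 1 then (norm z)\<^sup>2 * frac_kernel s z else 0)
      \<le> (2 ^ Suc j) ^ DIM('a) * ((1 / 2) powr (2 - 2 * s)) ^ j"
    by blast
qed auto

text \<open>The same dyadic count at infinity: the ring \<open>2^j \<le> norm z < 2^(j+1)\<close>
  contributes a multiple of \<open>(2 powr (- 2 s))^j\<close>, summable because
  \<open>s > 0\<close>.\<close>

lemma integrable_kernel_far:
  assumes "0 < s"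
  shows "integrable lebesgue (\<lambda>z::'a::euclidean_space. if 1 \<le> norm z then frac_kernel s z else 0)"
proof (rule integrable_lebesgue_dominated_by_balls[where r = "\<lambda>j. 2 ^ Suc j"
      and c = "\<lambda>j. 1 / (2 ^ j) ^ DIM('a) * (2 powr (- (2 * s))) ^ j", OF _ _ _ _ refl])
  have "2 powr (- (2 * s)) < 2 powr 0"
    using assms by (intro powr_less_mono) auto
  then have q: "(2 :: real) powr (- (2 * s)) < 1" by simp
  have "(\<lambda>j. 1 / (2 ^ j) ^ DIM('a) * (2 powr (- (2 * s))) ^ j * (2 ^ Suc j) ^ DIM('a))
     = (\<lambda>j. 2 ^ DIM('a) * (2 powr (- (2 * s)) :: real) ^ j)"
    by (auto simp: fun_eq_iff power_mult_distrib field_simps)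
  then show "summable (\<lambda>j. 1 / (2 ^ j) ^ DIM('a) * (2 powr (- (2 * s))) ^ j * (2 ^ Suc j :: real) ^ DIM('a))"
    using q by (auto intro!: summable_mult summable_geometric)
  fix z :: 'a
  assume nz: "(if 1 \<le> norm z then frac_kernel s z else 0) \<noteq> 0"
  then have z1: "1 \<le> norm z" by (auto split: if_splits)
  then have z: "z \<noteq> 0" by auto
  obtain j where j: "2 ^ j \<le> norm z" "norm z < 2 ^ Suc j"
    using ex_power_of_two_bracket[OF z1] by auto
  have "frac_kernel s z = (1 / norm z) ^ DIM('a) * norm z powr (- (2 * s))"
    using z by (simp add: frac_kernel_def powr_add powr_minus powr_realpow field_simps)
  also have "\<dots> \<le> (1 / 2 ^ j) ^ DIM('a) * (2 ^ j) powr (- (2 * s))"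
    using j z assms by (intro mult_mono power_mono powr_mono2') (auto simp: frac_le)
  also have "(2 ^ j) powr (- (2 * s)) = (2 powr (- (2 * s)) :: real) ^ j"
    by (simp add: powr_realpow[symmetric] powr_powr mult.commute)
  finally show "\<exists>j. z \<in> ball 0 (2 ^ Suc j) \<and> (if 1 \<le> norm z then frac_kernel s z else 0)
      \<le> 1 / (2 ^ j) ^ DIM('a) * (2 powr (- (2 * s))) ^ j"
    using z1 j by (intro exI[of _ j]) (simp add: power_one_over)
qed auto

text \<open>The usual weight for Levy measures: quadratic near the origin, where second order
  remainders live, and constant at infinity, where only boundedness is available.\<close>

abbreviation msq :: "'a::real_normed_vector \<Rightarrow> real" where
  "msq z \<equiv> min 1 ((norm z)\<^sup>2)"

lemma integrable_kernel:
  assumes "0 < s" "s < 1"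
  shows "integrable lebesgue (\<lambda>z::'a::euclidean_space. msq z * frac_kernel s z)"
proof -
  have "(\<lambda>z::'a. msq z * frac_kernel s z) =
      (\<lambda>z. (if norm z < 1 then (norm z)\<^sup>2 * frac_kernel s z else 0) + (if 1 \<le> norm z then frac_kernel s z else 0))"
  proof
    fix z :: 'a
    have "norm z < 1 \<Longrightarrow> (norm z)\<^sup>2 \<le> 1" "1 \<le> norm z \<Longrightarrow> 1 \<le> (norm z)\<^sup>2"
      by (auto intro: power_le_one one_le_power)
    then show "msq z * frac_kernel s z =
      (if norm z < 1 then (norm z)\<^sup>2 * frac_kernel s z else 0) + (if 1 \<le> norm z then frac_kernel s z else 0)"
      by (auto simp: min_def not_less)
  qed
  then show ?thesis
    using Bochner_Integration.integrable_add[OF integrable_kernel_near[OF assms(2)] integrable_kernel_far[OF assms(1)]]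
    by simp
qed

text \<open>The function \<open>C * msq z * frac_kernel s z\<close> is the one majorant behind the
  limits at a fixed point: any family of remainders with a common constant \<open>C\<close> passes
  to the limit by dominated convergence.\<close>

lemma
  fixes q :: "'a::euclidean_space \<Rightarrow> real"
  assumes s: "0 < s" "s < 1"
  shows integrable_kernel_bound: "\<lbrakk>q \<in> borel_measurable lebesgue; \<And>z. \<bar>q z\<bar> \<le> C * msq z\<rbrakk> \<Longrightarrow>
      integrable lebesgue (\<lambda>z. q z * frac_kernel s z)"
    and integral_kernel_tendsto: "\<lbrakk>\<And>n. Q n \<in> borel_measurable lebesgue; \<And>n z. \<bar>Q n z\<bar> \<le> C * msq z;
      \<And>z. (\<lambda>n. Q n z) \<longlonglongrightarrow> q z\<rbrakk> \<Longrightarrow>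
      (\<lambda>n. LINT z|lebesgue. Q n z * frac_kernel s z) \<longlonglongrightarrow> (LINT z|lebesgue. q z * frac_kernel s z)"
proof -
  have w: "integrable lebesgue (\<lambda>z::'a. C * (msq z * frac_kernel s z))"
    using integrable_kernel[OF s] by (intro integrable_mult_right)
  have le: "norm (q z * frac_kernel s z) \<le> C * (msq z * frac_kernel s z)" if "\<bar>q z\<bar> \<le> C * msq z" for q and z :: 'a
    using mult_right_mono[OF that frac_kernel_nonneg[of s z]] by (simp add: abs_mult mult.assoc)
  show "integrable lebesgue (\<lambda>z. q z * frac_kernel s z)"
    if "q \<in> borel_measurable lebesgue" "\<And>z. \<bar>q z\<bar> \<le> C * msq z"
  proof (rule Bochner_Integration.integrable_bound[OF w])
    show "AE z in lebesgue. norm (q z * frac_kernel s z) \<le> norm (C * (msq z * frac_kernel s z))"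
      by (rule AE_I2, rule order_trans[OF le[OF that(2)]]) simp
  qed (use that(1) in measurable)
  show "(\<lambda>n. LINT z|lebesgue. Q n z * frac_kernel s z) \<longlonglongrightarrow> (LINT z|lebesgue. q z * frac_kernel s z)"
    if Q: "\<And>n. Q n \<in> borel_measurable lebesgue" "\<And>n z. \<bar>Q n z\<bar> \<le> C * msq z" "\<And>z. (\<lambda>n. Q n z) \<longlonglongrightarrow> q z"
  proof (rule integral_dominated_convergence[OF _ _ w])
    show "AE z in lebesgue. norm (Q n z * frac_kernel s z) \<le> C * (msq z * frac_kernel s z)" for n
      by (rule AE_I2) (rule le[OF Q(2)])
    show "AE z in lebesgue. (\<lambda>n. Q n z * frac_kernel s z) \<longlonglongrightarrow> q z * frac_kernel s z"
      by (intro AE_I2 tendsto_intros Q(3))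
  qed (use Q(1) borel_measurable_LIMSEQ_real[OF Q(3) Q(1)] in auto)
qed

section \<open>The weight of \<open>L1w\<close> and its translates\<close>

lemma kernel_le_decay:
  fixes z :: "'a::euclidean_space"
  assumes "0 < r" "r \<le> norm z" "0 < s"
  shows "frac_kernel s z \<le> (1 + 1 / r powr (real DIM('a) + 2 * s)) * decay s z"
proof -
  let ?a = "real DIM('a) + 2 * s"
  have "r powr ?a \<le> norm z powr ?a" using assms by (intro powr_mono2) auto
  moreover have "0 < r powr ?a" using assms by simp
  moreover have "0 < norm z" using assms by linarith
  ultimately have "1 / norm z powr ?a \<le> 1 / r powr ?a" by (intro divide_left_mono mult_pos_pos) auto
  then have "(1 + norm z powr ?a) * (1 / norm z powr ?a) \<le> 1 + 1 / r powr ?a"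
    using \<open>0 < norm z\<close> by (simp add: add_divide_distrib)
  then show ?thesis
    unfolding frac_kernel_def decay_def by (simp add: pos_le_divide_eq add_pos_nonneg mult.commute)
qed

text \<open>From \<open>norm (x + z) \<le> 2 * max R (norm z)\<close> the two denominators differ by
  a bounded factor. The factor depends on \<open>R\<close> only, which later gives a majorant that
  is uniform over converging centres.\<close>

lemma decay_shift_le:
  fixes x z :: "'a::euclidean_space"
  assumes "norm x \<le> R" "0 < s"
  shows "decay s z \<le> (1 + 2 powr (real DIM('a) + 2 * s) * (1 + R powr (real DIM('a) + 2 * s))) * decay s (x + z)"
proof -
  let ?a = "real DIM('a) + 2 * s"
  have R: "0 \<le> R" using assms(1) norm_ge_zero order_trans by blast
  have "norm (x + z) \<le> 2 * max R (norm z)" using norm_triangle_ineq[of x z] assms by linarith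
  then have "norm (x + z) powr ?a \<le> (2 * max R (norm z)) powr ?a"
    using assms by (intro powr_mono2) auto
  also have "\<dots> = 2 powr ?a * max R (norm z) powr ?a" using R by (simp add: powr_mult)
  also have "max R (norm z) powr ?a \<le> R powr ?a + norm z powr ?a" by (simp add: max_def)
  finally have "norm (x + z) powr ?a \<le> 2 powr ?a * (R powr ?a + norm z powr ?a)" by simp
  moreover have "1 + X \<le> (1 + c * (1 + \<rho>)) * (1 + \<zeta>)"
    if "X \<le> c * (\<rho> + \<zeta>)" "0 \<le> c" "0 \<le> \<rho>" "0 \<le> \<zeta>" for X c \<rho> \<zeta> :: real
  proof -
    have "(1 + c * (1 + \<rho>)) * (1 + \<zeta>) = 1 + c * (\<rho> + \<zeta>) + \<zeta> + c + c * (\<rho> * \<zeta>)"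
      by (simp add: algebra_simps)
    moreover have "0 \<le> c * (\<rho> * \<zeta>)" using that by simp
    ultimately show ?thesis using that by linarith
  qed
  ultimately have "1 + norm (x + z) powr ?a \<le> (1 + 2 powr ?a * (1 + R powr ?a)) * (1 + norm z powr ?a)"
    by simp
  moreover have "1 / A \<le> C * (1 / B)" if "0 < A" "0 < B" "B \<le> C * A" for A B C :: real
    using that by (simp add: field_simps)
  ultimately show ?thesis
    unfolding decay_def by (simp add: add_pos_nonneg)
qed

lemma integrable_decay:
  assumes "0 < s" "s < 1"
  shows "integrable lebesgue (decay s :: 'a::euclidean_space \<Rightarrow> real)"
proof (rule Bochner_Integration.integrable_bound)
  show "integrable lebesgue (\<lambda>z::'a. indicator (ball 0 1) z + msq z * frac_kernel s z)"
    by (intro Bochner_Integration.integrable_add integrable_kernel assms)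
      (use emeasure_lborel_ball_finite[of "0::'a" 1] in \<open>auto simp: integrable_indicator_iff\<close>)
  show "AE z in lebesgue. norm (decay s z :: real)
      \<le> norm (indicator (ball 0 1) z + msq z * frac_kernel s (z::'a))"
  proof (rule AE_I2)
    fix z :: 'a
    show "norm (decay s z :: real) \<le> norm (indicator (ball 0 1) z + msq z * frac_kernel s z)"
    proof (cases "norm z < 1")
      case True
      have "decay s z \<le> 1" by (simp add: decay_def divide_le_eq_1 add_pos_nonneg)
      moreover have "0 \<le> msq z * frac_kernel s z" by simp
      moreover have "indicator (ball 0 1) z = (1::real)" using True by simp
      ultimately show ?thesis using decay_pos[of s z] unfolding real_norm_def by linarith
    next
      case False
      have "decay s z \<le> frac_kernel s z" using False
        unfolding decay_def frac_kernel_def by (intro divide_left_mono) (auto intro!: mult_pos_pos add_pos_nonneg)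
      moreover have "indicator (ball 0 1) z = (0::real)" "msq z = 1"
        using False by (auto intro: one_le_power)
      ultimately show ?thesis
        using decay_pos[of s z] abs_of_pos[OF decay_pos[of s z]] unfolding real_norm_def by simp
    qed
  qed
qed auto

lemma L1w_iff: "u \<in> L1w s \<longleftrightarrow> integrable lebesgue (\<lambda>x. u x * decay s x)"
  by (simp add: L1w_def decay_def)

lemma bounded_L1w:
  fixes u :: "'a::euclidean_space \<Rightarrow> real"
  assumes "0 < s" "s < 1" "u \<in> borel_measurable lebesgue" "\<And>x. \<bar>u x\<bar> \<le> B"
  shows "u \<in> L1w s"
  unfolding L1w_iff
proof (rule Bochner_Integration.integrable_bound)
  show "integrable lebesgue (\<lambda>x::'a. B * decay s x)" using integrable_decay[OF assms(1,2)] by (intro integrable_mult_right)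
  show "(\<lambda>x. u x * decay s x) \<in> borel_measurable lebesgue" using assms(3) by measurable
  have "0 \<le> B" using assms(4)[of 0] by linarith
  then show "AE x in lebesgue. norm (u x * decay s x) \<le> norm (B * decay s x)"
    using assms(4) by (auto simp: abs_mult intro!: AE_I2 mult_right_mono)
qed

section \<open>Second order expansions and the fractional operators\<close>

lemma frac_const_pos:
  assumes "0 < s" "s < 1"
  shows "0 < frac_const N s"
  unfolding frac_const_def using assms by (auto intro!: mult_pos_pos divide_pos_pos Gamma_real_pos add_nonneg_pos)

lemma Bform_integrand_shift:
  fixes x :: "'a::euclidean_space"
  shows "(u x - u (x + z)) * (v x - v (x + z)) / norm (x - (x + z)) powr (real DIM('a) + 2 * s)
    = (u (x + z) - u x) * (v (x + z) - v x) * frac_kernel s z"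
proof -
  have "(u x - u (x + z)) * (v x - v (x + z)) = (u (x + z) - u x) * (v (x + z) - v x)"
    by (simp add: algebra_simps)
  then show ?thesis by (simp add: frac_kernel_def)
qed

lemma Bform_eq:
  fixes x :: "'a::euclidean_space"
  shows "Bform s u v x = frac_const DIM('a) s / 2 *
    (LINT z|lebesgue. (u (x + z) - u x) * (v (x + z) - v x) * frac_kernel s z)"
  unfolding Bform_def
  by (subst integral_lebesgue_shift[of _ x, symmetric]) (simp only: Bform_integrand_shift)

lemma Bform_finite_eq:
  fixes x :: "'a::euclidean_space"
  shows "Bform_finite s u v x \<longleftrightarrow>
    integrable lebesgue (\<lambda>z. (u (x + z) - u x) * (v (x + z) - v x) * frac_kernel s z)"
  unfolding Bform_finite_def
  by (subst integrable_lebesgue_shift[of _ x, symmetric]) (simp only: Bform_integrand_shift)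

text \<open>The linear term is subtracted on the unit ball only, as in the Levy-Khintchine formula.
  There it is odd on a symmetric set and drops out of the principal value; outside it would not be
  bounded.\<close>

abbreviation quad_rem :: "'a::euclidean_space \<Rightarrow> 'a \<Rightarrow> ('a \<Rightarrow> real) \<Rightarrow> 'a \<Rightarrow> real" where
  "quad_rem x l f z \<equiv> f (x + z) - f x - (if norm z < 1 then l \<bullet> z else 0)"

text \<open>An expansion at the single point \<open>x\<close> is all that the fractional operators at \<open>x\<close> need; the function
  may be discontinuous elsewhere.\<close>

definition quad_at :: "'a::euclidean_space \<Rightarrow> 'a \<Rightarrow> real \<Rightarrow> ('a \<Rightarrow> real) \<Rightarrow> bool" where
  "quad_at x l C f \<longleftrightarrow> f \<in> borel_measurable lebesgue \<and>
    (\<forall>z. \<bar>quad_rem x l f z\<bar> \<le> C * msq z)"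

lemma quad_at_measurable: "quad_at x l C f \<Longrightarrow> f \<in> borel_measurable lebesgue"
  and quad_at_bound:
    "quad_at x l C f \<Longrightarrow> \<bar>quad_rem x l f z\<bar> \<le> C * msq z"
  by (auto simp: quad_at_def)

lemma quad_at_nonneg: 
  fixes x :: "'a::euclidean_space"
  assumes "quad_at x l C f"
  shows "0 \<le> C"
proof -
  obtain b :: 'a where "b \<in> Basis" using nonempty_Basis by blast
  then show ?thesis using quad_at_bound[OF assms, of b] abs_ge_zero[THEN order_trans] by force
qed

lemma quad_atI_bounded:
  fixes f :: "'a::euclidean_space \<Rightarrow> real"
  assumes f: "f \<in> borel_measurable lebesgue" "\<And>v. \<bar>f v\<bar> \<le> B"
    and r: "0 < r" "\<And>z. norm z < r \<Longrightarrow> \<bar>f (x + z) - f x - l \<bullet> z\<bar> \<le> k * (norm z)\<^sup>2"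
  shows "\<exists>C. quad_at x l C f"
proof -
  define \<rho> where "\<rho> = min 1 r"
  have \<rho>: "0 < \<rho>" "\<rho> \<le> 1" "\<rho> \<le> r" using r by (auto simp: \<rho>_def)
  \<comment> \<open>Inside radius \<open>\<rho>\<close> the first summand suffices. Outside, the
    crude bound \<open>2 * B + norm l\<close> is divided by \<open>\<rho>\<^sup>2\<close>, a lower
    bound of \<open>msq\<close> there.\<close>
  define C where "C = \<bar>k\<bar> + (2 * B + norm l) / \<rho>\<^sup>2"
  have B: "0 \<le> B" using f(2)[of 0] by linarith
  have "\<bar>quad_rem x l f z\<bar> \<le> C * msq z" for z
  proof (cases "norm z < \<rho>")
    case True
    then have "(norm z)\<^sup>2 \<le> 1" using \<rho> by (auto intro: power_le_one)
    have "k * (norm z)\<^sup>2 \<le> C * (norm z)\<^sup>2"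
      unfolding C_def using B by (intro mult_right_mono add_increasing2) auto
    with r(2)[of z] True \<rho> \<open>(norm z)\<^sup>2 \<le> 1\<close> show ?thesis by (simp add: min_absorb2)
  next
    case False
    have "\<bar>if norm z < 1 then l \<bullet> z else 0\<bar> \<le> norm l"
      using Cauchy_Schwarz_ineq2[of l z] mult_left_mono[of "norm z" 1 "norm l"] by auto
    then have 1: "\<bar>quad_rem x l f z\<bar> \<le> 2 * B + norm l"
      using f(2)[of "x + z"] f(2)[of x] by linarith
    have "\<rho>\<^sup>2 \<le> msq z" using False \<rho> by (auto intro: power_mono power_le_one)
    moreover have "0 < \<rho>\<^sup>2" using \<rho> by simp
    ultimately have "(2 * B + norm l) \<le> (2 * B + norm l) / \<rho>\<^sup>2 * msq z"
      using mult_left_mono[of "\<rho>\<^sup>2" "msq z" "(2 * B + norm l) / \<rho>\<^sup>2"] B by auto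
    also have "\<dots> \<le> C * msq z"
      unfolding C_def by (intro mult_right_mono) auto
    finally show ?thesis using 1 by linarith
  qed
  then show ?thesis using f unfolding quad_at_def by blast
qed

lemma min_sq_le: "msq z \<le> min 1 (norm z)"
proof (cases "norm z \<le> 1")
  case True
  then have "norm z * norm z \<le> norm z * 1" by (intro mult_left_mono) auto
  then show ?thesis using True by (auto simp: power2_eq_square)
qed auto

lemma min_power2: "(min 1 (norm z))\<^sup>2 = msq z"
proof (cases "norm z \<le> 1")
  case True
  then show ?thesis using power_le_one[of "norm z" 2] by (simp add: min_absorb2)
next
  case False
  then show ?thesis using one_le_power[of "norm z" 2] by (simp add: min_absorb1)
qed

lemma quad_at_diff_le:
  assumes "quad_at x l C f"
  shows "\<bar>f (x + z) - f x\<bar> \<le> (norm l + C) * min 1 (norm z)"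
proof -
  have "\<bar>if norm z < 1 then l \<bullet> z else 0\<bar> \<le> norm l * min 1 (norm z)"
    using Cauchy_Schwarz_ineq2[of l z] by auto
  moreover have "C * msq z \<le> C * min 1 (norm z)"
    using quad_at_nonneg[OF assms] min_sq_le by (intro mult_left_mono) auto
  ultimately show ?thesis
    using quad_at_bound[OF assms, of z] by (simp add: distrib_right)
qed

lemma quad_at_lin:
  fixes x :: "'a::euclidean_space"
  assumes "quad_at x l C f" "quad_at x m D g"
  shows "quad_at x (a *\<^sub>R l + b *\<^sub>R m) (\<bar>a\<bar> * C + \<bar>b\<bar> * D) (\<lambda>v. a * f v + b * g v)"
  unfolding quad_at_def
proof (intro conjI allI)
  show "(\<lambda>v. a * f v + b * g v) \<in> borel_measurable lebesgue"
    using assms[THEN quad_at_measurable] by measurable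
  fix z :: 'a
  define p where "p = quad_rem x l f z"
  define q where "q = g (x + z) - g x - (if norm z < 1 then m \<bullet> z else 0)"
  have "\<bar>a * f (x + z) + b * g (x + z) - (a * f x + b * g x) - (if norm z < 1 then (a *\<^sub>R l + b *\<^sub>R m) \<bullet> z else 0)\<bar>
      = \<bar>a * p + b * q\<bar>"
    by (simp add: p_def q_def algebra_simps)
  also have "\<dots> \<le> \<bar>a\<bar> * \<bar>p\<bar> + \<bar>b\<bar> * \<bar>q\<bar>"
    using abs_triangle_ineq[of "a * p" "b * q"] by (simp add: abs_mult)
  also have "\<dots> \<le> \<bar>a\<bar> * (C * msq z) + \<bar>b\<bar> * (D * msq z)"
    using assms[THEN quad_at_bound, of z] unfolding p_def q_def
    by (intro add_mono mult_left_mono) auto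
  finally show "\<bar>a * f (x + z) + b * g (x + z) - (a * f x + b * g x) - (if norm z < 1 then (a *\<^sub>R l + b *\<^sub>R m) \<bullet> z else 0)\<bar>
      \<le> (\<bar>a\<bar> * C + \<bar>b\<bar> * D) * msq z"
    by (simp add: algebra_simps)
qed

lemma measurable_quad_remainder:
  assumes "f \<in> borel_measurable lebesgue"
  shows "(\<lambda>z. quad_rem x l f z) \<in> borel_measurable lebesgue"
proof -
  have "(\<lambda>z. if norm z < 1 then l \<bullet> z else 0) \<in> borel_measurable borel" by measurable
  then have "(\<lambda>z. if norm z < 1 then l \<bullet> z else 0) \<in> borel_measurable lebesgue"
    by (auto intro: measurable_completion)
  then show ?thesis using measurable_lebesgue_shift[OF assms, of x] by measurable
qed

lemma integrable_quad_remainder: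
  assumes "0 < s" "s < 1" "quad_at x l C f"
  shows "integrable lebesgue (\<lambda>z. quad_rem x l f z * frac_kernel s z)"
  by (rule integrable_kernel_bound[OF assms(1,2) measurable_quad_remainder[OF quad_at_measurable[OF assms(3)]]
        quad_at_bound[OF assms(3)]])

lemma integrable_indicator_norm:
  fixes G :: "'a::euclidean_space \<Rightarrow> real"
  assumes "integrable lebesgue G"
  shows "integrable lebesgue (\<lambda>z. indicator {z. \<epsilon> < norm z} z * G z)"
proof -
  have "open {z::'a. \<epsilon> < norm z}" by (intro open_Collect_less continuous_intros)
  then have "{z::'a. \<epsilon> < norm z} \<in> sets lebesgue" by (auto intro: sets_completionI_sets)
  then show ?thesis using integrable_mult_indicator[OF _ assms] by (simp add: mult.commute)
qed

text \<open>Each truncated integral is unchanged when the compensator \<open>l \<bullet> z\<close>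
  is subtracted on the unit ball, because the truncated compensator is integrable and odd, hence has
  integral 0 by reflection. The compensated integrand is absolutely integrable, so the truncation
  can be removed by dominated convergence.\<close>

lemma frac_lap_quad:
  fixes x :: "'a::euclidean_space"
  assumes s: "0 < s" "s < 1" and f: "quad_at x l C f"
  shows "frac_lap s f x = - frac_const DIM('a) s *
    (LINT z|lebesgue. quad_rem x l f z * frac_kernel s z)"
proof -
  define L where "L z = (if norm z < 1 then l \<bullet> z else 0)" for z
  define G where "G z = (f (x + z) - f x - L z) * frac_kernel s z" for z
  have G: "integrable lebesgue G"
    using integrable_quad_remainder[OF s f] by (simp add: G_def[abs_def] L_def)
  have Lm: "L \<in> borel_measurable borel" unfolding L_def by measurable
  have trunc: "(LINT y:{y. norm (x - y) > \<epsilon>}|lebesgue. (f x - f y) / norm (x - y) powr (real DIM('a) + 2 * s))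
      = - (LINT z|lebesgue. indicator {z. \<epsilon> < norm z} z * G z)" if "0 < \<epsilon>" for \<epsilon>
  proof -
    let ?T = "\<lambda>z. indicator {z. \<epsilon> < norm z} z * (L z * frac_kernel s z)"
    let ?q = "\<lambda>z. indicator {z. \<epsilon> < norm z} z * L z"
    have "?q \<in> borel_measurable borel" using Lm by measurable
    then have q: "?q \<in> borel_measurable lebesgue" by (auto intro: measurable_completion)
    \<comment> \<open>Beyond distance \<open>\<epsilon>\<close> one has
      \<open>norm z \<le> (norm z)\<^sup>2 / \<epsilon>\<close>; the constant blows up with the
      truncation, but only integrability for fixed \<open>\<epsilon>\<close> is used.\<close>
    have "\<bar>?q z\<bar> \<le> norm l / \<epsilon> * msq z" for z
    proof -
      have "\<bar>l \<bullet> z\<bar> \<le> norm l / \<epsilon> * msq z" if "norm z < 1" "\<epsilon> < norm z"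
      proof -
        have "norm z * \<epsilon> \<le> norm z * norm z" using that by (intro mult_left_mono) auto
        then have "norm z \<le> (norm z)\<^sup>2 / \<epsilon>"
          using \<open>0 < \<epsilon>\<close> by (simp add: field_simps power2_eq_square)
        then have "norm l * norm z \<le> norm l * ((norm z)\<^sup>2 / \<epsilon>)" by (intro mult_left_mono) auto
        moreover have "(norm z)\<^sup>2 \<le> 1" using that by (intro power_le_one) auto
        ultimately show ?thesis using Cauchy_Schwarz_ineq2[of l z] by (simp add: min_absorb2)
      qed
      then show ?thesis using \<open>0 < \<epsilon>\<close> by (auto simp: L_def indicator_def)
    qed
    from integrable_kernel_bound[OF s q this] have T: "integrable lebesgue ?T" by (simp add: mult.assoc)
    have odd: "?T (- z) = - ?T z" for z by (simp add: L_def indicator_def)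
    have "(LINT z|lebesgue. ?T z) = (LINT z|lebesgue. ?T (- z))"
      by (rule integral_lebesgue_reflect[symmetric])
    also have "\<dots> = - (LINT z|lebesgue. ?T z)"
      unfolding odd by (rule Bochner_Integration.integral_minus)
    finally have T0: "(LINT z|lebesgue. ?T z) = 0" by simp
    have iG: "integrable lebesgue (\<lambda>z. indicator {z. \<epsilon> < norm z} z * G z)"
      by (rule integrable_indicator_norm[OF G])
    have "(LINT y:{y. norm (x - y) > \<epsilon>}|lebesgue. (f x - f y) / norm (x - y) powr (real DIM('a) + 2 * s))
       = (LINT z|lebesgue. - (indicator {z. \<epsilon> < norm z} z * G z) - ?T z)"
      unfolding set_lebesgue_integral_def
      by (subst integral_lebesgue_shift[of _ x, symmetric])
        (auto intro!: Bochner_Integration.integral_cong simp: indicator_def G_def frac_kernel_def diff_divide_distrib add_divide_distrib algebra_simps)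
    also have "\<dots> = (LINT z|lebesgue. - (indicator {z. \<epsilon> < norm z} z * G z)) - (LINT z|lebesgue. ?T z)"
      using iG T by (intro Bochner_Integration.integral_diff) auto
    finally show ?thesis using T0 by simp
  qed
  have lim: "((\<lambda>\<epsilon>. LINT z|lebesgue. indicator {z. \<epsilon> < norm z} z * G z) \<longlongrightarrow> (LINT z|lebesgue. G z)) (at_right 0)"
  proof (rule tendsto_at_right_sequentially[of 0 1])
    fix S :: "nat \<Rightarrow> real" assume S: "\<And>n. 0 < S n" "S \<longlonglongrightarrow> 0"
    show "(\<lambda>n. LINT z|lebesgue. indicator {z. S n < norm z} z * G z) \<longlonglongrightarrow> (LINT z|lebesgue. G z)"
    proof (rule integral_dominated_convergence[where w = "\<lambda>z. norm (G z)"])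
      show "integrable lebesgue (\<lambda>z. norm (G z))" using G by (rule integrable_norm)
      show "AE z in lebesgue. (\<lambda>n. indicator {z. S n < norm z} z * G z) \<longlonglongrightarrow> G z"
      proof (rule AE_I2)
        fix z :: 'a
        show "(\<lambda>n. indicator {z. S n < norm z} z * G z) \<longlonglongrightarrow> G z"
        proof (cases "z = 0")
          case True
          then show ?thesis by (simp add: G_def frac_kernel_def)
        next
          case False
          then have "\<forall>\<^sub>F n in sequentially. S n < norm z" using S(2) by (intro order_tendstoD) auto
          then have "\<forall>\<^sub>F n in sequentially. indicator {z. S n < norm z} z * G z = G z"
            by (rule eventually_mono) simp
          then show ?thesis by (rule tendsto_eventually)
        qed
      qed
      show "(\<lambda>z. indicator {z. S n < norm z} z * G z) \<in> borel_measurable lebesgue" for n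
        by (rule borel_measurable_integrable[OF integrable_indicator_norm[OF G]])
      show "AE z in lebesgue. norm (indicator {z. S n < norm z} z * G z) \<le> norm (G z)" for n
        by (auto simp: indicator_def)
    qed (rule borel_measurable_integrable[OF G])
  qed simp
  \<comment> \<open>\<open>frac_lap\<close> is defined by \<open>Lim\<close>, which identifies the
    value only after convergence has been shown.\<close>
  have "((\<lambda>\<epsilon>. frac_const DIM('a) s * (LINT y:{y. norm (x - y) > \<epsilon>}|lebesgue. (f x - f y) / norm (x - y) powr (real DIM('a) + 2 * s)))
     \<longlongrightarrow> frac_const DIM('a) s * - (LINT z|lebesgue. G z)) (at_right 0)"
    using lim by (intro tendsto_mult tendsto_const tendsto_eq_rhs[OF Lim_transform_eventually[OF tendsto_minus[OF lim]]])
      (auto simp: eventually_at_right_less trunc intro!: eventually_mono[OF eventually_at_right_less])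
  then show ?thesis
    unfolding frac_lap_def by (subst tendsto_Lim) (auto simp: G_def[abs_def] L_def)
qed

section \<open>Finiteness of the bilinear form\<close>

definition kernel_mass :: "'a::euclidean_space itself \<Rightarrow> real \<Rightarrow> real" where
  "kernel_mass _ s = (LINT z::'a|lebesgue. msq z * frac_kernel s z)"

lemma kernel_mass_nonneg: "0 \<le> kernel_mass TYPE('a::euclidean_space) s"
  unfolding kernel_mass_def by (intro Bochner_Integration.integral_nonneg) simp

text \<open>Increments of a function with an expansion at \<open>x\<close> are of order
  \<open>min 1 (norm z)\<close>, so this condition on \<open>h\<close> makes its form with every
  such function absolutely convergent. It lets \<open>h\<close> be unbounded, as members of
  \<open>L1w\<close> may be.\<close>

definition form_admissible :: "real \<Rightarrow> 'a::euclidean_space \<Rightarrow> ('a \<Rightarrow> real) \<Rightarrow> bool" where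
  "form_admissible s x h \<longleftrightarrow> h \<in> borel_measurable lebesgue \<and>
    integrable lebesgue (\<lambda>z. min 1 (norm z) * \<bar>h (x + z) - h x\<bar> * frac_kernel s z)"

lemma lebesgue_measurable_norm_fun:
  assumes "g \<in> borel_measurable borel"
  shows "(\<lambda>z::'a::euclidean_space. g (norm z) :: real) \<in> borel_measurable lebesgue"
proof -
  have "(\<lambda>z::'a. g (norm z)) \<in> borel_measurable borel" using assms by measurable
  then show ?thesis by (auto intro: measurable_completion)
qed

lemma measurable_Bform_integrand:
  fixes x :: "'a::euclidean_space"
  assumes "u \<in> borel_measurable lebesgue" "v \<in> borel_measurable lebesgue"
  shows "(\<lambda>z. (u (x + z) - u x) * (v (x + z) - v x) * frac_kernel s z) \<in> borel_measurable lebesgue"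
  using assms[THEN measurable_lebesgue_shift, of x] by measurable

lemma abs_Bform_integrand_le:
  fixes x :: "'a::euclidean_space"
  assumes "\<bar>u (x + z) - u x\<bar> \<le> D * min 1 (norm z)"
  shows "\<bar>(u (x + z) - u x) * (v (x + z) - v x) * frac_kernel s z\<bar>
    \<le> D * (min 1 (norm z) * \<bar>v (x + z) - v x\<bar> * frac_kernel s z)"
proof -
  have "\<bar>u (x + z) - u x\<bar> * (\<bar>v (x + z) - v x\<bar> * frac_kernel s z)
      \<le> D * min 1 (norm z) * (\<bar>v (x + z) - v x\<bar> * frac_kernel s z)"
    using assms by (intro mult_right_mono) auto
  then show ?thesis by (simp add: abs_mult mult.assoc)
qed

lemma form_admissible_lipschitz:
  fixes x :: "'a::euclidean_space"
  assumes "0 < s" "s < 1" "f \<in> borel_measurable lebesgue"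
    and "\<And>z. \<bar>f (x + z) - f x\<bar> \<le> D * min 1 (norm z)"
  shows "form_admissible s x f"
  unfolding form_admissible_def
proof (rule conjI[OF assms(3)], rule integrable_kernel_bound[OF assms(1,2)])
  show "(\<lambda>z. min 1 (norm z) * \<bar>f (x + z) - f x\<bar>) \<in> borel_measurable lebesgue"
    using measurable_lebesgue_shift[OF assms(3), of x] lebesgue_measurable_norm_fun[of "\<lambda>t. min 1 t"]
    by measurable
  fix z :: 'a
  have "min 1 (norm z) * \<bar>f (x + z) - f x\<bar> \<le> min 1 (norm z) * (D * min 1 (norm z))"
    using assms(4)[of z] by (intro mult_left_mono) auto
  also have "\<dots> = D * msq z"
    unfolding min_power2[symmetric] by (simp add: power2_eq_square)
  finally show "\<bar>min 1 (norm z) * \<bar>f (x + z) - f x\<bar>\<bar> \<le> D * msq z" by (simp add: abs_mult)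
qed

lemma quad_at_admissible:
  assumes "0 < s" "s < 1" "quad_at x l C f"
  shows "form_admissible s x f"
  using assms quad_at_diff_le[OF assms(3)] quad_at_measurable[OF assms(3)]
  by (intro form_admissible_lipschitz)

lemma Bform_finite_quad:
  assumes "quad_at x l C f" "form_admissible s x h"
  shows "Bform_finite s f h x"
  unfolding Bform_finite_eq
proof (rule Bochner_Integration.integrable_bound)
  show "integrable lebesgue (\<lambda>z. (norm l + C) * (min 1 (norm z) * \<bar>h (x + z) - h x\<bar> * frac_kernel s z))"
    using assms(2) unfolding form_admissible_def by (intro integrable_mult_right) auto
  show "AE z in lebesgue. norm ((f (x + z) - f x) * (h (x + z) - h x) * frac_kernel s z)
      \<le> norm ((norm l + C) * (min 1 (norm z) * \<bar>h (x + z) - h x\<bar> * frac_kernel s z))"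
    using abs_Bform_integrand_le[OF quad_at_diff_le[OF assms(1)], of _ h s]
    by (intro AE_I2) (metis abs_ge_self order_trans real_norm_def)
qed (use assms(2) quad_at_measurable[OF assms(1)] in \<open>auto simp: form_admissible_def intro: measurable_Bform_integrand\<close>)

lemma square_kernel_nonneg: "0 \<le> d * d * frac_kernel s z"
  by (rule mult_nonneg_nonneg) simp_all

lemma Bform_nonneg:
  fixes x :: "'a::euclidean_space"
  assumes "0 < s" "s < 1"
  shows "0 \<le> Bform s u u x"
  unfolding Bform_eq using frac_const_pos[OF assms, of "DIM('a)"]
  by (intro mult_nonneg_nonneg[OF _ Bochner_Integration.integral_nonneg] square_kernel_nonneg) simp_all

lemma Bform_self_le:
  fixes x :: "'a::euclidean_space"
  assumes s: "0 < s" "s < 1" and "\<And>z. (u (x + z) - u x)\<^sup>2 \<le> D * msq z"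
  shows "Bform s u u x \<le> frac_const DIM('a) s / 2 * (D * kernel_mass TYPE('a) s)"
proof -
  have "(LINT z|lebesgue. (u (x + z) - u x) * (u (x + z) - u x) * frac_kernel s z)
      \<le> (LINT z|lebesgue. D * (msq (z::'a) * frac_kernel s z))"
  proof (rule Bochner_Integration.integral_mono')
    show "integrable lebesgue (\<lambda>z::'a. D * (msq z * frac_kernel s z))"
      using integrable_kernel[OF s] by (intro integrable_mult_right)
    fix z :: 'a
    show "(u (x + z) - u x) * (u (x + z) - u x) * frac_kernel s z \<le> D * (msq z * frac_kernel s z)"
      using mult_right_mono[OF assms(3)[of z], of "frac_kernel s z"]
      by (simp add: power2_eq_square mult.assoc)
    have "0 \<le> D * msq z" using assms(3)[of z] zero_le_power2 order_trans by blast
    then show "0 \<le> D * (msq z * frac_kernel s z)"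
      using mult_nonneg_nonneg[of "D * msq z" "frac_kernel s z"] by (simp add: mult.assoc)
  qed
  then show ?thesis
    unfolding Bform_eq kernel_mass_def using frac_const_pos[OF s, of "DIM('a)"]
    by (intro mult_left_mono) auto
qed

section \<open>Limits and linearity of the operators at a point\<close>

lemma quad_at_limit:
  fixes x :: "'a::euclidean_space"
  assumes F: "\<And>n. quad_at x l C (F n)" and lim: "\<And>v. (\<lambda>n. F n v) \<longlonglongrightarrow> f v"
  shows "quad_at x l C f"
  unfolding quad_at_def
proof (intro conjI allI)
  show "f \<in> borel_measurable lebesgue"
    by (rule borel_measurable_LIMSEQ_real[OF lim quad_at_measurable[OF F]])
  fix z :: 'a
  show "\<bar>quad_rem x l f z\<bar> \<le> C * msq z"
  proof (rule LIMSEQ_le_const2)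
    show "(\<lambda>n. \<bar>quad_rem x l (F n) z\<bar>)
      \<longlonglongrightarrow> \<bar>quad_rem x l f z\<bar>"
      by (intro tendsto_intros lim)
  qed (use quad_at_bound[OF F] in blast)
qed

text \<open>The common slope \<open>l\<close> and constant \<open>C\<close> provide the majorant, so
  pointwise convergence of the functions is enough for convergence of the operator.\<close>

lemma frac_lap_tendsto:
  fixes x :: "'a::euclidean_space"
  assumes s: "0 < s" "s < 1"
    and F: "\<And>n. quad_at x l C (F n)" and lim: "\<And>v. (\<lambda>n. F n v) \<longlonglongrightarrow> f v"
  shows "(\<lambda>n. frac_lap s (F n) x) \<longlonglongrightarrow> frac_lap s f x"
proof -
  note f = quad_at_limit[OF F lim]
  have "(\<lambda>n. LINT z|lebesgue. quad_rem x l (F n) z * frac_kernel s z)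
    \<longlonglongrightarrow> (LINT z|lebesgue. quad_rem x l f z * frac_kernel s z)"
    by (intro integral_kernel_tendsto[OF s _ quad_at_bound[OF F]] measurable_quad_remainder
        quad_at_measurable[OF F] tendsto_intros lim)
  then show ?thesis
    unfolding frac_lap_quad[OF s F] frac_lap_quad[OF s f] by (intro tendsto_intros)
qed

lemma Bform_tendsto:
  fixes x :: "'a::euclidean_space"
  assumes F: "\<And>n. quad_at x l C (F n)" and lim: "\<And>v. (\<lambda>n. F n v) \<longlonglongrightarrow> f v"
    and h: "form_admissible s x h"
  shows "(\<lambda>n. Bform s (F n) h x) \<longlonglongrightarrow> Bform s f h x"
  unfolding Bform_eq
proof (intro tendsto_mult tendsto_const integral_dominated_convergence)
  show "integrable lebesgue (\<lambda>z. (norm l + C) * (min 1 (norm z) * \<bar>h (x + z) - h x\<bar> * frac_kernel s z))"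
    using h unfolding form_admissible_def by (intro integrable_mult_right) auto
  show "AE z in lebesgue. norm ((F n (x + z) - F n x) * (h (x + z) - h x) * frac_kernel s z)
      \<le> (norm l + C) * (min 1 (norm z) * \<bar>h (x + z) - h x\<bar> * frac_kernel s z)" for n
    using abs_Bform_integrand_le[OF quad_at_diff_le[OF F[of n]], of _ h s]
    by (intro AE_I2) (simp only: real_norm_def)
  show "AE z in lebesgue. (\<lambda>n. (F n (x + z) - F n x) * (h (x + z) - h x) * frac_kernel s z)
       \<longlonglongrightarrow> (f (x + z) - f x) * (h (x + z) - h x) * frac_kernel s z"
    by (intro AE_I2 tendsto_intros lim)
qed (use h in \<open>auto simp: form_admissible_def
    intro!: measurable_Bform_integrand quad_at_measurable[OF F] quad_at_measurable[OF quad_at_limit[OF F lim]]\<close>)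

lemma Bform_self_tendsto:
  fixes x :: "'a::euclidean_space"
  assumes s: "0 < s" "s < 1"
    and F: "\<And>n. quad_at x l C (F n)" and lim: "\<And>v. (\<lambda>n. F n v) \<longlonglongrightarrow> f v"
  shows "(\<lambda>n. Bform s (F n) (F n) x) \<longlonglongrightarrow> Bform s f f x"
  unfolding Bform_eq
proof (intro tendsto_mult_left integral_kernel_tendsto[OF s])
  show "(\<lambda>z. (F n (x + z) - F n x) * (F n (x + z) - F n x)) \<in> borel_measurable lebesgue" for n
    using measurable_lebesgue_shift[OF quad_at_measurable[OF F[of n]], of x] by measurable
  fix n and z :: 'a
  have "\<bar>F n (x + z) - F n x\<bar>\<^sup>2 \<le> ((norm l + C) * min 1 (norm z))\<^sup>2"
    using quad_at_diff_le[OF F] by (intro power_mono) auto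
  then show "\<bar>(F n (x + z) - F n x) * (F n (x + z) - F n x)\<bar> \<le> (norm l + C)\<^sup>2 * msq z"
    by (simp add: power_mult_distrib min_power2 power2_eq_square[symmetric])
qed (intro tendsto_intros lim)

lemma frac_lap_lin:
  fixes x :: "'a::euclidean_space"
  assumes s: "0 < s" "s < 1" and f: "quad_at x l C f" and g: "quad_at x m D g"
  shows "frac_lap s (\<lambda>v. a * f v + b * g v) x = a * frac_lap s f x + b * frac_lap s g x"
proof -
  let ?R = "\<lambda>f l z. quad_rem x l f z * frac_kernel s z"
  have "?R (\<lambda>v. a * f v + b * g v) (a *\<^sub>R l + b *\<^sub>R m) = (\<lambda>z. a * ?R f l z + b * ?R g m z)"
    by (auto simp: fun_eq_iff algebra_simps)
  then have "(LINT z|lebesgue. ?R (\<lambda>v. a * f v + b * g v) (a *\<^sub>R l + b *\<^sub>R m) z)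
      = a * (LINT z|lebesgue. ?R f l z) + b * (LINT z|lebesgue. ?R g m z)"
    using integrable_quad_remainder[OF s f] integrable_quad_remainder[OF s g]
    by (simp only: Bochner_Integration.integral_add integrable_mult_right integral_mult_right_zero)
  then show ?thesis
    unfolding frac_lap_quad[OF s f] frac_lap_quad[OF s g] frac_lap_quad[OF s quad_at_lin[OF f g]]
    by (simp add: algebra_simps)
qed

lemma Bform_lin:
  fixes x :: "'a::euclidean_space"
  assumes "Bform_finite s f h x" "Bform_finite s g h x"
  shows "Bform s (\<lambda>v. a * f v + b * g v) h x = a * Bform s f h x + b * Bform s g h x"
proof -
  let ?R = "\<lambda>f z. (f (x + z) - f x) * (h (x + z) - h x) * frac_kernel s z"
  have "?R (\<lambda>v. a * f v + b * g v) = (\<lambda>z. a * ?R f z + b * ?R g z)"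
    by (auto simp: fun_eq_iff algebra_simps)
  then have "(LINT z|lebesgue. ?R (\<lambda>v. a * f v + b * g v) z) = a * (LINT z|lebesgue. ?R f z) + b * (LINT z|lebesgue. ?R g z)"
    using assms unfolding Bform_finite_eq
    by (simp only: Bochner_Integration.integral_add integrable_mult_right integral_mult_right_zero)
  then show ?thesis unfolding Bform_eq by (simp add: algebra_simps)
qed

text \<open>Pointwise \<open>(p + q)\<^sup>2 \<le> 2 p\<^sup>2 + 2 q\<^sup>2\<close>. This replaces
  the triangle inequality for \<open>Ds\<close>; only the order of growth of the energies matters
  later.\<close>

lemma Bform_self_lin_le:
  fixes x :: "'a::euclidean_space"
  assumes s: "0 < s" "s < 1" and fg: "Bform_finite s f f x" "Bform_finite s g g x"
  shows "Bform s (\<lambda>v. a * f v + b * g v) (\<lambda>v. a * f v + b * g v) x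
    \<le> 2 * a\<^sup>2 * Bform s f f x + 2 * b\<^sup>2 * Bform s g g x"
proof -
  let ?R = "\<lambda>f z. (f (x + z) - f x) * (f (x + z) - f x) * frac_kernel s z"
  have "(LINT z|lebesgue. ?R (\<lambda>v. a * f v + b * g v) z)
      \<le> (LINT z|lebesgue. 2 * a\<^sup>2 * ?R f z + 2 * b\<^sup>2 * ?R g z)"
  proof (rule Bochner_Integration.integral_mono')
    show "integrable lebesgue (\<lambda>z. 2 * a\<^sup>2 * ?R f z + 2 * b\<^sup>2 * ?R g z)"
      using fg unfolding Bform_finite_eq by (intro Bochner_Integration.integrable_add integrable_mult_right)
    fix z
    define p q where "p = a * (f (x + z) - f x)" and "q = b * (g (x + z) - g x)"
    have "(p + q) * (p + q) \<le> 2 * p\<^sup>2 + 2 * q\<^sup>2"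
      using zero_le_power2[of "p - q"] by (simp add: power2_eq_square algebra_simps)
    then have "(p + q) * (p + q) * frac_kernel s z \<le> (2 * p\<^sup>2 + 2 * q\<^sup>2) * frac_kernel s z"
      by (rule mult_right_mono) simp
    also have "\<dots> = 2 * a\<^sup>2 * ?R f z + 2 * b\<^sup>2 * ?R g z"
      by (simp add: p_def q_def power2_eq_square distrib_right)
    also have "(p + q) * (p + q) * frac_kernel s z = ?R (\<lambda>v. a * f v + b * g v) z"
      by (simp add: p_def q_def right_diff_distrib add_diff_add)
    finally show "?R (\<lambda>v. a * f v + b * g v) z \<le> 2 * a\<^sup>2 * ?R f z + 2 * b\<^sup>2 * ?R g z" .
    show "0 \<le> 2 * a\<^sup>2 * ?R f z + 2 * b\<^sup>2 * ?R g z"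
      by (intro add_nonneg_nonneg mult_nonneg_nonneg[OF _ square_kernel_nonneg]) simp_all
  qed
  also have "\<dots> = 2 * a\<^sup>2 * (LINT z|lebesgue. ?R f z) + 2 * b\<^sup>2 * (LINT z|lebesgue. ?R g z)"
    using fg unfolding Bform_finite_eq
    by (simp only: Bochner_Integration.integral_add integrable_mult_right integral_mult_right_zero)
  finally have "frac_const DIM('a) s / 2 * (LINT z|lebesgue. ?R (\<lambda>v. a * f v + b * g v) z)
      \<le> frac_const DIM('a) s / 2 * (2 * a\<^sup>2 * (LINT z|lebesgue. ?R f z) + 2 * b\<^sup>2 * (LINT z|lebesgue. ?R g z))"
    using frac_const_pos[OF s, of "DIM('a)"] by (intro mult_left_mono) auto
  then show ?thesis unfolding Bform_eq by (simp add: algebra_simps)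
qed

section \<open>Functions of class C2\<close>

lemma Ck_on_cong:
  assumes "open S" "\<And>x. x \<in> S \<Longrightarrow> f x = g x" "Ck_on k f S"
  shows "Ck_on k g S"
  using assms(2,3)
proof (induction k arbitrary: f g)
  case 0
  then show ?case using continuous_on_cong[of S S f g] by simp
next
  case (Suc k)
  have f: "f differentiable at x" if "x \<in> S" for x
    using Suc.prems(2) that at_within_open[OF that \<open>open S\<close>] by (auto simp: differentiable_on_def)
  have D: "frechet_derivative f (at x) = frechet_derivative g (at x)" if "x \<in> S" for x
    using frechet_derivative_transform_within_open[OF f[OF that] \<open>open S\<close> that] Suc.prems(1) by blast
  have "g differentiable_on S"
    unfolding differentiable_on_def
  proof
    fix x assume "x \<in> S"
    then have "(f has_derivative frechet_derivative f (at x)) (at x)"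
      using f frechet_derivative_works by blast
    then have "(g has_derivative frechet_derivative f (at x)) (at x)"
      using has_derivative_transform_within_open[OF _ \<open>open S\<close> \<open>x \<in> S\<close>] Suc.prems(1) by blast
    then show "g differentiable at x within S"
      using differentiable_at_withinI differentiableI by blast
  qed
  moreover have "Ck_on k (\<lambda>x. frechet_derivative g (at x) b) S" if "b \<in> Basis" for b
    by (rule Suc.IH[of "\<lambda>x. frechet_derivative f (at x) b"]) (use Suc.prems(2) that D in auto)
  ultimately show ?case by simp
qed

lemma Ck_on_Suc_imp: "Ck_on (Suc k) f S \<Longrightarrow> Ck_on k f S"
proof (induction k arbitrary: f)
  case 0
  then show ?case by (simp add: differentiable_imp_continuous_on)
next
  case (Suc k)
  have "Ck_on k (\<lambda>x. frechet_derivative f (at x) b) S" if "b \<in> Basis" for b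
    by (rule Suc.IH) (use Suc.prems that in simp)
  then show ?case using Suc.prems by simp
qed

text \<open>Structural induction, carrying along that each directional derivative is again
  polynomial. This closure is what the induction on the order of smoothness uses, and polynomials
  are the source of \<open>C^2\<close> test functions.\<close>

lemma real_polynomial_function_derivative:
  assumes "real_polynomial_function f"
  shows "\<exists>D. (\<forall>x. (f has_derivative D x) (at x)) \<and> (\<forall>b. real_polynomial_function (\<lambda>x. D x b))"
  using assms
proof induction
  case (linear f)
  show ?case
    using bounded_linear_imp_has_derivative[OF linear] by (intro exI[of _ "\<lambda>_. f"]) auto
next
  case (const c)
  show ?case by (intro exI[of _ "\<lambda>_ _. 0"]) auto
next
  case (add f g)
  then obtain D E where "\<forall>x. (f has_derivative D x) (at x)" "\<forall>b. real_polynomial_function (\<lambda>x. D x b)"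
    "\<forall>x. (g has_derivative E x) (at x)" "\<forall>b. real_polynomial_function (\<lambda>x. E x b)" by blast
  then show ?case by (intro exI[of _ "\<lambda>x b. D x b + E x b"]) (auto intro: has_derivative_add)
next
  case (mult f g)
  then obtain D E where *: "\<forall>x. (f has_derivative D x) (at x)" "\<forall>b. real_polynomial_function (\<lambda>x. D x b)"
    "\<forall>x. (g has_derivative E x) (at x)" "\<forall>b. real_polynomial_function (\<lambda>x. E x b)" by blast
  have "((\<lambda>x. f x * g x) has_derivative (\<lambda>b. f x * E x b + D x b * g x)) (at x)" for x
    using * by (intro has_derivative_mult) auto
  moreover have "real_polynomial_function (\<lambda>x. f x * E x b + D x b * g x)" for b
    using * mult(1,2) by (intro real_polynomial_function.intros(3,4)) auto
  ultimately show ?case by (intro exI[of _ "\<lambda>x b. f x * E x b + D x b * g x"]) blast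
qed

lemma Ck_on_real_polynomial_function: "real_polynomial_function f \<Longrightarrow> Ck_on k f S"
proof (induction k arbitrary: f)
  case 0
  then show ?case
    by (simp add: continuous_on_polymonial_function real_polynomial_function_eq)
next
  case (Suc k)
  obtain D where D: "\<And>x. (f has_derivative D x) (at x)" "\<And>b. real_polynomial_function (\<lambda>x. D x b)"
    using real_polynomial_function_derivative[OF Suc.prems] by blast
  have "frechet_derivative f (at x) = D x" for x
    using frechet_derivative_at[OF D(1)] by simp
  then show ?case
    using Suc.IH[OF D(2)] differentiable_on_real_polynomial_function[OF Suc.prems] by simp
qed

text \<open>The second partial derivatives are continuous, hence bounded on the compact ball, and
  the ball is convex, so the mean value inequality makes each partial derivative Lipschitz.
  \<open>p\<close> collects the partial derivatives into the gradient vector.\<close>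

lemma C2_gradient_lipschitz:
  fixes f :: "'a::euclidean_space \<Rightarrow> real"
  assumes f: "Ck_on 2 f S" and S: "open S" "cball c r \<subseteq> S"
  shows "\<exists>D p. 0 \<le> D \<and> (\<forall>x\<in>cball c r. (f has_derivative (\<lambda>z. p x \<bullet> z)) (at x)) \<and>
    (\<forall>x\<in>cball c r. \<forall>y\<in>cball c r. norm (p x - p y) \<le> D * norm (x - y))"
proof -
  define G where "G b x = frechet_derivative f (at x) b" for b x
  have f1: "f differentiable_on S" and G1: "\<And>b. b \<in> Basis \<Longrightarrow> Ck_on (Suc 0) (G b) S"
    using f unfolding numeral_2_eq_2 Ck_on.simps(2)[of "Suc 0"] G_def[abs_def] by blast+
  have fd: "f differentiable at x" if "x \<in> S" for x
    using f1 that unfolding differentiable_on_eq_differentiable_at[OF S(1)] by blast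
  have Gd: "G b differentiable at x" if "x \<in> S" "b \<in> Basis" for x b
  proof -
    have "G b differentiable_on S" using G1[OF that(2)] unfolding Ck_on.simps(2) by blast
    then show ?thesis using that unfolding differentiable_on_eq_differentiable_at[OF S(1)] by blast
  qed
  have "\<exists>M\<ge>0. \<forall>x\<in>cball c r. \<bar>frechet_derivative (G b) (at x) d\<bar> \<le> M" if "b \<in> Basis" "d \<in> Basis" for b d
  proof -
    have "continuous_on S (\<lambda>x. frechet_derivative (G b) (at x) d)"
      using G1[OF that(1)] that(2) by simp
    then have "compact ((\<lambda>x. frechet_derivative (G b) (at x) d) ` cball c r)"
      using S(2) by (intro compact_continuous_image) (auto intro: continuous_on_subset)
    then have "bounded ((\<lambda>x. frechet_derivative (G b) (at x) d) ` cball c r)"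
      by (rule compact_imp_bounded)
    then obtain M where "0 < M" "\<And>x. x \<in> cball c r \<Longrightarrow> \<bar>frechet_derivative (G b) (at x) d\<bar> \<le> M"
      unfolding bounded_pos by auto
    then show ?thesis by (intro exI[of _ M]) auto
  qed
  then obtain M where M: "\<And>b d. b \<in> Basis \<Longrightarrow> d \<in> Basis \<Longrightarrow> 0 \<le> M b d"
    "\<And>b d x. b \<in> Basis \<Longrightarrow> d \<in> Basis \<Longrightarrow> x \<in> cball c r \<Longrightarrow> \<bar>frechet_derivative (G b) (at x) d\<bar> \<le> M b d"
    by metis
  have lip: "\<bar>G b x - G b y\<bar> \<le> (\<Sum>d\<in>Basis. M b d) * norm (x - y)"
    if b: "b \<in> Basis" and xy: "x \<in> cball c r" "y \<in> cball c r" for b x y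
  proof -
    have "norm (G b x - G b y) \<le> (\<Sum>d\<in>Basis. M b d) * norm (x - y)"
    proof (rule differentiable_bound[where S = "cball c r" and f' = "\<lambda>x. frechet_derivative (G b) (at x)"])
      fix v assume v: "v \<in> cball c r"
      then have der: "(G b has_derivative frechet_derivative (G b) (at v)) (at v)"
        using Gd[of v b] b S(2) frechet_derivative_works by blast
      then show "(G b has_derivative frechet_derivative (G b) (at v)) (at v within cball c r)"
        by (rule has_derivative_at_withinI)
      show "onorm (frechet_derivative (G b) (at v)) \<le> (\<Sum>d\<in>Basis. M b d)"
      proof (rule onorm_bound)
        fix z
        interpret bounded_linear "frechet_derivative (G b) (at v)" using der by (rule has_derivative_bounded_linear)
        have "frechet_derivative (G b) (at v) z = frechet_derivative (G b) (at v) (\<Sum>d\<in>Basis. (z \<bullet> d) *\<^sub>R d)"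
          by (simp add: euclidean_representation)
        also have "\<dots> = (\<Sum>d\<in>Basis. (z \<bullet> d) * frechet_derivative (G b) (at v) d)"
          by (simp add: sum scaleR)
        also have "norm \<dots> \<le> (\<Sum>d\<in>Basis. M b d * norm z)"
        proof (rule order_trans[OF norm_sum sum_mono])
          fix d :: 'a assume d: "d \<in> Basis"
          have "\<bar>z \<bullet> d\<bar> * \<bar>frechet_derivative (G b) (at v) d\<bar> \<le> norm z * M b d"
            using M(2)[OF b d v] Basis_le_norm[OF d] by (intro mult_mono) auto
          then show "norm ((z \<bullet> d) * frechet_derivative (G b) (at v) d) \<le> M b d * norm z"
            by (simp add: abs_mult mult.commute)
        qed
        finally show "norm (frechet_derivative (G b) (at v) z) \<le> (\<Sum>d\<in>Basis. M b d) * norm z"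
          by (simp add: sum_distrib_right)
      qed (use M(1) b in \<open>auto intro: sum_nonneg\<close>)
    qed (use xy in auto)
    then show ?thesis by simp
  qed
  define p where "p x = (\<Sum>b\<in>Basis. G b x *\<^sub>R b)" for x
  define D where "D = (\<Sum>b\<in>Basis. \<Sum>d\<in>Basis. M b d)"
  have "0 \<le> D" unfolding D_def by (intro sum_nonneg M)
  moreover have "(f has_derivative (\<lambda>z. p x \<bullet> z)) (at x)" if "x \<in> cball c r" for x
  proof -
    have der: "(f has_derivative frechet_derivative f (at x)) (at x)"
      using fd[of x] that S(2) frechet_derivative_works by blast
    interpret bounded_linear "frechet_derivative f (at x)" using der by (rule has_derivative_bounded_linear)
    have "frechet_derivative f (at x) z = p x \<bullet> z" for z
    proof -
      have "frechet_derivative f (at x) z = frechet_derivative f (at x) (\<Sum>d\<in>Basis. (z \<bullet> d) *\<^sub>R d)"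
        by (simp add: euclidean_representation)
      also have "\<dots> = (\<Sum>d\<in>Basis. (z \<bullet> d) * G d x)" by (simp add: sum scaleR G_def)
      also have "\<dots> = p x \<bullet> z" unfolding p_def inner_sum_left by (simp add: inner_commute mult.commute)
      finally show ?thesis .
    qed
    then have "frechet_derivative f (at x) = (\<lambda>z. p x \<bullet> z)" by auto
    then show ?thesis using der by simp
  qed
  moreover have "norm (p x - p y) \<le> D * norm (x - y)" if "x \<in> cball c r" "y \<in> cball c r" for x y
  proof -
    have "p x - p y = (\<Sum>b\<in>Basis. (G b x - G b y) *\<^sub>R b)"
      unfolding p_def by (simp add: sum_subtractf scaleR_diff_left)
    also have "norm \<dots> \<le> (\<Sum>b\<in>Basis. (\<Sum>d\<in>Basis. M b d) * norm (x - y))"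
      by (rule order_trans[OF norm_sum sum_mono]) (use lip that in auto)
    finally show ?thesis by (simp add: D_def sum_distrib_right)
  qed
  ultimately show ?thesis by (intro exI[of _ D] exI[of _ p]) (simp del: mem_cball)
qed

section \<open>Increments of a function with Lipschitz gradient\<close>

lemma has_derivative_translate:
  fixes f :: "'a::real_normed_vector \<Rightarrow> real"
  assumes "(f has_derivative D) (at (x + u))"
  shows "((\<lambda>u. f (x + u)) has_derivative D) (at u)"
proof -
  have "((\<lambda>u. x + u) has_derivative (\<lambda>w. w)) (at u)" by (auto intro!: derivative_eq_intros)
  from has_derivative_compose[OF this assms] show ?thesis by simp
qed

context
  fixes f :: "'a::euclidean_space \<Rightarrow> real" and c :: 'a and r D :: real and p
  assumes D: "0 \<le> D"
    and der: "\<forall>x\<in>cball c r. (f has_derivative (\<lambda>z. p x \<bullet> z)) (at x)"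
    and lip: "\<forall>x\<in>cball c r. \<forall>y\<in>cball c r. norm (p x - p y) \<le> D * norm (x - y)"
begin

lemma segment_in_cball:
  assumes "x \<in> cball c r" "x + z \<in> cball c r" "u \<in> closed_segment 0 z"
  shows "x + u \<in> cball c r"
proof -
  have "x + u \<in> closed_segment x (x + z)"
    using closed_segment_translation_eq[of x u 0 z] assms(3) by simp
  then show ?thesis using assms closed_segment_subset[OF assms(1,2) convex_cball] by blast
qed

text \<open>The mean value inequality is applied to
  \<open>u \<mapsto> f (x + u) - f (y + u)\<close>, whose gradient is at most
  \<open>D * norm (x - y)\<close> along the segment. The gain of both factors, distance of the
  centres and size of the increment, is what makes the near part of the bilinear form converge under
  doubling.\<close>

lemma second_difference_le:
  assumes "x \<in> cball c r" "y \<in> cball c r" "x + z \<in> cball c r" "y + z \<in> cball c r"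
  shows "\<bar>(f (x + z) - f x) - (f (y + z) - f y)\<bar> \<le> D * norm (x - y) * norm z"
proof -
  have "norm ((f (x + z) - f (y + z)) - (f (x + 0) - f (y + 0))) \<le> D * norm (x - y) * norm (z - 0)"
  proof (rule differentiable_bound[where S = "closed_segment 0 z"
        and f' = "\<lambda>u w. (p (x + u) - p (y + u)) \<bullet> w" and f = "\<lambda>u. f (x + u) - f (y + u)"])
    fix u assume u: "u \<in> closed_segment 0 z"
    note xu = segment_in_cball[OF assms(1,3) u] and yu = segment_in_cball[OF assms(2,4) u]
    have d: "((\<lambda>u. f (x + u)) has_derivative (\<lambda>w. p (x + u) \<bullet> w)) (at u)"
      "((\<lambda>u. f (y + u)) has_derivative (\<lambda>w. p (y + u) \<bullet> w)) (at u)"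
      by (rule has_derivative_translate, rule der[rule_format], rule xu yu)+
    show "((\<lambda>u. f (x + u) - f (y + u)) has_derivative (\<lambda>w. (p (x + u) - p (y + u)) \<bullet> w)) (at u within closed_segment 0 z)"
      using has_derivative_at_withinI[OF has_derivative_diff[OF d]] by (simp add: inner_diff_left)
    show "onorm (\<lambda>w. (p (x + u) - p (y + u)) \<bullet> w) \<le> D * norm (x - y)"
    proof (rule onorm_bound)
      fix w :: 'a
      have "norm (p (x + u) - p (y + u)) * norm w \<le> D * norm (x - y) * norm w"
        using lip xu yu by (intro mult_right_mono) fastforce+
      then show "norm ((p (x + u) - p (y + u)) \<bullet> w) \<le> D * norm (x - y) * norm w"
        using Cauchy_Schwarz_ineq2[of "p (x + u) - p (y + u)" w] by simp
    qed (use D in auto)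
  qed auto
  then show ?thesis by (simp add: algebra_simps)
qed

lemma first_order_expansion_le:
  assumes "x \<in> cball c r" "x + z \<in> cball c r"
  shows "\<bar>f (x + z) - f x - p x \<bullet> z\<bar> \<le> D * (norm z)\<^sup>2"
proof -
  have "norm ((f (x + z) - p x \<bullet> z) - (f (x + 0) - p x \<bullet> 0)) \<le> D * norm z * norm (z - 0)"
  proof (rule differentiable_bound[where S = "closed_segment 0 z"
        and f' = "\<lambda>u w. (p (x + u) - p x) \<bullet> w" and f = "\<lambda>u. f (x + u) - p x \<bullet> u"])
    fix u assume u: "u \<in> closed_segment 0 z"
    note xu = segment_in_cball[OF assms u]
    have d: "((\<lambda>u. f (x + u)) has_derivative (\<lambda>w. p (x + u) \<bullet> w)) (at u)"
      by (rule has_derivative_translate, rule der[rule_format], rule xu)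
    show "((\<lambda>u. f (x + u) - p x \<bullet> u) has_derivative (\<lambda>w. (p (x + u) - p x) \<bullet> w)) (at u within closed_segment 0 z)"
      using has_derivative_at_withinI[OF has_derivative_diff[OF d bounded_linear_imp_has_derivative[OF bounded_linear_inner_right]]]
      by (simp add: inner_diff_left)
    show "onorm (\<lambda>w. (p (x + u) - p x) \<bullet> w) \<le> D * norm z"
    proof (rule onorm_bound)
      fix w :: 'a
      have "norm (p (x + u) - p x) \<le> D * norm u" using lip xu assms(1) by fastforce
      also have "\<dots> \<le> D * norm z" using D segment_bound1[OF u] by (intro mult_left_mono) auto
      finally have "norm (p (x + u) - p x) * norm w \<le> D * norm z * norm w"
        by (intro mult_right_mono) auto
      then show "norm ((p (x + u) - p x) \<bullet> w) \<le> D * norm z * norm w"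
        using Cauchy_Schwarz_ineq2[of "p (x + u) - p x" w] by simp
    qed (use D in auto)
  qed auto
  then show ?thesis by (simp add: algebra_simps power2_eq_square)
qed

text \<open>The gradient at \<open>x\<close> exceeds the one at the centre by at most
  \<open>D * r\<close>, and the quadratic remainder is at most \<open>2 * D * r * norm z\<close>
  since two points of the ball are at most \<open>2 * r\<close> apart; together
  \<open>3 * D * r\<close>.\<close>

lemma lipschitz_increment_le:
  assumes "x \<in> cball c r" "x + z \<in> cball c r"
  shows "\<bar>f (x + z) - f x\<bar> \<le> (norm (p c) + 3 * D * r) * norm z"
proof -
  have xc: "norm (x - c) \<le> r" "norm (x + z - c) \<le> r"
    using assms by (auto simp: dist_norm norm_minus_commute)
  have r: "0 \<le> r" using xc norm_ge_zero order_trans by blast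
  have "norm z \<le> 2 * r"
    using norm_triangle_ineq4[of "x + z - c" "x - c"] xc by (simp add: algebra_simps)
  then have z: "D * (norm z)\<^sup>2 \<le> 2 * D * r * norm z"
    using D mult_left_mono[of "norm z" "2 * r" "D * norm z"] by (simp add: power2_eq_square mult_ac)
  have "norm (p x - p c) \<le> D * norm (x - c)" using lip assms(1) r by simp
  also have "\<dots> \<le> D * r" using D xc by (intro mult_left_mono) auto
  finally have "norm (p x) \<le> norm (p c) + D * r" using norm_triangle_sub[of "p x" "p c"] by linarith
  then have "\<bar>p x \<bullet> z\<bar> \<le> (norm (p c) + D * r) * norm z"
    using Cauchy_Schwarz_ineq2[of "p x" z] mult_right_mono[of "norm (p x)" _ "norm z"] by fastforce
  then show ?thesis
    using first_order_expansion_le[OF assms] z by (simp add: algebra_simps abs_le_iff)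
qed

end

section \<open>Viscosity inequalities for functions with a second order expansion\<close>

lemma quad_at_L1w:
  fixes x :: "'a::euclidean_space"
  assumes s: "0 < s" "s < 1" and f: "quad_at x l C f"
  shows "f \<in> L1w s"
proof (rule bounded_L1w[OF s quad_at_measurable[OF f]])
  fix v
  have "(norm l + C) * min 1 (norm (v - x)) \<le> (norm l + C) * 1"
    using quad_at_nonneg[OF f] by (intro mult_left_mono) auto
  then show "\<bar>f v\<bar> \<le> \<bar>f x\<bar> + (norm l + C)"
    using quad_at_diff_le[OF f, of "v - x"] by simp
qed

lemma Ck2_test_function: "Ck_on 2 f \<Omega> \<Longrightarrow> f \<in> L1w s \<Longrightarrow> test_function s \<sigma> \<Omega> f"
  unfolding test_function_def using Ck_on_Suc_imp[of 1 f \<Omega>] by (auto simp: numeral_2_eq_2)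

text \<open>A polynomial multiple of \<open>\<bar>v - x\<bar>\<^sup>2\<close> on \<open>\<Omega>\<close>, with the polynomial from the Weierstrass theorem,
  replaces the cutoff functions one would otherwise need.\<close>

lemma quad_at_one_sided_approximation:
  fixes f :: "'a::euclidean_space \<Rightarrow> real"
  assumes s: "0 < s" "s < 1" and \<Omega>: "open \<Omega>" "bounded \<Omega>" "x \<in> \<Omega>"
    and f: "quad_at x l C f" and cont: "continuous_on (closure \<Omega>) f" and sg: "sg = 1 \<or> sg = (- 1 :: real)"
  obtains F C' where "\<And>n. quad_at x l C' (F n)" "\<And>n. F n x = f x" "\<And>n v. sg * f v \<le> sg * F n v"
    "\<And>v. (\<lambda>n. F n v) \<longlonglongrightarrow> f v" "\<And>n. test_function s \<sigma> \<Omega> (F n)"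
proof -
  \<comment> \<open>Here the linear term is subtracted everywhere. For increments of length at least
    1 it is at most \<open>norm l\<close> times the squared length, which explains the extra
    summand.\<close>
  define C0 where "C0 = C + norm l"
  define q where "q v = (f v - f x - l \<bullet> (v - x)) / (norm (v - x))\<^sup>2" for v
  have C0: "0 \<le> C" "0 \<le> C0" using quad_at_nonneg[OF f] by (auto simp: C0_def)
  have sgsg: "sg * sg = 1" and asg: "\<bar>sg\<bar> = 1" using sg by auto
  have rem: "\<bar>f v - f x - l \<bullet> (v - x)\<bar> \<le> C0 * (norm (v - x))\<^sup>2" for v
  proof (cases "norm (v - x) < 1")
    case True
    then have "(norm (v - x))\<^sup>2 \<le> 1" by (intro power_le_one) auto
    then have "\<bar>f v - f x - l \<bullet> (v - x)\<bar> \<le> C * (norm (v - x))\<^sup>2"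
      using quad_at_bound[OF f, of "v - x"] True by (simp add: min_absorb2)
    then show ?thesis by (simp add: C0_def distrib_right add_increasing2)
  next
    case False
    then have "norm l * norm (v - x) \<le> norm l * (norm (v - x))\<^sup>2" "1 \<le> (norm (v - x))\<^sup>2"
      by (auto intro!: mult_left_mono self_le_power)
    moreover have "C * 1 \<le> C * (norm (v - x))\<^sup>2" using C0 calculation(2) by (intro mult_left_mono) auto
    ultimately show ?thesis
      using quad_at_bound[OF f, of "v - x"] False Cauchy_Schwarz_ineq2[of l "v - x"]
      by (simp add: C0_def distrib_right min_absorb1)
  qed
  have fq: "f v = f x + l \<bullet> (v - x) + (norm (v - x))\<^sup>2 * q v" for v
    by (cases "v = x") (auto simp: q_def)
  have q: "\<bar>q v\<bar> \<le> C0" for v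
  proof (cases "v = x")
    case False
    then show ?thesis using rem[of v] unfolding q_def by (simp add: pos_divide_le_eq)
  qed (use C0 in \<open>simp add: q_def\<close>)
  then have sq: "\<bar>sg * q v\<bar> \<le> C0" for v using asg by (simp add: abs_mult)
  \<comment> \<open>The quotient \<open>q\<close> is bounded but may be discontinuous at
    \<open>x\<close>. \<open>k n\<close> is a continuous substitute on the correct side of
    \<open>q\<close>: it takes the extreme value \<open>sg * C0\<close> at \<open>x\<close> and
    equals \<open>q\<close> as soon as \<open>n * norm (v - x) \<ge> 1\<close>.\<close>
  define k where "k n v = sg * C0 - min 1 (real n * norm (v - x)) * (sg * C0 - q v)" for n v
  have sk: "sg * k n v = C0 - min 1 (real n * norm (v - x)) * (C0 - sg * q v)" for n v
    using sg by (auto simp: k_def algebra_simps)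
  have k_ge: "sg * q v \<le> sg * k n v" and k_abs: "\<bar>k n v\<bar> \<le> C0" for n v
  proof -
    define m where "m = min 1 (real n * norm (v - x))"
    have "0 \<le> C0 - sg * q v" using sq[of v] by linarith
    moreover have "0 \<le> m" "m \<le> 1" by (auto simp: m_def)
    ultimately have "m * (C0 - sg * q v) \<le> 1 * (C0 - sg * q v)" "0 \<le> m * (C0 - sg * q v)"
      by (intro mult_right_mono mult_nonneg_nonneg; simp)+
    then have "sg * q v \<le> sg * k n v" "sg * k n v \<le> C0" by (simp_all add: sk m_def)
    then show "sg * q v \<le> sg * k n v" "\<bar>k n v\<bar> \<le> C0" using sq[of v] sg by auto
  qed
  have kcont: "continuous_on (closure \<Omega>) (k n)" for n
  proof -
    have "continuous_on (closure \<Omega>) (\<lambda>v. min 1 (real n * norm (v - x)) * (sg * C0 - q v))"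
      unfolding continuous_on_def
    proof
      fix v assume v: "v \<in> closure \<Omega>"
      let ?g = "\<lambda>v. min 1 (real n * norm (v - x)) * (sg * C0 - q v)"
      show "(?g \<longlongrightarrow> ?g v) (at v within closure \<Omega>)"
      proof (cases "v = x")
        case False
        have "(f \<longlongrightarrow> f v) (at v within closure \<Omega>)" using cont v by (simp add: continuous_on_def)
        then show ?thesis unfolding q_def using False by (intro tendsto_intros) auto
      next
        case True
        have "(?g \<longlongrightarrow> 0) (at v within closure \<Omega>)"
        proof (rule Lim_null_comparison)
          show "((\<lambda>w. real n * norm (w - x) * (2 * C0)) \<longlongrightarrow> 0) (at v within closure \<Omega>)"
            unfolding True by (auto intro!: tendsto_eq_intros)
          show "\<forall>\<^sub>F w in at v within closure \<Omega>. norm (?g w) \<le> real n * norm (w - x) * (2 * C0)"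
          proof (rule always_eventually, rule allI)
            fix w
            have "\<bar>sg * C0 - q w\<bar> \<le> 2 * C0" using q[of w] C0 sg by auto
            then show "norm (?g w) \<le> real n * norm (w - x) * (2 * C0)"
              unfolding real_norm_def abs_mult by (intro mult_mono) auto
          qed
        qed
        then show ?thesis by (simp add: True)
      qed
    qed
    then show ?thesis unfolding k_def by (rule continuous_on_diff[OF continuous_on_const])
  qed
  have cpt: "compact (closure \<Omega>)" using \<Omega>(2) by simp
  \<comment> \<open>The target is shifted by exactly the accuracy of the approximation, so the
    polynomial stays on the side of \<open>k n\<close> prescribed by \<open>sg\<close>, at distance
    at most \<open>2 / Suc n\<close>.\<close>
  have "\<exists>P. real_polynomial_function P \<and> (\<forall>v\<in>closure \<Omega>. \<bar>k n v + sg / real (Suc n) - P v\<bar> < 1 / real (Suc n))" for n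
  proof -
    have "continuous_on (closure \<Omega>) (\<lambda>v. k n v + sg / real (Suc n))" by (intro continuous_intros kcont)
    then show ?thesis
      by (rule Stone_Weierstrass_real_polynomial_function[OF cpt, of _ "1 / real (Suc n)"]) auto
  qed
  then obtain P where P: "\<And>n. real_polynomial_function (P n)"
    "\<And>n v. v \<in> closure \<Omega> \<Longrightarrow> \<bar>k n v + sg / real (Suc n) - P n v\<bar> < 1 / real (Suc n)"
    by metis
  have P_ge: "sg * q v \<le> sg * P n v" and P_near: "\<bar>P n v - k n v\<bar> \<le> 2 / real (Suc n)" if "v \<in> \<Omega>" for n v
  proof -
    have "v \<in> closure \<Omega>" using that closure_subset by blast
    note Pv = P(2)[OF this, of n]
    show "sg * q v \<le> sg * P n v" using Pv k_ge[of v n] sg by (auto simp: abs_less_iff)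
    have "\<bar>sg / real (Suc n)\<bar> \<le> 1 / real (Suc n)" using asg by (simp only: abs_divide)
    moreover have "2 / real (Suc n) = 1 / real (Suc n) + 1 / real (Suc n)"
      by (simp only: add_divide_distrib[symmetric] one_add_one)
    ultimately show "\<bar>P n v - k n v\<bar> \<le> 2 / real (Suc n)" using Pv by linarith
  qed
  have P_abs: "\<bar>P n v\<bar> \<le> C0 + 2" if "v \<in> \<Omega>" for n v
  proof -
    have "2 / real (Suc n) \<le> 2" by (simp add: divide_le_eq)
    then show ?thesis using P_near[OF that, of n] k_abs[of n v] by linarith
  qed
  define p where "p n v = f x + l \<bullet> (v - x) + (norm (v - x))\<^sup>2 * P n v" for n v
  have poly: "real_polynomial_function (p n)" for n
  proof -
    have "(norm (v - x))\<^sup>2 = (\<Sum>b\<in>Basis. ((v - x) \<bullet> b)\<^sup>2)" for v :: 'a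
      by (subst power2_norm_eq_inner, subst euclidean_inner) (simp add: power2_eq_square)
    moreover have lin: "real_polynomial_function (\<lambda>v. b \<bullet> (v - x))" for b :: 'a
      unfolding inner_diff_right
      by (intro real_polynomial_function_diff real_polynomial_function.intros bounded_linear_inner_right)
    moreover have "real_polynomial_function (\<lambda>v. (v - x) \<bullet> b)" for b :: 'a
      using lin[of b] by (simp add: inner_commute)
    ultimately show ?thesis unfolding p_def
      by (auto intro!: real_polynomial_function.intros(3,4) real_polynomial_function_sum
          real_polynomial_function_power P(1) real_polynomial_function.intros(2))
  qed
  \<comment> \<open>A jump across the boundary of \<open>\<Omega>\<close> is harmless: a test
    function is smooth in the open set \<open>\<Omega>\<close> and only weighted integrable on the
    whole space.\<close>
  define F where "F n v = (if v \<in> \<Omega> then p n v else f v)" for n v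
  obtain R where R: "1 \<le> R" "\<And>v. v \<in> \<Omega> \<Longrightarrow> norm (v - x) \<le> R"
  proof -
    obtain e where e: "\<And>v. v \<in> \<Omega> \<Longrightarrow> dist x v \<le> e"
      using \<Omega>(2) bounded_any_center[of \<Omega> x] by blast
    show ?thesis by (rule that[of "max 1 e"]) (use e in \<open>auto simp: dist_norm norm_minus_commute le_max_iff_disj\<close>)
  qed
  \<comment> \<open>One summand for each position of \<open>x + z\<close>: outside
    \<open>\<Omega>\<close>, inside at distance below 1, inside at distance between 1 and
    \<open>R\<close>. None depends on \<open>n\<close>.\<close>
  define C' where "C' = C + (C0 + 2) + (norm l * R + R\<^sup>2 * (C0 + 2))"
  have nn: "0 \<le> norm l * R + R\<^sup>2 * (C0 + 2)" using R C0 by simp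
  have Fx: "F n x = f x" for n by (simp add: F_def p_def)
  have meas: "F n \<in> borel_measurable lebesgue" for n
  proof -
    have "p n \<in> borel_measurable borel"
      using poly by (intro borel_measurable_continuous_onI continuous_on_polymonial_function)
        (simp add: real_polynomial_function_eq)
    then have "p n \<in> borel_measurable lebesgue" by (auto intro: measurable_completion)
    moreover have "\<Omega> \<in> sets lebesgue" using \<Omega>(1) by (auto intro: sets_completionI_sets)
    ultimately show ?thesis
      unfolding F_def using quad_at_measurable[OF f] by (intro measurable_If_set) auto
  qed
  have quad: "quad_at x l C' (F n)" for n
    unfolding quad_at_def
  proof (intro conjI allI meas)
    fix z :: 'a
    let ?m = "msq z"
    show "\<bar>quad_rem x l (F n) z\<bar> \<le> C' * ?m"
    proof (cases "x + z \<in> \<Omega>")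
      case False
      have "C * ?m \<le> C' * ?m" unfolding C'_def using nn C0 by (intro mult_right_mono) auto
      then show ?thesis using False quad_at_bound[OF f, of z] Fx by (simp add: F_def split del: if_split)
    next
      case True
      have eq: "F n (x + z) - F n x = l \<bullet> z + (norm z)\<^sup>2 * P n (x + z)"
        using True Fx[of n] by (simp add: F_def p_def)
      have Pz: "\<bar>(norm z)\<^sup>2 * P n (x + z)\<bar> \<le> (norm z)\<^sup>2 * (C0 + 2)"
        using P_abs[OF True, of n] by (simp add: abs_mult mult_left_mono)
      show ?thesis
      proof (cases "norm z < 1")
        case z: True
        then have "?m = (norm z)\<^sup>2" by (intro min_absorb2 power_le_one) auto
        moreover have "(C0 + 2) * ?m \<le> C' * ?m" unfolding C'_def using nn C0 by (intro mult_right_mono) auto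
        ultimately show ?thesis using Pz z unfolding eq by (simp add: mult.commute)
      next
        case z: False
        then have m: "?m = 1" by (intro min_absorb1 one_le_power) auto
        have zR: "norm z \<le> R" using R(2)[OF True] by simp
        have "\<bar>l \<bullet> z\<bar> \<le> norm l * R"
          using Cauchy_Schwarz_ineq2[of l z] mult_left_mono[OF zR, of "norm l"] by simp
        moreover have "(norm z)\<^sup>2 * (C0 + 2) \<le> R\<^sup>2 * (C0 + 2)"
          using zR C0 by (intro mult_right_mono power_mono) auto
        ultimately have "\<bar>l \<bullet> z + (norm z)\<^sup>2 * P n (x + z)\<bar> \<le> C'"
          using Pz C0 unfolding C'_def by linarith
        then show ?thesis using z unfolding eq m by simp
      qed
    qed
  qed
  show ?thesis
  proof (rule that[of C' F])
    show "sg * f v \<le> sg * F n v" for n v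
    proof (cases "v \<in> \<Omega>")
      case True
      have "(norm (v - x))\<^sup>2 * (sg * q v) \<le> (norm (v - x))\<^sup>2 * (sg * P n v)"
        by (rule mult_left_mono[OF P_ge[OF True]]) simp
      moreover have "sg * f v = sg * (f x + l \<bullet> (v - x)) + (norm (v - x))\<^sup>2 * (sg * q v)"
        by (subst fq) (simp add: algebra_simps)
      moreover have "sg * F n v = sg * (f x + l \<bullet> (v - x)) + (norm (v - x))\<^sup>2 * (sg * P n v)"
        using True by (simp add: F_def p_def algebra_simps)
      ultimately show ?thesis by linarith
    qed (simp add: F_def)
    show "(\<lambda>n. F n v) \<longlonglongrightarrow> f v" for v
    proof (cases "v \<in> \<Omega> \<and> v \<noteq> x")
      case True
      have "\<forall>\<^sub>F n in sequentially. 1 / norm (v - x) \<le> real n"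
        using filterlim_real_sequentially by (auto simp: filterlim_at_top)
      then have "\<forall>\<^sub>F n in sequentially. \<bar>P n v - q v\<bar> \<le> 2 / real (Suc n)"
      proof eventually_elim
        case (elim n)
        then have "1 \<le> real n * norm (v - x)" using True by (simp add: divide_le_eq)
        then have "k n v = q v" by (simp add: k_def)
        then show ?case using P_near[of v n] True by simp
      qed
      moreover have "(\<lambda>n. 2 / real (Suc n)) \<longlonglongrightarrow> 0"
        using tendsto_mult_right[OF LIMSEQ_inverse_real_of_nat, of 2] by (simp add: inverse_eq_divide)
      ultimately have "(\<lambda>n. P n v - q v) \<longlonglongrightarrow> 0"
        using Lim_null_comparison[of "\<lambda>n. P n v - q v"] by simp
      then have "(\<lambda>n. P n v) \<longlonglongrightarrow> q v" by (simp add: LIM_zero_iff)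
      then have "(\<lambda>n. p n v) \<longlonglongrightarrow> f x + l \<bullet> (v - x) + (norm (v - x))\<^sup>2 * q v"
        unfolding p_def by (intro tendsto_intros)
      then show ?thesis using True fq[of v] by (simp add: F_def)
    next
      case False
      then have "F n v = f v" for n using Fx by (auto simp: F_def)
      then show ?thesis by simp
    qed
    show "test_function s \<sigma> \<Omega> (F n)" for n
      by (intro Ck2_test_function quad_at_L1w[OF s quad] Ck_on_cong[OF \<Omega>(1) _ Ck_on_real_polynomial_function[OF poly]])
        (simp add: F_def)
  qed (fact quad Fx)+
qed

text \<open>The sign \<open>sg\<close> treats sub and super solutions together.\<close>

lemma visc_quad_at:
  fixes f :: "'a::euclidean_space \<Rightarrow> real" and H :: "'a \<times> real \<Rightarrow> real"
  assumes s: "0 < s" "s < 1" and \<Omega>: "open \<Omega>" "bounded \<Omega>" "x \<in> \<Omega>"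
    and H: "continuous_on UNIV H" and sg: "sg = 1 \<or> sg = (- 1 :: real)"
    and visc: "\<And>\<phi>. test_function s \<sigma> \<Omega> \<phi> \<Longrightarrow> (\<forall>y. sg * (u y - \<phi> y) \<le> sg * (u x - \<phi> x)) \<Longrightarrow> fin \<phi> x
        \<Longrightarrow> sg * (\<sigma> * frac_lap s \<phi> x + H (x, G \<phi> x)) \<le> 0"
    and f: "quad_at x l C f" "continuous_on (closure \<Omega>) f" "\<And>y. sg * u y \<le> sg * f y" "u x = f x"
    and G: "\<And>F C'. (\<And>n. quad_at x l C' (F n)) \<Longrightarrow> (\<And>v. (\<lambda>n. F n v) \<longlonglongrightarrow> f v) \<Longrightarrow> (\<lambda>n. G (F n) x) \<longlonglongrightarrow> G f x"
    and fin: "\<And>\<phi> C'. quad_at x l C' \<phi> \<Longrightarrow> fin \<phi> x"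
  shows "sg * (\<sigma> * frac_lap s f x + H (x, G f x)) \<le> 0"
proof -
  obtain F C' where F: "\<And>n. quad_at x l C' (F n)" "\<And>n. F n x = f x" "\<And>n v. sg * f v \<le> sg * F n v"
    "\<And>v. (\<lambda>n. F n v) \<longlonglongrightarrow> f v" "\<And>n. test_function s \<sigma> \<Omega> (F n)"
    using quad_at_one_sided_approximation[OF s \<Omega> f(1,2) sg] by metis
  \<comment> \<open>\<open>F n\<close> lies beyond \<open>f\<close> as seen from \<open>u\<close>
    and agrees with it at \<open>x\<close>, so \<open>u\<close> is touched at the same
    point.\<close>
  have "sg * (\<sigma> * frac_lap s (F n) x + H (x, G (F n) x)) \<le> 0" for n
  proof (rule visc[OF F(5) _ fin[OF F(1)]], rule allI)
    show "sg * (u y - F n y) \<le> sg * (u x - F n x)" for y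
      using f(3)[of y] f(4) F(2)[of n] F(3)[of y n] by (simp add: right_diff_distrib)
  qed
  moreover have "isCont H (x, G f x)" using H by (simp add: continuous_on_eq_continuous_at)
  then have "(\<lambda>n. H (x, G (F n) x)) \<longlonglongrightarrow> H (x, G f x)"
    by (rule isCont_tendsto_compose) (intro tendsto_Pair tendsto_const G[OF F(1) F(4)])
  then have "(\<lambda>n. sg * (\<sigma> * frac_lap s (F n) x + H (x, G (F n) x))) \<longlonglongrightarrow> sg * (\<sigma> * frac_lap s f x + H (x, G f x))"
    by (intro tendsto_intros frac_lap_tendsto[OF s F(1) F(4)])
  ultimately show ?thesis by (intro LIMSEQ_le_const2) auto
qed

section \<open>Peaks far from the domain\<close>

lemma integral_pos_of_pos_on_open:
  fixes g :: "'a::euclidean_space \<Rightarrow> real"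
  assumes g: "integrable lebesgue g" "\<And>z. 0 \<le> g z" and S: "open S" "S \<noteq> {}" "\<And>z. z \<in> S \<Longrightarrow> 0 < g z"
  shows "0 < (LINT z|lebesgue. g z)"
proof -
  have "(LINT z|lebesgue. g z) \<noteq> 0"
  proof
    assume "(LINT z|lebesgue. g z) = 0"
    then have "AE z in lebesgue. g z = 0" using integral_nonneg_eq_0_iff_AE[OF g(1)] g(2) by simp
    then obtain N where N: "{z. g z \<noteq> 0} \<subseteq> N" "N \<in> null_sets lebesgue"
      unfolding eventually_ae_filter by auto
    have "S \<subseteq> N" using S(3) N(1) by force
    then have "negligible S" using N(2) negligible_iff_null_sets negligible_subset by blast
    then show False using open_not_negligible[OF S(1,2)] by simp
  qed
  moreover have "0 \<le> (LINT z|lebesgue. g z)" using g(2) by (intro Bochner_Integration.integral_nonneg) auto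
  ultimately show ?thesis by simp
qed

text \<open>A coordinate vector multiplied by a number larger than the radius of
  \<open>\<Omega>\<close> is far away in every respect. The distance bound puts peaks where the
  kernel is tame; the strip bound on the \<open>b\<close> coordinate later keeps a scaled sine
  positive on the ball.\<close>

lemma ex_far_direction:
  fixes \<Omega> :: "'a::euclidean_space set"
  assumes "bounded \<Omega>"
  obtains e b :: 'a and R where "b \<in> Basis" "0 < R" "\<And>v w. v \<in> closure \<Omega> \<Longrightarrow> w \<in> ball e 1 \<Longrightarrow> 1 \<le> norm (w - v)"
    "\<And>v w. v \<in> closure \<Omega> \<Longrightarrow> w \<in> ball e 1 \<Longrightarrow> 0 < (w - v) \<bullet> b \<and> (w - v) \<bullet> b < R"
proof -
  obtain b :: 'a where b: "b \<in> Basis" using nonempty_Basis by blast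
  obtain r where r: "0 < r" "\<And>v. v \<in> closure \<Omega> \<Longrightarrow> norm v \<le> r"
    using assms bounded_closure[of \<Omega>] unfolding bounded_pos by blast
  \<comment> \<open>On the unit ball around this point the \<open>b\<close> coordinate lies in
    \<open>(r + 1, r + 3)\<close>, on the closure of \<open>\<Omega>\<close> in
    \<open>[- r, r]\<close>; so the difference is at least 1 and below
    \<open>2 * r + 4\<close>.\<close>
  let ?e = "(r + 2) *\<^sub>R b"
  have *: "1 \<le> (w - v) \<bullet> b \<and> (w - v) \<bullet> b < 2 * r + 4" if "v \<in> closure \<Omega>" "w \<in> ball ?e 1" for v w
  proof -
    have "\<bar>v \<bullet> b\<bar> \<le> r" using r(2)[OF that(1)] Basis_le_norm[OF b, of v] by linarith
    moreover have "\<bar>(w - ?e) \<bullet> b\<bar> < 1"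
      using that(2) Basis_le_norm[OF b, of "w - ?e"] by (simp add: dist_norm norm_minus_commute)
    moreover have "(w - ?e) \<bullet> b = w \<bullet> b - (r + 2)" using b by (simp add: inner_diff_left)
    ultimately show ?thesis by (simp add: inner_diff_left abs_less_iff abs_le_iff)
  qed
  show ?thesis
  proof (rule that[of b "2 * r + 4" ?e])
    fix v w assume vw: "v \<in> closure \<Omega>" "w \<in> ball ?e 1"
    show "1 \<le> norm (w - v)" using *[OF vw] Basis_le_norm[OF b, of "w - v"] by linarith
    show "0 < (w - v) \<bullet> b \<and> (w - v) \<bullet> b < 2 * r + 4" using *[OF vw] by linarith
  qed (use b r in auto)
qed

text \<open>The kernel measure of the ball as seen from \<open>x\<close>. A peak of height
  \<open>t\<close> on the ball enters the Laplacian as \<open>t\<close> times this mass and the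
  energy, to leading order, as \<open>t\<^sup>2\<close> times it.\<close>

definition ball_mass :: "real \<Rightarrow> 'a::euclidean_space \<Rightarrow> real \<Rightarrow> 'a \<Rightarrow> real" where
  "ball_mass s e \<delta> x = (LINT z|lebesgue. indicator (ball e \<delta>) (x + z) * frac_kernel s z)"

lemma lebesgue_measurable_indicator_ball: "indicator (ball e \<delta> :: 'a::euclidean_space set) \<in> borel_measurable (lebesgue :: 'a measure)"
  by (intro borel_measurable_indicator) (auto intro: sets_completionI_sets)

context
  fixes s :: real and x e :: "'a::euclidean_space" and \<delta> :: real
  assumes s: "0 < s" "s < 1" and far: "\<And>w. w \<in> ball e \<delta> \<Longrightarrow> 1 \<le> norm (w - x)" and \<delta>: "0 < \<delta>"
begin

lemma centre_notin_ball: "x \<notin> ball e \<delta>"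
  using far[of x] by auto

lemma indicator_ball_le: "indicator (ball e \<delta>) (x + z) \<le> msq z"
  using far[of "x + z"] one_le_power[of "norm z" 2] by (auto simp: indicator_def)

lemma quad_at_add_peak:
  assumes f: "quad_at x l C f"
  shows "quad_at x l (C + \<bar>t\<bar>) (\<lambda>v. f v + t * indicator (ball e \<delta>) v)"
  unfolding quad_at_def
proof (intro conjI allI)
  show "(\<lambda>v. f v + t * indicator (ball e \<delta>) v) \<in> borel_measurable lebesgue"
    using quad_at_measurable[OF f] lebesgue_measurable_indicator_ball[of e \<delta>] by measurable
  fix z :: 'a
  have "\<bar>t * indicator (ball e \<delta>) (x + z)\<bar> \<le> \<bar>t\<bar> * msq z"
    using indicator_ball_le[of z] by (simp add: abs_mult mult_left_mono)
  then show "\<bar>f (x + z) + t * indicator (ball e \<delta>) (x + z) - (f x + t * indicator (ball e \<delta>) x) - (if norm z < 1 then l \<bullet> z else 0)\<bar>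
      \<le> (C + \<bar>t\<bar>) * msq z"
    using quad_at_bound[OF f, of z] centre_notin_ball by (simp add: distrib_right split del: if_split)
qed

lemma quad_at_peak: "quad_at x 0 \<bar>t\<bar> (\<lambda>v. t * indicator (ball e \<delta>) v)"
proof -
  have "quad_at x 0 0 (\<lambda>_::'a. 0 :: real)" by (auto simp: quad_at_def)
  from quad_at_add_peak[OF this, of t] show ?thesis by simp
qed

lemma integrable_ball_kernel:
  assumes "g \<in> borel_measurable lebesgue" "\<And>z. \<bar>g z\<bar> \<le> D"
  shows "integrable lebesgue (\<lambda>z. g z * (indicator (ball e \<delta>) (x + z) * frac_kernel s z))"
proof -
  have le: "\<bar>g z * indicator (ball e \<delta>) (x + z)\<bar> \<le> D * msq z" for z
  proof -
    have "0 \<le> D" using assms(2)[of 0] by linarith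
    then show ?thesis unfolding abs_mult using assms(2) indicator_ball_le[of z] by (intro mult_mono) auto
  qed
  have "(\<lambda>z. g z * indicator (ball e \<delta>) (x + z)) \<in> borel_measurable lebesgue"
    using measurable_lebesgue_shift[OF lebesgue_measurable_indicator_ball, of e \<delta> x] assms(1) by measurable
  from integrable_kernel_bound[OF s this le] show ?thesis by (simp add: mult.assoc)
qed

lemma integrable_ball_mass: "integrable lebesgue (\<lambda>z. indicator (ball e \<delta>) (x + z) * frac_kernel s z)"
  using integrable_ball_kernel[of "\<lambda>_. 1" 1] by simp

lemma weighted_ball_mass_pos:
  assumes "g \<in> borel_measurable lebesgue" "\<And>z. \<bar>g z\<bar> \<le> D" "\<And>z. x + z \<in> ball e \<delta> \<Longrightarrow> 0 < g z"
  shows "0 < (LINT z|lebesgue. g z * (indicator (ball e \<delta>) (x + z) * frac_kernel s z))"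
proof (rule integral_pos_of_pos_on_open[OF integrable_ball_kernel[OF assms(1,2)]])
  show "open (ball (e - x) \<delta>)" "ball (e - x) \<delta> \<noteq> {}" using \<delta> by auto
  have ball: "z \<in> ball (e - x) \<delta> \<longleftrightarrow> x + z \<in> ball e \<delta>" for z by (simp add: dist_norm algebra_simps)
  show "0 \<le> g z * (indicator (ball e \<delta>) (x + z) * frac_kernel s z)" for z
    using assms(3)[of z] by (auto simp: indicator_def)
  show "0 < g z * (indicator (ball e \<delta>) (x + z) * frac_kernel s z)" if "z \<in> ball (e - x) \<delta>" for z
  proof -
    have *: "x + z \<in> ball e \<delta>" using that ball by blast
    then have "z \<noteq> 0" using centre_notin_ball by auto
    with * show ?thesis using assms(3)[OF *] frac_kernel_pos[of z s] by (simp add: indicator_def)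
  qed
qed

lemma ball_mass_pos: "0 < ball_mass s e \<delta> x"
  using weighted_ball_mass_pos[of "\<lambda>_. 1" 1] by (simp add: ball_mass_def)

lemma frac_lap_add_peak:
  assumes f: "quad_at x l C f"
  shows "frac_lap s (\<lambda>v. f v + t * indicator (ball e \<delta>) v) x
    = frac_lap s f x - frac_const DIM('a) s * (t * ball_mass s e \<delta> x)"
proof -
  have "(\<lambda>z. (f (x + z) + t * indicator (ball e \<delta>) (x + z) - (f x + t * indicator (ball e \<delta>) x) - (if norm z < 1 then l \<bullet> z else 0)) * frac_kernel s z)
    = (\<lambda>z. quad_rem x l f z * frac_kernel s z + t * (indicator (ball e \<delta>) (x + z) * frac_kernel s z))"
    using centre_notin_ball by (simp add: fun_eq_iff algebra_simps split del: if_split)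
  then show ?thesis
    unfolding frac_lap_quad[OF s quad_at_add_peak[OF f]] frac_lap_quad[OF s f] ball_mass_def
    using integrable_quad_remainder[OF s f] integrable_ball_mass
    by (simp only: Bochner_Integration.integral_add integrable_mult_right integral_mult_right_zero) (simp add: algebra_simps)
qed

text \<open>Expanding the square of the increment leaves a cross term \<open>t * \<beta>\<close>,
  where \<open>\<beta>\<close> integrates the increments of \<open>f\<close> over the ball. These
  are bounded, so \<open>\<beta>\<close> is at most a multiple of the ball mass and the cross term
  is of lower order for tall thin peaks.\<close>

lemma Bform_add_peak:
  assumes f: "quad_at x l C f"
  obtains \<beta> where "\<bar>\<beta>\<bar> \<le> (norm l + C) * ball_mass s e \<delta> x"
    "Bform s (\<lambda>v. f v + t * indicator (ball e \<delta>) v) (\<lambda>v. f v + t * indicator (ball e \<delta>) v) x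
    = Bform s f f x + frac_const DIM('a) s / 2 * (2 * (t * \<beta>) + t\<^sup>2 * ball_mass s e \<delta> x)"
proof -
  define \<eta> where "\<eta> z = (indicator (ball e \<delta>) (x + z) * frac_kernel s z :: real)" for z
  define D where "D z = f (x + z) - f x" for z
  have Db: "\<bar>D z\<bar> \<le> norm l + C" for z
  proof -
    have "(norm l + C) * min 1 (norm z) \<le> (norm l + C) * 1"
      using quad_at_nonneg[OF f] by (intro mult_left_mono) auto
    with quad_at_diff_le[OF f, of z] show ?thesis unfolding D_def by simp
  qed
  have Dm: "D \<in> borel_measurable lebesgue"
    unfolding D_def using measurable_lebesgue_shift[OF quad_at_measurable[OF f], of x] by measurable
  have i1: "integrable lebesgue (\<lambda>z. D z * \<eta> z)" unfolding \<eta>_def by (rule integrable_ball_kernel[OF Dm Db])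
  have i2: "integrable lebesgue \<eta>" unfolding \<eta>_def by (rule integrable_ball_mass)
  have i3: "integrable lebesgue (\<lambda>z. D z * D z * frac_kernel s z)"
    using Bform_finite_quad[OF f quad_at_admissible[OF s f]] unfolding Bform_finite_eq D_def .
  have eq: "(\<lambda>z. (f (x + z) + t * indicator (ball e \<delta>) (x + z) - (f x + t * indicator (ball e \<delta>) x)) *
      (f (x + z) + t * indicator (ball e \<delta>) (x + z) - (f x + t * indicator (ball e \<delta>) x)) * frac_kernel s z)
    = (\<lambda>z. D z * D z * frac_kernel s z + (2 * t * (D z * \<eta> z) + t\<^sup>2 * \<eta> z))"
    using centre_notin_ball by (auto simp: fun_eq_iff \<eta>_def D_def indicator_def algebra_simps power2_eq_square)
  define \<beta> where "\<beta> = (LINT z|lebesgue. D z * \<eta> z)"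
  have "Bform s (\<lambda>v. f v + t * indicator (ball e \<delta>) v) (\<lambda>v. f v + t * indicator (ball e \<delta>) v) x
    = Bform s f f x + frac_const DIM('a) s / 2 * (2 * (t * \<beta>) + t\<^sup>2 * ball_mass s e \<delta> x)"
    unfolding Bform_eq eq ball_mass_def \<eta>_def[symmetric] \<beta>_def D_def[symmetric] using i1 i2 i3
    by (simp only: Bochner_Integration.integral_add Bochner_Integration.integrable_add integrable_mult_right integral_mult_right_zero)
      (simp add: algebra_simps)
  moreover have "\<bar>\<beta>\<bar> \<le> (norm l + C) * ball_mass s e \<delta> x"
  proof -
    have "norm \<beta> \<le> (LINT z|lebesgue. norm (D z * \<eta> z))" unfolding \<beta>_def by (rule integral_norm_bound)
    also have "\<dots> \<le> (LINT z|lebesgue. (norm l + C) * \<eta> z)"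
    proof (rule Bochner_Integration.integral_mono)
      show "norm (D z * \<eta> z) \<le> (norm l + C) * \<eta> z" for z
        using mult_right_mono[OF Db[of z], of "\<eta> z"] by (simp add: abs_mult \<eta>_def)
    qed (use i1 i2 in auto)
    also have "\<dots> = (norm l + C) * (LINT z|lebesgue. \<eta> z)" by simp
    finally have "norm \<beta> \<le> (norm l + C) * (LINT z|lebesgue. \<eta> z)" .
    then show ?thesis by (simp add: ball_mass_def \<eta>_def)
  qed
  ultimately show ?thesis using that by blast
qed

end

text \<open>The balls shrink to the single point \<open>e\<close>, a null set, and the indicator of
  the unit ball around \<open>e\<close> is dominated by \<open>msq\<close>.\<close>

lemma ball_mass_tendsto_0:
  fixes x e :: "'a::euclidean_space"
  assumes s: "0 < s" "s < 1" and far: "\<And>w. w \<in> ball e 1 \<Longrightarrow> 1 \<le> norm (w - x)"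
  shows "(\<lambda>n. ball_mass s e (1 / real (Suc n)) x) \<longlonglongrightarrow> 0"
proof -
  have sub: "ball e (1 / real (Suc n)) \<subseteq> ball e 1" for n by (rule subset_ball) simp
  let ?B = "\<lambda>n. ball e (1 / real (Suc n))"
  have "(\<lambda>n. LINT z|lebesgue. indicator (?B n) (x + z) * frac_kernel s z)
      \<longlonglongrightarrow> (LINT z|lebesgue. indicator {e} (x + z) * frac_kernel s z)"
  proof (rule integral_kernel_tendsto[OF s, where C = 1])
    show "(\<lambda>z. indicator (?B n) (x + z) :: real) \<in> borel_measurable lebesgue" for n
      by (rule measurable_lebesgue_shift[OF lebesgue_measurable_indicator_ball])
    fix z :: 'a
    have "indicator (ball e 1) (x + z) \<le> msq z" by (rule indicator_ball_le[OF s far]) simp_all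
    then show "\<bar>indicator (?B n) (x + z) :: real\<bar> \<le> 1 * msq z" for n
      using subsetD[OF sub[of n], of "x + z"]
      by (auto simp: indicator_def simp del: mem_ball of_nat_Suc split: if_splits)
    show "(\<lambda>n. indicator (?B n) (x + z) :: real) \<longlonglongrightarrow> indicator {e} (x + z)"
    proof (cases "x + z = e")
      case False
      then have "\<forall>\<^sub>F n in sequentially. inverse (real (Suc n)) < dist e (x + z)"
        using LIMSEQ_inverse_real_of_nat by (intro order_tendstoD) auto
      then have "\<forall>\<^sub>F n in sequentially. indicator (?B n) (x + z) = (0::real)"
        by eventually_elim (auto simp: inverse_eq_divide)
      then show ?thesis using False by (simp add: tendsto_eventually)
    qed simp
  qed
  also have "(LINT z|lebesgue. indicator {e} (x + z) * frac_kernel s z) = 0"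
  proof (rule integral_eq_zero_AE)
    have "AE z in lebesgue. z \<noteq> e - x"
      using AE_completion[OF AE_lborel_singleton[of "e - x"]] by simp
    then show "AE z in lebesgue. indicator {e} (x + z) * frac_kernel s z = 0"
      by eventually_elim (auto simp: algebra_simps)
  qed
  finally show ?thesis by (simp add: ball_mass_def)
qed

text \<open>A tall thin peak outside \<open>\<Omega>\<close> leaves the fractional Laplacian almost unchanged but makes \<open>D\<^sub>s\<close>
  as large as desired. So the viscosity inequality holds with every larger value of the gradient.\<close>

lemma visc_quad_at_Ds:
  fixes f :: "'a::euclidean_space \<Rightarrow> real" and H :: "'a \<times> real \<Rightarrow> real"
  assumes s: "0 < s" "s < 1" and \<Omega>: "open \<Omega>" "bounded \<Omega>" "x \<in> \<Omega>"
    and H: "continuous_on UNIV H" and sg: "sg = 1 \<or> sg = (- 1 :: real)"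
    and visc: "\<And>\<phi>. test_function s \<sigma> \<Omega> \<phi> \<Longrightarrow> (\<forall>y. sg * (u y - \<phi> y) \<le> sg * (u x - \<phi> x)) \<Longrightarrow> Bform_finite s \<phi> \<phi> x
        \<Longrightarrow> sg * (\<sigma> * frac_lap s \<phi> x + H (x, Ds s \<phi> x)) \<le> 0"
    and f: "quad_at x l C f" "continuous_on (closure \<Omega>) f" "\<And>y. sg * u y \<le> sg * f y" "u x = f x"
    and p: "Ds s f x \<le> p"
  shows "sg * (\<sigma> * frac_lap s f x + H (x, p)) \<le> 0"
proof -
  obtain e b :: 'a and R where far: "\<And>v w. v \<in> closure \<Omega> \<Longrightarrow> w \<in> ball e 1 \<Longrightarrow> 1 \<le> norm (w - v)"
    using ex_far_direction[OF \<Omega>(2)] by metis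
  have xcl: "x \<in> closure \<Omega>" using \<Omega>(3) closure_subset by blast
  define c where "c = frac_const DIM('a) s"
  have c: "0 < c" unfolding c_def by (rule frac_const_pos[OF s])
  define \<kappa> where "\<kappa> n = ball_mass s e (1 / real (Suc n)) x" for n
  have farn: "1 \<le> norm (w - v)" if "v \<in> closure \<Omega>" "w \<in> ball e (1 / real (Suc n))" for v w n
  proof -
    have "ball e (1 / real (Suc n)) \<subseteq> ball e 1" by (rule subset_ball) simp
    then show ?thesis using far that by blast
  qed
  have dpos: "0 < 1 / real (Suc n)" for n by simp
  note pk = s farn[OF xcl] dpos
  have \<kappa>: "0 < \<kappa> n" for n unfolding \<kappa>_def by (rule ball_mass_pos[OF pk])
  have \<kappa>0: "\<kappa> \<longlonglongrightarrow> 0" unfolding \<kappa>_def by (rule ball_mass_tendsto_0[OF s far[OF xcl]])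
  define A where "A = Bform s f f x"
  have "0 \<le> A" unfolding A_def by (rule Bform_nonneg[OF s])
  have p0: "0 \<le> p" using p \<open>0 \<le> A\<close> by (auto simp: Ds_def A_def intro: order_trans[OF real_sqrt_ge_zero])
  have "sqrt A \<le> p" using p by (simp add: Ds_def A_def)
  then have Ap: "A \<le> p\<^sup>2" by (rule sqrt_le_D)
  \<comment> \<open>The solution of \<open>c / 2 * t\<^sup>2 * \<kappa> = p\<^sup>2 - A\<close>: the
    quadratic term of the peak supplies exactly the missing energy. Then
    \<open>t n * \<kappa> n\<close> is of order \<open>sqrt (\<kappa> n)\<close> and vanishes, and
    with it the change of the Laplacian and the cross term.\<close>
  define t where "t n = sqrt (2 * (p\<^sup>2 - A) / c / \<kappa> n)" for n
  have t0: "0 \<le> t n" for n unfolding t_def using Ap c \<kappa>[of n] by simp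
  have t2: "c / 2 * ((t n)\<^sup>2 * \<kappa> n) = p\<^sup>2 - A" for n
    unfolding t_def using Ap c \<kappa>[of n] by simp
  have t\<kappa>: "t n * \<kappa> n = sqrt (2 * (p\<^sup>2 - A) / c * \<kappa> n)" for n
  proof (rule real_sqrt_unique[symmetric])
    have "(t n * \<kappa> n)\<^sup>2 = (t n)\<^sup>2 * \<kappa> n * \<kappa> n" by (simp add: power2_eq_square)
    moreover have "(t n)\<^sup>2 * \<kappa> n = 2 * (p\<^sup>2 - A) / c"
      using t2[of n] c by (simp add: field_simps)
    ultimately show "(t n * \<kappa> n)\<^sup>2 = 2 * (p\<^sup>2 - A) / c * \<kappa> n" by simp
    show "0 \<le> t n * \<kappa> n" using t0 \<kappa>[of n] by simp
  qed
  have t\<kappa>0: "(\<lambda>n. t n * \<kappa> n) \<longlonglongrightarrow> 0"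
    unfolding t\<kappa> using tendsto_real_sqrt[OF tendsto_mult_left[OF \<kappa>0, of "2 * (p\<^sup>2 - A) / c"]]
    by (simp only: mult_zero_right real_sqrt_zero)
  \<comment> \<open>The peak points up for sub solutions and down for super solutions, so the
    touching survives. On the closure of \<open>\<Omega>\<close> nothing changes, in particular not
    the continuity.\<close>
  define F where "F n v = f v + sg * t n * indicator (ball e (1 / real (Suc n))) v" for n v
  have F: "quad_at x l (C + \<bar>sg * t n\<bar>) (F n)" for n
    unfolding F_def by (rule quad_at_add_peak[OF pk f(1)])
  have Fcl: "F n v = f v" if "v \<in> closure \<Omega>" for n v
    using centre_notin_ball[where e = e and \<delta> = "1 / real (Suc n)" and x = v, OF s farn[OF that] dpos] by (simp add: F_def)
  have sg2: "sg * sg = 1" using sg by auto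
  have ineq: "sg * (\<sigma> * frac_lap s (F n) x + H (x, Ds s (F n) x)) \<le> 0" for n
  proof (rule visc_quad_at[where u = u and G = "Ds s" and fin = "\<lambda>\<phi>. Bform_finite s \<phi> \<phi>",
        OF s \<Omega> H sg visc F])
    show "continuous_on (closure \<Omega>) (F n)"
      by (rule continuous_on_eq[OF f(2)]) (simp add: Fcl)
    show "u x = F n x" using f(4) Fcl[OF xcl] by simp
    show "sg * u y \<le> sg * F n y" for y
    proof -
      have "sg * F n y = sg * f y + t n * indicator (ball e (1 / real (Suc n))) y"
        using sg2 by (simp add: F_def distrib_left mult.assoc[symmetric])
      moreover have "0 \<le> t n * indicator (ball e (1 / real (Suc n))) y" using t0 by simp
      ultimately show ?thesis using f(3)[of y] by linarith
    qed
    show "Bform_finite s \<phi> \<phi> x" if "quad_at x l C' \<phi>" for \<phi> C'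
      by (rule Bform_finite_quad[OF that quad_at_admissible[OF s that]])
    show "(\<lambda>m. Ds s (G m) x) \<longlonglongrightarrow> Ds s (F n) x"
      if "\<And>m. quad_at x l C' (G m)" "\<And>v. (\<lambda>m. G m v) \<longlonglongrightarrow> F n v" for G C'
      unfolding Ds_def by (intro tendsto_real_sqrt Bform_self_tendsto[OF s that])
  qed auto
  have "\<exists>\<beta>. \<bar>\<beta>\<bar> \<le> (norm l + C) * \<kappa> n \<and>
      Bform s (F n) (F n) x = A + c / 2 * (2 * (sg * t n * \<beta>) + (sg * t n)\<^sup>2 * \<kappa> n)" for n
    by (rule Bform_add_peak[where \<delta> = "1 / real (Suc n)" and t = "sg * t n", OF pk f(1)]) (auto simp: F_def[abs_def] \<kappa>_def A_def c_def)
  then obtain \<beta> where \<beta>: "\<And>n. \<bar>\<beta> n\<bar> \<le> (norm l + C) * \<kappa> n"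
      "\<And>n. Bform s (F n) (F n) x = A + c / 2 * (2 * (sg * t n * \<beta> n) + (sg * t n)\<^sup>2 * \<kappa> n)"
    by metis
  have B: "Bform s (F n) (F n) x = p\<^sup>2 + c * sg * (t n * \<beta> n)" for n
    using \<beta>(2)[of n] t2[of n] sg2 by (simp add: power_mult_distrib power2_eq_square[of sg] algebra_simps)
  have "(\<lambda>n. t n * \<beta> n) \<longlonglongrightarrow> 0"
  proof (rule Lim_null_comparison)
    show "\<forall>\<^sub>F n in sequentially. norm (t n * \<beta> n) \<le> (norm l + C) * (t n * \<kappa> n)"
    proof (rule always_eventually, rule allI)
      fix n
      have "t n * \<bar>\<beta> n\<bar> \<le> t n * ((norm l + C) * \<kappa> n)" using \<beta>(1) t0 by (rule mult_left_mono)
      then show "norm (t n * \<beta> n) \<le> (norm l + C) * (t n * \<kappa> n)"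
        using t0[of n] by (simp add: abs_mult mult_ac)
    qed
    show "(\<lambda>n. (norm l + C) * (t n * \<kappa> n)) \<longlonglongrightarrow> 0" using tendsto_mult_left[OF t\<kappa>0, of "norm l + C"] by simp
  qed
  then have "(\<lambda>n. Bform s (F n) (F n) x) \<longlonglongrightarrow> p\<^sup>2 + c * sg * 0"
    unfolding B by (intro tendsto_intros)
  then have "(\<lambda>n. Ds s (F n) x) \<longlonglongrightarrow> sqrt (p\<^sup>2)"
    unfolding Ds_def by (intro tendsto_real_sqrt) simp
  then have Dlim: "(\<lambda>n. Ds s (F n) x) \<longlonglongrightarrow> p" using p0 by simp
  have "frac_lap s (F n) x = frac_lap s f x - c * sg * (t n * \<kappa> n)" for n
    unfolding F_def c_def \<kappa>_def using frac_lap_add_peak[OF pk f(1), where t = "sg * t n"] by (simp add: mult_ac)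
  then have "(\<lambda>n. frac_lap s (F n) x) \<longlonglongrightarrow> frac_lap s f x - c * sg * 0"
    by (simp only:) (intro tendsto_intros t\<kappa>0)
  then have Llim: "(\<lambda>n. frac_lap s (F n) x) \<longlonglongrightarrow> frac_lap s f x" by simp
  have "isCont H (x, p)" using H by (simp add: continuous_on_eq_continuous_at)
  then have "(\<lambda>n. H (x, Ds s (F n) x)) \<longlonglongrightarrow> H (x, p)"
    by (rule isCont_tendsto_compose) (intro tendsto_Pair tendsto_const Dlim)
  then have "(\<lambda>n. sg * (\<sigma> * frac_lap s (F n) x + H (x, Ds s (F n) x))) \<longlonglongrightarrow> sg * (\<sigma> * frac_lap s f x + H (x, p))"
    by (intro tendsto_intros Llim)
  then show ?thesis using ineq by (intro LIMSEQ_le_const2) auto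
qed

section \<open>Doubling of variables\<close>

text \<open>The doubled maximum is at least every diagonal value \<open>w a - v a\<close>, which
  bounds the penalty and forces the maximizers to a common limit. There \<open>w - v\<close> is
  still positive, so the limit is interior. A tail of the subsequence is taken to make all closeness
  bounds hold for every index. The last conclusion holds for all \<open>a\<close> in the space,
  because outside \<open>\<Omega>\<close> the difference is nonpositive.\<close>

lemma doubling_of_variables:
  fixes w v :: "'a::euclidean_space \<Rightarrow> real"
  assumes \<Omega>: "open \<Omega>" "bounded \<Omega>"
    and cont: "continuous_on (closure \<Omega>) w" "continuous_on (closure \<Omega>) v"
    and off: "\<forall>a. a \<notin> \<Omega> \<longrightarrow> w a \<le> v a" and pos: "x0 \<in> \<Omega>" "v x0 < w x0"
  obtains xh r X Y k where "xh \<in> \<Omega>" "0 < r" "r \<le> 1" "cball xh (2 * r) \<subseteq> \<Omega>"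
    "X \<longlonglongrightarrow> xh" "Y \<longlonglongrightarrow> xh" "\<And>n. norm (X n - xh) \<le> r" "\<And>n. norm (Y n - xh) \<le> r"
    "\<And>n. 1 \<le> k n" "(\<lambda>n. sqrt (k n) * norm (X n - Y n)) \<longlonglongrightarrow> 0" "\<And>n. sqrt (k n) * norm (X n - Y n) \<le> 1"
    "\<And>n a b. a \<in> closure \<Omega> \<Longrightarrow> b \<in> closure \<Omega> \<Longrightarrow>
      w a - v b - k n * (norm (a - b))\<^sup>2 \<le> w (X n) - v (Y n) - k n * (norm (X n - Y n))\<^sup>2"
    "\<And>n a. w a - v a \<le> w (X n) - v (Y n)"
proof -
  let ?K = "closure \<Omega>"
  have K: "compact ?K" using \<Omega>(2) by simp
  have x0: "x0 \<in> ?K" using pos(1) closure_subset by blast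
  define \<Phi> where "\<Phi> m p = w (fst p) - v (snd p) - real (Suc m) * (norm (fst p - snd p))\<^sup>2" for m p
  have "\<exists>p\<in>?K \<times> ?K. \<forall>q\<in>?K \<times> ?K. \<Phi> m q \<le> \<Phi> m p" for m
  proof (rule continuous_attains_sup)
    show "compact (?K \<times> ?K)" using K by (intro compact_Times)
    show "?K \<times> ?K \<noteq> {}" using x0 by auto
    have "continuous_on (?K \<times> ?K) (\<lambda>p. w (fst p))" "continuous_on (?K \<times> ?K) (\<lambda>p. v (snd p))"
      by (rule continuous_on_compose2[OF cont(1) continuous_on_fst[OF continuous_on_id]], auto,
          rule continuous_on_compose2[OF cont(2) continuous_on_snd[OF continuous_on_id]], auto)
    then show "continuous_on (?K \<times> ?K) (\<Phi> m)" unfolding \<Phi>_def by (intro continuous_intros)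
  qed
  then obtain Z where Z: "\<And>m. Z m \<in> ?K \<times> ?K" "\<And>m q. q \<in> ?K \<times> ?K \<Longrightarrow> \<Phi> m q \<le> \<Phi> m (Z m)"
    by metis
  obtain z \<sigma> where z: "z \<in> ?K \<times> ?K" "strict_mono \<sigma>" "(Z \<circ> \<sigma>) \<longlonglongrightarrow> z"
    using compact_Times[OF K K] Z(1) unfolding compact_def by metis
  define xh where "xh = fst z"
  have ZK: "fst (Z m) \<in> ?K" "snd (Z m) \<in> ?K" for m using Z(1)[of m] by (auto simp: mem_Times_iff)
  have zK: "fst z \<in> ?K" "snd z \<in> ?K" using z(1) by (auto simp: mem_Times_iff)
  have lX: "(\<lambda>n. fst (Z (\<sigma> n))) \<longlonglongrightarrow> xh" and lY: "(\<lambda>n. snd (Z (\<sigma> n))) \<longlonglongrightarrow> snd z"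
    using tendsto_fst[OF z(3)] tendsto_snd[OF z(3)] by (simp_all add: xh_def o_def)
  have lw: "(\<lambda>n. w (fst (Z (\<sigma> n)))) \<longlonglongrightarrow> w xh"
    by (rule continuous_on_tendsto_compose[OF cont(1) lX]) (use zK ZK in \<open>auto simp: xh_def\<close>)
  have lv: "(\<lambda>n. v (snd (Z (\<sigma> n)))) \<longlonglongrightarrow> v (snd z)"
    by (rule continuous_on_tendsto_compose[OF cont(2) lY]) (use zK ZK in auto)
  have diag: "w a - v a \<le> \<Phi> m (Z m)" if "a \<in> ?K" for a m
    using Z(2)[of "(a, a)" m] that by (simp add: \<Phi>_def)
  have pen: "real (Suc m) * (norm (fst (Z m) - snd (Z m)))\<^sup>2 \<le> w (fst (Z m)) - v (snd (Z m)) - (w a - v a)"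
    if "a \<in> ?K" for a m
    using diag[OF that, of m] by (simp add: \<Phi>_def)
  have "(\<lambda>n. (norm (fst (Z (\<sigma> n)) - snd (Z (\<sigma> n))))\<^sup>2) \<longlonglongrightarrow> 0"
  proof (rule Lim_null_comparison)
    have "(\<lambda>n. inverse (real (Suc (\<sigma> n)))) \<longlonglongrightarrow> 0"
      using LIMSEQ_subseq_LIMSEQ[OF LIMSEQ_inverse_real_of_nat z(2)] by (simp add: o_def)
    then show "(\<lambda>n. inverse (real (Suc (\<sigma> n))) * (w (fst (Z (\<sigma> n))) - v (snd (Z (\<sigma> n))) - (w x0 - v x0))) \<longlonglongrightarrow> 0"
      using tendsto_mult[OF _ tendsto_diff[OF tendsto_diff[OF lw lv] tendsto_const[of "w x0 - v x0"]]]
      by fastforce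
    show "\<forall>\<^sub>F n in sequentially. norm ((norm (fst (Z (\<sigma> n)) - snd (Z (\<sigma> n))))\<^sup>2)
      \<le> inverse (real (Suc (\<sigma> n))) * (w (fst (Z (\<sigma> n))) - v (snd (Z (\<sigma> n))) - (w x0 - v x0))"
      using pen[OF x0] by (intro always_eventually allI) (simp add: field_simps)
  qed
  moreover have "(\<lambda>n. (norm (fst (Z (\<sigma> n)) - snd (Z (\<sigma> n))))\<^sup>2) \<longlonglongrightarrow> (norm (xh - snd z))\<^sup>2"
    by (intro tendsto_intros lX lY)
  ultimately have "(norm (xh - snd z))\<^sup>2 = 0" using LIMSEQ_unique by blast
  then have z2: "snd z = xh" by simp
  define k where "k n = real (Suc (\<sigma> n))" for n
  \<comment> \<open>With the limit point itself as diagonal competitor the upper bound of the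
    penalty tends to 0 by continuity of \<open>w\<close> and \<open>v\<close>; a fixed competitor
    such as \<open>x0\<close> only gives boundedness.\<close>
  have kpen: "(\<lambda>n. k n * (norm (fst (Z (\<sigma> n)) - snd (Z (\<sigma> n))))\<^sup>2) \<longlonglongrightarrow> 0"
  proof (rule tendsto_sandwich[OF _ _ tendsto_const])
    show "(\<lambda>n. w (fst (Z (\<sigma> n))) - v (snd (Z (\<sigma> n))) - (w xh - v xh)) \<longlonglongrightarrow> 0"
      using tendsto_diff[OF tendsto_diff[OF lw lv] tendsto_const[of "w xh - v xh"]] z2 by simp
    show "\<forall>\<^sub>F n in sequentially. k n * (norm (fst (Z (\<sigma> n)) - snd (Z (\<sigma> n))))\<^sup>2
        \<le> w (fst (Z (\<sigma> n))) - v (snd (Z (\<sigma> n))) - (w xh - v xh)"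
      using pen[of xh] zK unfolding k_def xh_def by (intro always_eventually allI) auto
  qed (auto simp: k_def)
  have sq: "(\<lambda>n. sqrt (k n) * norm (fst (Z (\<sigma> n)) - snd (Z (\<sigma> n)))) \<longlonglongrightarrow> 0"
    using tendsto_real_sqrt[OF kpen] by (simp add: real_sqrt_mult)
  have ge: "w x0 - v x0 \<le> w (fst (Z m)) - v (snd (Z m))" for m
    using pen[OF x0, of m] zero_le_power2[of "norm (fst (Z m) - snd (Z m))"]
    by (smt (verit) mult_nonneg_nonneg of_nat_0_le_iff)
  have "w x0 - v x0 \<le> w xh - v xh"
    by (rule LIMSEQ_le_const[OF tendsto_diff[OF lw lv[unfolded z2]]]) (use ge in auto)
  then have xh: "xh \<in> \<Omega>" using off pos(2) by force
  have bound: "w a - v a \<le> w (fst (Z m)) - v (snd (Z m))" for a m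
  proof (cases "a \<in> ?K")
    case True
    then show ?thesis using pen[OF True, of m] zero_le_power2[of "norm (fst (Z m) - snd (Z m))"]
      by (smt (verit) mult_nonneg_nonneg of_nat_0_le_iff)
  next
    case False
    then have "a \<notin> \<Omega>" using closure_subset by blast
    then show ?thesis using spec[OF off, of a] ge[of m] pos(2) by simp
  qed
  obtain \<epsilon> where \<epsilon>: "0 < \<epsilon>" "cball xh \<epsilon> \<subseteq> \<Omega>"
    using \<Omega>(1) xh open_contains_cball by blast
  \<comment> \<open>Halved so that a point at distance at most \<open>r\<close> from
    \<open>xh\<close> can still be moved by \<open>r\<close> inside \<open>\<Omega>\<close>; at most
    1 so that \<open>msq\<close> is the squared norm on increments of length up to
    \<open>r\<close>.\<close>
  define r where "r = min 1 (\<epsilon> / 2)"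
  have r: "0 < r" "r \<le> 1" "cball xh (2 * r) \<subseteq> \<Omega>"
    using \<epsilon> by (auto simp: r_def min_def)
  have "\<forall>\<^sub>F n in sequentially. norm (fst (Z (\<sigma> n)) - xh) < r \<and> norm (snd (Z (\<sigma> n)) - xh) < r
      \<and> sqrt (k n) * norm (fst (Z (\<sigma> n)) - snd (Z (\<sigma> n))) < 1"
    using tendstoD[OF lX r(1)] tendstoD[OF lY[unfolded z2] r(1)] order_tendstoD(2)[OF sq, of 1]
    by (simp add: dist_norm eventually_conj)
  then obtain N where N: "\<And>n. n \<ge> N \<Longrightarrow> norm (fst (Z (\<sigma> n)) - xh) < r \<and> norm (snd (Z (\<sigma> n)) - xh) < r
      \<and> sqrt (k n) * norm (fst (Z (\<sigma> n)) - snd (Z (\<sigma> n))) < 1"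
    unfolding eventually_sequentially by blast
  show ?thesis
  proof (rule that[of xh r "\<lambda>n. fst (Z (\<sigma> (n + N)))" "\<lambda>n. snd (Z (\<sigma> (n + N)))" "\<lambda>n. k (n + N)"])
    show "(\<lambda>n. fst (Z (\<sigma> (n + N)))) \<longlonglongrightarrow> xh" "(\<lambda>n. snd (Z (\<sigma> (n + N)))) \<longlonglongrightarrow> xh"
      "(\<lambda>n. sqrt (k (n + N)) * norm (fst (Z (\<sigma> (n + N))) - snd (Z (\<sigma> (n + N))))) \<longlonglongrightarrow> 0"
      using LIMSEQ_ignore_initial_segment[OF lX, of N] LIMSEQ_ignore_initial_segment[OF lY, of N]
        LIMSEQ_ignore_initial_segment[OF sq, of N] z2 by simp_all
    show "w a - v b - k (n + N) * (norm (a - b))\<^sup>2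
      \<le> w (fst (Z (\<sigma> (n + N)))) - v (snd (Z (\<sigma> (n + N)))) - k (n + N) * (norm (fst (Z (\<sigma> (n + N))) - snd (Z (\<sigma> (n + N)))))\<^sup>2"
      if "a \<in> ?K" "b \<in> ?K" for n a b
      using Z(2)[of "(a, b)" "\<sigma> (n + N)"] that by (simp add: \<Phi>_def k_def)
  qed (use r xh N bound in \<open>auto simp: less_imp_le k_def\<close>)
qed

section \<open>Gluing prescribed increments to a given function\<close>

definition cutoff :: "real \<Rightarrow> 'a::euclidean_space \<Rightarrow> real" where
  "cutoff r z = max 0 (min 1 (2 - 2 * norm z / r))"

lemma cutoff_range [simp]: "0 \<le> cutoff r z" "cutoff r z \<le> 1"
  by (auto simp: cutoff_def)

lemma cutoff_eq_1: "0 < r \<Longrightarrow> norm z \<le> r / 2 \<Longrightarrow> cutoff r z = 1"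
  by (simp add: cutoff_def field_simps)

lemma cutoff_eq_0: "0 < r \<Longrightarrow> r \<le> norm z \<Longrightarrow> cutoff r z = 0"
  by (simp add: cutoff_def field_simps)

lemma cutoff_0 [simp]: "cutoff r 0 = 1"
  by (simp add: cutoff_def)

lemma continuous_on_cutoff [continuous_intros]: "continuous_on S f \<Longrightarrow> continuous_on S (\<lambda>z. cutoff r (f z))"
  unfolding cutoff_def divide_inverse by (intro continuous_intros)

text \<open>A convex combination of an increment \<open>g\<close> relative to the centre and a
  difference \<open>u y - b\<close> at the absolute point \<open>y\<close>, so one-sided bounds
  shared by both are inherited. The reference \<open>b\<close> may be the value of \<open>u\<close>
  at another point than the centre. The cutoff is piecewise linear: it is 1 near the centre, so the
  expansion there is that of \<open>g\<close>, and elsewhere continuity is enough.\<close>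

definition glue :: "real \<Rightarrow> ('a \<Rightarrow> real) \<Rightarrow> ('a \<Rightarrow> real) \<Rightarrow> real \<Rightarrow> 'a \<Rightarrow> 'a::euclidean_space \<Rightarrow> real" where
  "glue r g u b x y = cutoff r (y - x) * g (y - x) + (1 - cutoff r (y - x)) * (u y - b)"

lemma glue_le:
  assumes "0 < r" "norm (y - x) \<le> r \<Longrightarrow> g (y - x) \<le> c" "u y - b \<le> c"
  shows "glue r g u b x y \<le> c"
proof (cases "norm (y - x) \<le> r")
  case True
  have "cutoff r (y - x) * g (y - x) + (1 - cutoff r (y - x)) * (u y - b)
      \<le> cutoff r (y - x) * c + (1 - cutoff r (y - x)) * c"
    using assms True by (intro add_mono mult_left_mono) auto
  then show ?thesis by (simp add: glue_def algebra_simps)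
next
  case False
  then show ?thesis using assms cutoff_eq_0[of r "y - x"] by (simp add: glue_def)
qed

lemma glue_ge:
  assumes "0 < r" "norm (y - x) \<le> r \<Longrightarrow> c \<le> g (y - x)" "c \<le> u y - b"
  shows "c \<le> glue r g u b x y"
proof (cases "norm (y - x) \<le> r")
  case True
  have "cutoff r (y - x) * c + (1 - cutoff r (y - x)) * c
      \<le> cutoff r (y - x) * g (y - x) + (1 - cutoff r (y - x)) * (u y - b)"
    using assms True by (intro add_mono mult_left_mono) auto
  then show ?thesis by (simp add: glue_def algebra_simps)
next
  case False
  then show ?thesis using assms cutoff_eq_0[of r "y - x"] by (simp add: glue_def)
qed

context
  fixes \<Omega> :: "'a::euclidean_space set" and x :: 'a and g u :: "'a \<Rightarrow> real" and r b B :: real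
  assumes r: "0 < r" "r \<le> 1"
    and inside: "\<And>z. norm z \<le> r \<Longrightarrow> x + z \<in> closure \<Omega>"
    and gcont: "continuous_on (cball 0 r) g" and gB: "\<And>z. norm z \<le> r \<Longrightarrow> \<bar>g z\<bar> \<le> B"
    and ucont: "continuous_on (closure \<Omega>) u" and um: "u \<in> borel_measurable lebesgue"
    and uB: "\<And>p. \<bar>u p - b\<bar> \<le> B" and g0: "g 0 = 0"
begin

text \<open>\<open>g\<close> is controlled on the ball of radius \<open>r\<close> only. The two
  closed pieces overlap on the sphere, where the cutoff is already 0.\<close>

lemma continuous_on_glue: "continuous_on (closure \<Omega>) (glue r g u b x)"
proof -
  let ?K = "closure \<Omega>"
  have "continuous_on (?K \<inter> cball x r) (glue r g u b x)"
  proof -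
    have "continuous_on (?K \<inter> cball x r) (\<lambda>y. g (y - x))"
      by (rule continuous_on_compose2[OF gcont]) (auto intro!: continuous_intros simp: dist_norm norm_minus_commute)
    moreover have "continuous_on (?K \<inter> cball x r) u" using ucont by (rule continuous_on_subset) auto
    ultimately show ?thesis unfolding glue_def by (intro continuous_intros)
  qed
  moreover have "continuous_on (?K - ball x r) (glue r g u b x)"
  proof -
    have "continuous_on (?K - ball x r) (\<lambda>y. u y - b)"
      by (intro continuous_intros continuous_on_subset[OF ucont]) auto
    then show ?thesis
    proof (rule continuous_on_eq)
      fix y assume "y \<in> ?K - ball x r"
      then have "cutoff r (y - x) = 0" using r by (intro cutoff_eq_0) (auto simp: dist_norm norm_minus_commute)
      then show "u y - b = glue r g u b x y" by (simp add: glue_def)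
    qed
  qed
  ultimately have "continuous_on ((?K \<inter> cball x r) \<union> (?K - ball x r)) (glue r g u b x)"
    by (intro continuous_on_closed_Un) (auto intro: closed_Diff)
  moreover have "(?K \<inter> cball x r) \<union> (?K - ball x r) = ?K" by auto
  ultimately show ?thesis by simp
qed

lemma glue_outside: "y \<notin> closure \<Omega> \<Longrightarrow> glue r g u b x y = u y - b"
proof -
  assume "y \<notin> closure \<Omega>"
  then have "r \<le> norm (y - x)" using inside[of "y - x"] by force
  then show ?thesis using cutoff_eq_0[of r "y - x"] r by (simp add: glue_def)
qed

lemma measurable_glue: "glue r g u b x \<in> borel_measurable lebesgue"
proof -
  have "(\<lambda>y. indicator (closure \<Omega>) y *\<^sub>R glue r g u b x y) \<in> borel_measurable borel"
    by (rule borel_measurable_continuous_on_indicator[OF _ continuous_on_glue]) auto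
  then have "(\<lambda>y. indicator (closure \<Omega>) y *\<^sub>R glue r g u b x y) \<in> borel_measurable lebesgue"
    by (auto intro: measurable_completion)
  moreover have "(\<lambda>y. u y - b) \<in> borel_measurable lebesgue" using um by measurable
  moreover have "closure \<Omega> \<in> sets lebesgue" by (auto intro: sets_completionI_sets)
  ultimately have "(\<lambda>y. if y \<in> closure \<Omega> then indicator (closure \<Omega>) y *\<^sub>R glue r g u b x y else u y - b) \<in> borel_measurable lebesgue"
    by (intro measurable_If_set) auto
  moreover have "(\<lambda>y. if y \<in> closure \<Omega> then indicator (closure \<Omega>) y *\<^sub>R glue r g u b x y else u y - b) = glue r g u b x"
    using glue_outside by (auto simp: fun_eq_iff)
  ultimately show ?thesis by simp
qed

lemma glue_bounded: "\<bar>glue r g u b x y\<bar> \<le> B"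
proof -
  have "glue r g u b x y \<le> B"
    by (rule glue_le[OF r(1)]) (use gB[of "y - x"] uB[of y] in auto)
  moreover have "- B \<le> glue r g u b x y"
    by (rule glue_ge[OF r(1)]) (use gB[of "y - x"] uB[of y] in auto)
  ultimately show ?thesis by linarith
qed

lemma quad_at_glue:
  assumes "\<And>z. norm z \<le> r \<Longrightarrow> \<bar>g z - l \<bullet> z\<bar> \<le> k * (norm z)\<^sup>2"
  shows "\<exists>C. quad_at x l C (\<lambda>y. c + glue r g u b x y)"
proof (rule quad_atI_bounded)
  show "(\<lambda>y. c + glue r g u b x y) \<in> borel_measurable lebesgue" using measurable_glue by measurable
  show "\<bar>c + glue r g u b x v\<bar> \<le> \<bar>c\<bar> + B" for v using glue_bounded[of v] by linarith
  show "0 < r / 2" using r by simp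
  show "\<bar>c + glue r g u b x (x + z) - (c + glue r g u b x x) - l \<bullet> z\<bar> \<le> k * (norm z)\<^sup>2"
    if "norm z < r / 2" for z
    using assms[of z] that r cutoff_eq_1[of r z] g0 by (simp add: glue_def)
qed

text \<open>Convexity of the square separates the two parts. The near part is at most
  \<open>A\<^sup>2 * k * (norm z)\<^sup>2\<close>; the far part lives where
  \<open>norm z > r / 2\<close>, so \<open>B\<^sup>2\<close> is absorbed by
  \<open>msq z \<ge> r\<^sup>2 / 4\<close>. The resulting energy bound is linear in
  \<open>k\<close>.\<close>

lemma glue_square_le:
  assumes A: "\<And>z. norm z \<le> r \<Longrightarrow> \<bar>g z\<bar> \<le> A * sqrt k * norm z" and k: "1 \<le> k"
  shows "(glue r g u b x (x + z))\<^sup>2 \<le> (A\<^sup>2 + 4 * B\<^sup>2 / r\<^sup>2) * k * msq z"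
proof -
  let ?c = "cutoff r z" and ?m = "msq z"
  let ?d = "u (x + z) - b"
  have "(glue r g u b x (x + z))\<^sup>2 \<le> ?c * (g z)\<^sup>2 + (1 - ?c) * ?d\<^sup>2"
  proof -
    have "?c * (g z)\<^sup>2 + (1 - ?c) * ?d\<^sup>2 - (?c * g z + (1 - ?c) * ?d)\<^sup>2 = ?c * (1 - ?c) * (g z - ?d)\<^sup>2"
      by (simp add: power2_eq_square algebra_simps)
    moreover have "0 \<le> ?c * (1 - ?c) * (g z - ?d)\<^sup>2" by simp
    ultimately have "(?c * g z + (1 - ?c) * ?d)\<^sup>2 \<le> ?c * (g z)\<^sup>2 + (1 - ?c) * ?d\<^sup>2" by linarith
    then show ?thesis by (simp add: glue_def)
  qed
  also have "?c * (g z)\<^sup>2 \<le> A\<^sup>2 * k * ?m"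
  proof (cases "norm z \<le> r")
    case True
    have "\<bar>g z\<bar>\<^sup>2 \<le> (A * sqrt k * norm z)\<^sup>2" using A[OF True] by (intro power_mono) auto
    then have "(g z)\<^sup>2 \<le> A\<^sup>2 * k * (norm z)\<^sup>2" using k by (simp add: power_mult_distrib)
    moreover have "?m = (norm z)\<^sup>2" using True r by (intro min_absorb2 power_le_one) auto
    moreover have "?c * (g z)\<^sup>2 \<le> 1 * (g z)\<^sup>2" by (intro mult_right_mono) auto
    ultimately show ?thesis by simp
  next
    case False
    then show ?thesis using cutoff_eq_0[of r z] r k by simp
  qed
  also have "(1 - ?c) * ?d\<^sup>2 \<le> 4 * B\<^sup>2 / r\<^sup>2 * k * ?m"
  proof (cases "norm z \<le> r / 2")
    case True
    then show ?thesis using cutoff_eq_1[of r z] r k by simp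
  next
    case False
    have B0: "0 \<le> B" using uB[of x] by linarith
    have "\<bar>?d\<bar>\<^sup>2 \<le> B\<^sup>2" using uB[of "x + z"] by (intro power_mono) auto
    moreover have "(1 - ?c) * ?d\<^sup>2 \<le> 1 * ?d\<^sup>2" by (intro mult_right_mono) auto
    moreover have "(r / 2)\<^sup>2 \<le> ?m"
      using False r by (auto intro!: power_mono power_le_one)
    then have "B\<^sup>2 * 4 / r\<^sup>2 * (r / 2)\<^sup>2 \<le> B\<^sup>2 * 4 / r\<^sup>2 * ?m" by (intro mult_left_mono) auto
    then have "B\<^sup>2 \<le> 4 * B\<^sup>2 / r\<^sup>2 * ?m" using r by (simp add: power_divide mult.commute)
    moreover have "4 * B\<^sup>2 / r\<^sup>2 * ?m * 1 \<le> 4 * B\<^sup>2 / r\<^sup>2 * ?m * k" using k by (intro mult_left_mono) auto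
    ultimately show ?thesis by (simp add: mult_ac)
  qed
  finally show ?thesis by (simp add: distrib_right)
qed

end

section \<open>Coupled test functions\<close>

text \<open>The kernel that acts on the part of \<open>glue\<close> given by absolute points. After
  the substitution \<open>p = x + z\<close> the centre occurs in this regular kernel and no longer
  in the argument of \<open>u\<close>, so moving the centre is a limit of kernels.\<close>

definition far_kernel :: "real \<Rightarrow> real \<Rightarrow> 'a::euclidean_space \<Rightarrow> real" where
  "far_kernel s r z = (1 - cutoff r z) * frac_kernel s z"

lemma far_kernel_nonneg [simp]: "0 \<le> far_kernel s r z"
  by (simp add: far_kernel_def)

lemma lebesgue_measurable_cutoff [measurable]: "cutoff r \<in> borel_measurable lebesgue"
proof -
  have "cutoff r \<in> borel_measurable borel" unfolding cutoff_def by measurable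
  then show ?thesis by (auto intro: measurable_completion)
qed

lemma lebesgue_measurable_far_kernel_diff:
  "(\<lambda>p. far_kernel s r (p - a)) \<in> borel_measurable lebesgue"
proof -
  have "far_kernel s r \<in> borel_measurable lebesgue" unfolding far_kernel_def by measurable
  from measurable_lebesgue_shift[OF this, of "- a"] show ?thesis by simp
qed

lemma far_kernel_le_decay:
  assumes "0 < r" "0 < s"
  shows "\<exists>D\<ge>0. \<forall>z::'a::euclidean_space. far_kernel s r z \<le> D * decay s z"
proof (intro exI conjI allI)
  let ?D = "1 + 1 / (r / 2) powr (real DIM('a) + 2 * s)"
  show D: "0 \<le> ?D" by simp
  fix z :: 'a
  show "far_kernel s r z \<le> ?D * decay s z"
  proof (cases "norm z \<le> r / 2")
    case True
    then show ?thesis using cutoff_eq_1[OF assms(1) True] D decay_pos[of s z]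
      unfolding far_kernel_def by (simp add: less_imp_le)
  next
    case False
    have "far_kernel s r z \<le> 1 * frac_kernel s z" unfolding far_kernel_def by (intro mult_right_mono) auto
    also have "\<dots> \<le> ?D * decay s z" using kernel_le_decay[of "r / 2" z s] assms False by simp
    finally show ?thesis .
  qed
qed

text \<open>At \<open>p = ah\<close> the kernel itself is singular, but the factor
  \<open>1 - cutoff\<close> vanishes within distance \<open>r / 2\<close>, so the sequence is
  eventually 0. At other points both factors are continuous.\<close>

lemma far_kernel_diff_tendsto:
  fixes a :: "nat \<Rightarrow> 'a::euclidean_space"
  assumes r: "0 < r" and a: "a \<longlonglongrightarrow> ah"
  shows "(\<lambda>n. far_kernel s r (p - a n)) \<longlonglongrightarrow> far_kernel s r (p - ah)"
proof (cases "p = ah")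
  case True
  have "\<forall>\<^sub>F n in sequentially. dist (a n) ah < r / 2" using tendstoD[OF a half_gt_zero[OF r]] .
  then have "\<forall>\<^sub>F n in sequentially. far_kernel s r (p - a n) = 0"
  proof eventually_elim
    case (elim n)
    then have "cutoff r (p - a n) = 1" using True
      by (intro cutoff_eq_1[OF r]) (simp add: dist_norm norm_minus_commute)
    then show ?case by (simp add: far_kernel_def)
  qed
  then show ?thesis using True by (simp add: far_kernel_def tendsto_eventually)
next
  case False
  have "isCont (cutoff r) (p - ah)"
    using continuous_on_cutoff[OF continuous_on_id, of "UNIV :: 'a set" r] by (simp add: continuous_on_eq_continuous_at)
  then have "(\<lambda>n. cutoff r (p - a n)) \<longlonglongrightarrow> cutoff r (p - ah)"
    by (rule isCont_tendsto_compose) (intro tendsto_intros a)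
  moreover have "(\<lambda>n. frac_kernel s (p - a n)) \<longlonglongrightarrow> frac_kernel s (p - ah)"
    unfolding frac_kernel_def using False by (intro tendsto_intros a) auto
  ultimately show ?thesis unfolding far_kernel_def by (intro tendsto_intros)
qed

lemma far_kernel_diff_dominated:
  assumes "0 < r" "0 < s"
  obtains M where "\<And>a p :: 'a::euclidean_space. norm a \<le> R \<Longrightarrow> far_kernel s r (p - a) \<le> M * decay s p"
proof -
  obtain D where D: "0 \<le> D" "\<And>z::'a. far_kernel s r z \<le> D * decay s z"
    using far_kernel_le_decay[OF assms] by blast
  define E where "E = 1 + 2 powr (real DIM('a) + 2 * s) * (1 + R powr (real DIM('a) + 2 * s))"
  have "far_kernel s r (p - a) \<le> D * E * decay s p" if "norm a \<le> R" for a p :: 'a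
  proof -
    have "far_kernel s r (p - a) \<le> D * decay s (p - a)" by (rule D)
    also have "\<dots> \<le> D * (E * decay s p)"
      using decay_shift_le[OF that assms(2), of "p - a"] D(1) unfolding E_def by (intro mult_left_mono) simp_all
    finally show ?thesis by (simp add: mult.assoc)
  qed
  then show ?thesis using that by blast
qed

text \<open>A convergent sequence of centres is bounded, so one multiple of \<open>decay\<close>
  dominates all the kernels. The integrand may vary with \<open>n\<close> as well, which is needed
  for reference values taken at moving points.\<close>

lemma
  fixes a :: "nat \<Rightarrow> 'a::euclidean_space"
  assumes s: "0 < s" and r: "0 < r" and a: "a \<longlonglongrightarrow> ah"
    and q: "\<And>n. q n \<in> borel_measurable lebesgue" "\<And>p. (\<lambda>n. q n p) \<longlonglongrightarrow> qh p"
    and Q: "\<And>n p. \<bar>q n p\<bar> \<le> Q p" "integrable lebesgue (\<lambda>p. Q p * decay s p)"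
  shows integrable_far_kernel: "integrable lebesgue (\<lambda>p. far_kernel s r (p - a n) * q n p)"
    and integral_far_kernel_tendsto:
      "(\<lambda>n. LINT p|lebesgue. far_kernel s r (p - a n) * q n p) \<longlonglongrightarrow> (LINT p|lebesgue. far_kernel s r (p - ah) * qh p)"
proof -
  obtain R where R: "\<And>n. norm (a n) \<le> R"
    using convergent_imp_Bseq[of a] a unfolding convergent_def Bseq_def by blast
  obtain M where M: "\<And>a p :: 'a. norm a \<le> R \<Longrightarrow> far_kernel s r (p - a) \<le> M * decay s p"
    using far_kernel_diff_dominated[OF r s] by blast
  have qh: "qh \<in> borel_measurable lebesgue" by (rule borel_measurable_LIMSEQ_real[OF q(2) q(1)])
  have m: "(\<lambda>p. far_kernel s r (p - ah) * qh p) \<in> borel_measurable lebesgue"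
    using lebesgue_measurable_far_kernel_diff qh by (intro borel_measurable_times)
  have mn: "(\<lambda>p. far_kernel s r (p - a n) * q n p) \<in> borel_measurable lebesgue" for n
    using lebesgue_measurable_far_kernel_diff q(1) by (intro borel_measurable_times)
  have w: "integrable lebesgue (\<lambda>p. M * (Q p * decay s p))" using Q(2) by (rule integrable_mult_right)
  have lim: "AE p in lebesgue. (\<lambda>n. far_kernel s r (p - a n) * q n p) \<longlonglongrightarrow> far_kernel s r (p - ah) * qh p"
    by (intro AE_I2 tendsto_mult far_kernel_diff_tendsto[OF r a] q(2))
  have bd: "AE p in lebesgue. norm (far_kernel s r (p - a n) * q n p) \<le> M * (Q p * decay s p)" for n
  proof (rule AE_I2)
    fix p :: 'a
    have "far_kernel s r (p - a n) * \<bar>q n p\<bar> \<le> M * decay s p * Q p"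
      using M[OF R[of n], of p] Q(1)[of n p]
      by (intro mult_mono) (auto intro: order_trans[OF far_kernel_nonneg[of s r "p - a n"]])
    then show "norm (far_kernel s r (p - a n) * q n p) \<le> M * (Q p * decay s p)"
      by (simp add: abs_mult mult_ac)
  qed
  show "integrable lebesgue (\<lambda>p. far_kernel s r (p - a n) * q n p)"
    by (rule integrable_dominated_convergence2[OF m mn w lim bd])
  show "(\<lambda>n. LINT p|lebesgue. far_kernel s r (p - a n) * q n p) \<longlonglongrightarrow> (LINT p|lebesgue. far_kernel s r (p - ah) * qh p)"
    by (rule integral_dominated_convergence[OF m mn w lim bd])
qed

text \<open>With equal slope, equal \<open>g\<close> and equal reference value, subtracting the
  compensated integrands cancels everything except
  \<open>far_kernel s r z * (u (x + z) - u (y + z))\<close>. Each term is then recentred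
  separately.\<close>

lemma frac_lap_glue_diff:
  fixes x y :: "'a::euclidean_space"
  assumes s: "0 < s" "s < 1"
    and f1: "quad_at x l C1 f1" "\<And>z. f1 (x + z) - f1 x = glue r g u b x (x + z)"
    and f2: "quad_at y l C2 f2" "\<And>z. f2 (y + z) - f2 y = glue r g u b y (y + z)"
    and i: "integrable lebesgue (\<lambda>p. far_kernel s r (p - x) * u p)" "integrable lebesgue (\<lambda>p. far_kernel s r (p - y) * u p)"
  shows "frac_lap s f1 x - frac_lap s f2 y = - frac_const DIM('a) s *
    ((LINT p|lebesgue. far_kernel s r (p - x) * u p) - (LINT p|lebesgue. far_kernel s r (p - y) * u p))"
proof -
  let ?R = "\<lambda>f x z. quad_rem x l f z * frac_kernel s z"
  have sx: "(LINT p|lebesgue. far_kernel s r (p - x) * u p) = (LINT z|lebesgue. far_kernel s r z * u (x + z))"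
    "integrable lebesgue (\<lambda>z. far_kernel s r z * u (x + z))"
    using integral_lebesgue_shift[of "\<lambda>p. far_kernel s r (p - x) * u p" x]
      integrable_lebesgue_shift[of "\<lambda>p. far_kernel s r (p - x) * u p" x] i by simp_all
  have sy: "(LINT p|lebesgue. far_kernel s r (p - y) * u p) = (LINT z|lebesgue. far_kernel s r z * u (y + z))"
    "integrable lebesgue (\<lambda>z. far_kernel s r z * u (y + z))"
    using integral_lebesgue_shift[of "\<lambda>p. far_kernel s r (p - y) * u p" y]
      integrable_lebesgue_shift[of "\<lambda>p. far_kernel s r (p - y) * u p" y] i by simp_all
  have "(LINT z|lebesgue. ?R f1 x z) - (LINT z|lebesgue. ?R f2 y z) = (LINT z|lebesgue. ?R f1 x z - ?R f2 y z)"
    by (rule Bochner_Integration.integral_diff[symmetric, OF integrable_quad_remainder[OF s f1(1)] integrable_quad_remainder[OF s f2(1)]])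
  also have "(\<lambda>z. ?R f1 x z - ?R f2 y z) = (\<lambda>z. far_kernel s r z * u (x + z) - far_kernel s r z * u (y + z))"
    unfolding f1(2) f2(2) glue_def far_kernel_def by (simp add: fun_eq_iff algebra_simps split del: if_split)
  also have "(LINT z|lebesgue. far_kernel s r z * u (x + z) - far_kernel s r z * u (y + z))
      = (LINT p|lebesgue. far_kernel s r (p - x) * u p) - (LINT p|lebesgue. far_kernel s r (p - y) * u p)"
    unfolding sx sy by (rule Bochner_Integration.integral_diff[OF sx(2) sy(2)])
  finally show ?thesis
    unfolding frac_lap_quad[OF s f1(1)] frac_lap_quad[OF s f2(1)] by (simp only: right_diff_distrib[symmetric])
qed

text \<open>The product of increments splits along \<open>glue\<close>: the cutoff part stays in the
  increment variable, the rest is recentred to absolute points. The near part is integrable as the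
  difference of the whole and the far part.\<close>

lemma
  fixes x :: "'a::euclidean_space"
  assumes f: "quad_at x l C f" "\<And>z. f (x + z) - f x = glue r g u b x (x + z)"
    and h: "form_admissible s x h"
    and i: "integrable lebesgue (\<lambda>p. far_kernel s r (p - x) * ((u p - b) * (h p - h x)))"
  shows integrable_near_part: "integrable lebesgue (\<lambda>z. cutoff r z * g z * (h (x + z) - h x) * frac_kernel s z)"
    and Bform_glue: "Bform s f h x = frac_const DIM('a) s / 2 *
      ((LINT z|lebesgue. cutoff r z * g z * (h (x + z) - h x) * frac_kernel s z) +
       (LINT p|lebesgue. far_kernel s r (p - x) * ((u p - b) * (h p - h x))))"
proof -
  let ?T = "\<lambda>z. (f (x + z) - f x) * (h (x + z) - h x) * frac_kernel s z"
  let ?F = "\<lambda>z. far_kernel s r z * ((u (x + z) - b) * (h (x + z) - h x))"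
  have T: "integrable lebesgue ?T" using Bform_finite_quad[OF f(1) h] unfolding Bform_finite_eq .
  have F: "(LINT p|lebesgue. far_kernel s r (p - x) * ((u p - b) * (h p - h x))) = (LINT z|lebesgue. ?F z)"
    "integrable lebesgue ?F"
    using integral_lebesgue_shift[of "\<lambda>p. far_kernel s r (p - x) * ((u p - b) * (h p - h x))" x]
      integrable_lebesgue_shift[of "\<lambda>p. far_kernel s r (p - x) * ((u p - b) * (h p - h x))" x] i by simp_all
  have eq: "(\<lambda>z. cutoff r z * g z * (h (x + z) - h x) * frac_kernel s z) = (\<lambda>z. ?T z - ?F z)"
    unfolding f(2) glue_def far_kernel_def by (simp add: fun_eq_iff algebra_simps)
  show "integrable lebesgue (\<lambda>z. cutoff r z * g z * (h (x + z) - h x) * frac_kernel s z)"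
    unfolding eq by (rule Bochner_Integration.integrable_diff[OF T F(2)])
  have "(LINT z|lebesgue. cutoff r z * g z * (h (x + z) - h x) * frac_kernel s z) = (LINT z|lebesgue. ?T z) - (LINT z|lebesgue. ?F z)"
    unfolding eq by (rule Bochner_Integration.integral_diff[OF T F(2)])
  then show "Bform s f h x = frac_const DIM('a) s / 2 *
      ((LINT z|lebesgue. cutoff r z * g z * (h (x + z) - h x) * frac_kernel s z) +
       (LINT p|lebesgue. far_kernel s r (p - x) * ((u p - b) * (h p - h x))))"
    unfolding F Bform_eq by simp
qed

text \<open>Increments of length at most 1 are handled by the local Lipschitz bound of
  \<open>h\<close>, giving \<open>msq\<close> times the kernel. For longer ones the kernel is at
  most a multiple of \<open>decay\<close>, and \<open>decay_shift_le\<close> moves the weight from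
  \<open>z\<close> to \<open>x + z\<close>, where membership in \<open>L1w\<close> applies.\<close>

lemma form_admissible_C2:
  fixes x :: "'a::euclidean_space"
  assumes s: "0 < s" "s < 1" and h: "Ck_on 2 h UNIV" "h \<in> L1w s"
  shows "form_admissible s x h"
proof -
  obtain D0 p0 where "0 \<le> D0" "\<forall>y\<in>cball x 1. (h has_derivative (\<lambda>z. p0 y \<bullet> z)) (at y)"
    "\<forall>y\<in>cball x 1. \<forall>z\<in>cball x 1. norm (p0 y - p0 z) \<le> D0 * norm (y - z)"
    using C2_gradient_lipschitz[OF h(1) open_UNIV subset_UNIV, of x 1] by blast
  from lipschitz_increment_le[OF this]
  obtain L where L: "\<And>z. norm z \<le> 1 \<Longrightarrow> \<bar>h (x + z) - h x\<bar> \<le> L * norm z"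
    by (metis mem_cball dist_norm diff_add_cancel norm_minus_commute add_diff_cancel_left' centre_in_cball zero_le_one)
  have "continuous_on UNIV h"
    using h(1) by (simp add: numeral_2_eq_2 differentiable_imp_continuous_on)
  then have "h \<in> borel_measurable borel" by (rule borel_measurable_continuous_onI)
  then have hm: "h \<in> borel_measurable lebesgue" by (auto intro: measurable_completion)
  define D where "D = 1 + 1 / 1 powr (real DIM('a) + 2 * s)"
  define E where "E = 1 + 2 powr (real DIM('a) + 2 * s) * (1 + norm x powr (real DIM('a) + 2 * s))"
  have D: "0 \<le> D" by (simp add: D_def)
  have hL: "integrable lebesgue (\<lambda>z. \<bar>h (x + z)\<bar> * decay s (x + z))"
  proof -
    have "integrable lebesgue (\<lambda>z. \<bar>h z * decay s z\<bar>)"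
      using h(2) unfolding L1w_iff by (rule integrable_abs)
    then show ?thesis
      using integrable_lebesgue_shift[of "\<lambda>z. \<bar>h z\<bar> * decay s z" x] by (simp add: abs_mult abs_of_pos)
  qed
  show ?thesis
    unfolding form_admissible_def
  proof (rule conjI[OF hm], rule Bochner_Integration.integrable_bound)
    let ?W = "\<lambda>z. \<bar>L\<bar> * (msq z * frac_kernel s z) +
        (D * E * (\<bar>h (x + z)\<bar> * decay s (x + z)) + D * \<bar>h x\<bar> * decay s z)"
    show "integrable lebesgue ?W"
      by (intro Bochner_Integration.integrable_add integrable_mult_right integrable_kernel[OF s] hL integrable_decay[OF s])
    show "(\<lambda>z. min 1 (norm z) * \<bar>h (x + z) - h x\<bar> * frac_kernel s z) \<in> borel_measurable lebesgue"
      using measurable_lebesgue_shift[OF hm, of x] lebesgue_measurable_norm_fun[of "\<lambda>t. min 1 t"] by measurable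
    show "AE z in lebesgue. norm (min 1 (norm z) * \<bar>h (x + z) - h x\<bar> * frac_kernel s z) \<le> norm (?W z)"
    proof (rule AE_I2)
      fix z :: 'a
      have E: "0 \<le> E" by (simp add: E_def)
      have n2: "0 \<le> D * E * (\<bar>h (x + z)\<bar> * decay s (x + z)) + D * \<bar>h x\<bar> * decay s z"
        using D E by (intro add_nonneg_nonneg mult_nonneg_nonneg less_imp_le[OF decay_pos]) auto
      have n1: "0 \<le> \<bar>L\<bar> * (msq z * frac_kernel s z)" by simp
      have "min 1 (norm z) * \<bar>h (x + z) - h x\<bar> * frac_kernel s z \<le> ?W z"
      proof (cases "norm z \<le> 1")
        case True
        have "\<bar>h (x + z) - h x\<bar> \<le> \<bar>L\<bar> * norm z"
          using L[OF True] mult_right_mono[OF abs_ge_self[of L] norm_ge_zero[of z]] by linarith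
        then have "min 1 (norm z) * \<bar>h (x + z) - h x\<bar> * frac_kernel s z \<le> norm z * (\<bar>L\<bar> * norm z) * frac_kernel s z"
          using True by (intro mult_right_mono mult_mono) auto
        moreover have "msq z = norm z * norm z"
          using True power_le_one[of "norm z" 2] by (simp add: power2_eq_square)
        ultimately show ?thesis using n2 by (simp add: mult_ac)
      next
        case False
        have "frac_kernel s z \<le> D * decay s z"
          unfolding D_def using kernel_le_decay[of 1 z s] False s by simp
        then have "\<bar>h (x + z) - h x\<bar> * frac_kernel s z \<le> (\<bar>h (x + z)\<bar> + \<bar>h x\<bar>) * (D * decay s z)"
          by (intro mult_mono) auto
        also have "\<dots> = D * \<bar>h (x + z)\<bar> * decay s z + D * \<bar>h x\<bar> * decay s z" by (simp add: algebra_simps)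
        also have "D * \<bar>h (x + z)\<bar> * decay s z \<le> D * \<bar>h (x + z)\<bar> * (E * decay s (x + z))"
          using decay_shift_le[of x "norm x" s z] D s unfolding E_def by (intro mult_left_mono) auto
        finally have "\<bar>h (x + z) - h x\<bar> * frac_kernel s z
            \<le> D * E * (\<bar>h (x + z)\<bar> * decay s (x + z)) + D * \<bar>h x\<bar> * decay s z"
          by (simp add: mult_ac)
        moreover have m: "min 1 (norm z) = 1" using False by simp
        ultimately show ?thesis using n1 unfolding m mult_1 by linarith
      qed
      moreover have "0 \<le> min 1 (norm z) * \<bar>h (x + z) - h x\<bar> * frac_kernel s z" by simp
      ultimately show "norm (min 1 (norm z) * \<bar>h (x + z) - h x\<bar> * frac_kernel s z) \<le> norm (?W z)"
        unfolding real_norm_def by linarith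
    qed
  qed
qed

text \<open>The factor \<open>g\<close> contributes \<open>A * norm z\<close> and the second
  difference of \<open>h\<close> contributes \<open>D * norm z\<close>, which together compensate
  the singularity. In the application \<open>A\<close> grows like \<open>sqrt k\<close> while
  \<open>D\<close> is proportional to the distance of the doubling points.\<close>

lemma near_part_diff_le:
  fixes x y :: "'a::euclidean_space"
  assumes s: "0 < s" "s < 1" and r: "0 < r" "r \<le> 1"
    and i: "integrable lebesgue (\<lambda>z. cutoff r z * g z * (h (x + z) - h x) * frac_kernel s z)"
      "integrable lebesgue (\<lambda>z. cutoff r z * g z * (h (y + z) - h y) * frac_kernel s z)"
    and g: "\<And>z. norm z \<le> r \<Longrightarrow> \<bar>g z\<bar> \<le> A * norm z" "0 \<le> A"
    and h: "\<And>z. norm z \<le> r \<Longrightarrow> \<bar>(h (x + z) - h x) - (h (y + z) - h y)\<bar> \<le> D * norm z" "0 \<le> D"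
  shows "\<bar>(LINT z|lebesgue. cutoff r z * g z * (h (x + z) - h x) * frac_kernel s z) -
      (LINT z|lebesgue. cutoff r z * g z * (h (y + z) - h y) * frac_kernel s z)\<bar> \<le> A * D * kernel_mass TYPE('a) s"
proof -
  let ?N = "\<lambda>x z. cutoff r z * g z * (h (x + z) - h x) * frac_kernel s z"
  have "norm (LINT z|lebesgue. ?N x z - ?N y z) \<le> (LINT z|lebesgue. norm (?N x z - ?N y z))"
    by (rule integral_norm_bound)
  also have "\<dots> \<le> (LINT z::'a|lebesgue. A * D * (msq z * frac_kernel s z))"
  proof (rule Bochner_Integration.integral_mono)
    show "integrable lebesgue (\<lambda>z. norm (?N x z - ?N y z))"
      using i by (intro integrable_norm Bochner_Integration.integrable_diff)
    show "integrable lebesgue (\<lambda>z::'a. A * D * (msq z * frac_kernel s z))"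
      using integrable_kernel[OF s] by (intro integrable_mult_right)
    fix z :: 'a
    show "norm (?N x z - ?N y z) \<le> A * D * (msq z * frac_kernel s z)"
    proof (cases "norm z \<le> r")
      case True
      have eq: "?N x z - ?N y z = cutoff r z * (g z * ((h (x + z) - h x) - (h (y + z) - h y))) * frac_kernel s z"
        by (simp add: algebra_simps)
      have "\<bar>g z\<bar> * \<bar>(h (x + z) - h x) - (h (y + z) - h y)\<bar> \<le> (A * norm z) * (D * norm z)"
        using g(1)[OF True] h(1)[OF True] g(2) h(2) by (intro mult_mono) auto
      moreover have "msq z = (norm z)\<^sup>2"
        using True r by (intro min_absorb2 power_le_one) auto
      ultimately have "\<bar>g z * ((h (x + z) - h x) - (h (y + z) - h y))\<bar> \<le> A * D * msq z"
        by (simp add: abs_mult power2_eq_square mult_ac)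
      then have "cutoff r z * \<bar>g z * ((h (x + z) - h x) - (h (y + z) - h y))\<bar> \<le> 1 * (A * D * msq z)"
        by (intro mult_mono) auto
      then have "cutoff r z * \<bar>g z * ((h (x + z) - h x) - (h (y + z) - h y))\<bar> * frac_kernel s z
          \<le> 1 * (A * D * msq z) * frac_kernel s z"
        by (rule mult_right_mono) simp
      then show ?thesis unfolding eq real_norm_def abs_mult[of _ "frac_kernel s z"] abs_mult[of "cutoff r z"]
        by (simp add: mult.assoc)
    next
      case False
      then show ?thesis using cutoff_eq_0[of r z] r g(2) h(2) by simp
    qed
  qed
  also have "\<dots> = A * D * kernel_mass TYPE('a) s" by (simp add: kernel_mass_def)
  finally show ?thesis
    using Bochner_Integration.integral_diff[OF i] by simp
qed

text \<open>Near the doubling points both test functions have the same increments \<open>g\<close>, squeezed between those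
  of \<open>w\<close> and \<open>v\<close>. Away from them both equal \<open>v\<close> up to a constant at the same point of the space, not at
  the same increment: this avoids comparing \<open>v\<close> with its translates, which need not be continuous.\<close>

lemma coupled_test_functions:
  fixes w v :: "'a::euclidean_space \<Rightarrow> real"
  assumes s: "0 < s" "s < 1" and \<Omega>: "open \<Omega>" "bounded \<Omega>"
    and meas: "v \<in> borel_measurable lebesgue"
    and bd: "\<And>p. \<bar>w p\<bar> \<le> B" "\<And>p. \<bar>v p\<bar> \<le> B"
    and cont: "continuous_on (closure \<Omega>) w" "continuous_on (closure \<Omega>) v"
    and off: "\<forall>a. a \<notin> \<Omega> \<longrightarrow> w a \<le> v a" and pos: "x0 \<in> \<Omega>" "v x0 < w x0"
  obtains xh r X Y k l \<psi>1 \<psi>2 A where "xh \<in> \<Omega>" "0 < r" "cball xh (2 * r) \<subseteq> \<Omega>"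
    "X \<longlonglongrightarrow> xh" "Y \<longlonglongrightarrow> xh" "\<And>n. norm (X n - xh) \<le> r" "\<And>n. norm (Y n - xh) \<le> r"
    "\<And>n. 1 \<le> (k n :: real)" "(\<lambda>n. sqrt (k n) * norm (X n - Y n)) \<longlonglongrightarrow> 0"
    "\<And>n::nat. \<exists>C. quad_at (X n) (l n) C (\<psi>1 n)" "\<And>n. \<exists>C. quad_at (Y n) (l n) C (\<psi>2 n)"
    "\<And>n. continuous_on (closure \<Omega>) (\<psi>1 n)" "\<And>n. continuous_on (closure \<Omega>) (\<psi>2 n)"
    "\<And>n p. w p \<le> \<psi>1 n p" "\<And>n p. \<psi>2 n p \<le> v p" "\<And>n. \<psi>1 n (X n) = w (X n)" "\<And>n. \<psi>2 n (Y n) = v (Y n)"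
    "(\<lambda>n. frac_lap s (\<psi>1 n) (X n) - frac_lap s (\<psi>2 n) (Y n)) \<longlonglongrightarrow> 0"
    "\<And>n. Bform s (\<psi>1 n) (\<psi>1 n) (X n) \<le> A * k n" "\<And>n. Bform s (\<psi>2 n) (\<psi>2 n) (Y n) \<le> A * k n" "0 \<le> A"
    "\<And>h. Ck_on 2 h UNIV \<Longrightarrow> h \<in> L1w s \<Longrightarrow> (\<lambda>n. Bform s (\<psi>1 n) h (X n) - Bform s (\<psi>2 n) h (Y n)) \<longlonglongrightarrow> 0"
proof (cases rule: doubling_of_variables[OF \<Omega> cont off pos, case_names doubled])
  case (doubled xh r X Y k)
  note xh = doubled(1) and r = doubled(2-4) and XY = doubled(5-8) and k = doubled(9-11) and mx = doubled(12)
    and dg = doubled(13)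
  define c where "c = frac_const DIM('a) s"
  have c: "0 < c" unfolding c_def by (rule frac_const_pos[OF s])
  have cb: "X n + z \<in> cball xh (2 * r)" "Y n + z \<in> cball xh (2 * r)" if "norm z \<le> r" for n z
    using norm_triangle_ineq[of "X n - xh" z] norm_triangle_ineq[of "Y n - xh" z] XY(3,4)[of n] that
    by (auto simp: dist_norm norm_minus_commute algebra_simps)
  have cl: "X n + z \<in> closure \<Omega>" "Y n + z \<in> closure \<Omega>" if "norm z \<le> r" for n z
    using cb[OF that, of n] r(3) closure_subset by blast+
  have clX: "X n \<in> closure \<Omega>" "Y n \<in> closure \<Omega>" for n using cl[of 0 n] r by auto
  \<comment> \<open>The gradient of the penalty in its first variable, equivalently minus the
    gradient in the second; hence a common slope for both test functions.\<close>
  define l where "l n = (2 * k n) *\<^sub>R (X n - Y n)" for n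
  \<comment> \<open>The linear function clipped into the band between the two increments. Clipping
    keeps the correct order on both sides and changes the linear function by at most
    \<open>k n * (norm z)\<^sup>2\<close>.\<close>
  define g where "g n z = max (w (X n + z) - w (X n)) (min (v (Y n + z) - v (Y n)) (l n \<bullet> z))" for n z
  define \<psi>1 where "\<psi>1 n p = w (X n) + glue r (g n) v (v (Y n)) (X n) p" for n p
  define \<psi>2 where "\<psi>2 n p = v (Y n) + glue r (g n) v (v (Y n)) (Y n) p" for n p
  \<comment> \<open>Moving both points by \<open>z\<close> leaves the penalty unchanged, so the band
    is nonempty.\<close>
  have ab: "w (X n + z) - w (X n) \<le> v (Y n + z) - v (Y n)" if "norm z \<le> r" for n z
    using mx[OF cl(1)[OF that] cl(2)[OF that], of n n n] by simp
  \<comment> \<open>Only \<open>X n\<close> is moved here, only \<open>Y n\<close> for the lower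
    bound on \<open>v\<close>; each time the penalty changes by its linear part with slope
    \<open>l n\<close> and by \<open>k n * (norm z)\<^sup>2\<close>.\<close>
  have up: "w (X n + z) - w (X n) \<le> l n \<bullet> z + k n * (norm z)\<^sup>2" if "norm z \<le> r" for n z
  proof -
    have e: "(norm (X n + z - Y n))\<^sup>2 = (norm (X n - Y n))\<^sup>2 + 2 * ((X n - Y n) \<bullet> z) + (norm z)\<^sup>2"
      unfolding power2_norm_eq_inner by (simp add: inner_diff_left inner_diff_right inner_add_left inner_add_right inner_commute)
    then show ?thesis using mx[OF cl(1)[OF that] clX(2), of n n n] unfolding e l_def by (simp add: algebra_simps)
  qed
  have lo: "l n \<bullet> z - k n * (norm z)\<^sup>2 \<le> v (Y n + z) - v (Y n)" if "norm z \<le> r" for n z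
  proof -
    have e: "(norm (X n - (Y n + z)))\<^sup>2 = (norm (X n - Y n))\<^sup>2 - 2 * ((X n - Y n) \<bullet> z) + (norm z)\<^sup>2"
      unfolding power2_norm_eq_inner by (simp add: inner_diff_left inner_diff_right inner_add_left inner_add_right inner_commute)
    then show ?thesis using mx[OF clX(1) cl(2)[OF that], of n n n] unfolding e l_def by (simp add: algebra_simps)
  qed
  have gq: "\<bar>g n z - l n \<bullet> z\<bar> \<le> k n * (norm z)\<^sup>2" if "norm z \<le> r" for n z
  proof -
    have "0 \<le> k n * (norm z)\<^sup>2" using k(1)[of n] by simp
    then show ?thesis using ab[OF that, of n] up[OF that, of n] lo[OF that, of n] unfolding g_def by linarith
  qed
  have gw: "w (X n + z) - w (X n) \<le> g n z" for n z by (simp add: g_def)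
  have gv: "g n z \<le> v (Y n + z) - v (Y n)" if "norm z \<le> r" for n z
    using ab[OF that, of n] by (simp add: g_def)
  have gB: "\<bar>g n z\<bar> \<le> 2 * B" if "norm z \<le> r" for n z
    using gw[of n z] gv[OF that, of n] bd(1)[of "X n + z"] bd(1)[of "X n"] bd(2)[of "Y n + z"] bd(2)[of "Y n"]
    by linarith
  have vB: "\<bar>v p - v (Y n)\<bar> \<le> 2 * B" for n p using bd(2)[of p] bd(2)[of "Y n"] by linarith
  have B0: "0 \<le> B" using bd(1)[of 0] by linarith
  \<comment> \<open>If \<open>sqrt k * norm z \<le> 1\<close>, the slope gives 2, because
    \<open>norm l = 2 * k * norm (X - Y) \<le> 2 * sqrt k\<close>, and the quadratic term gives 1.
    Otherwise the sup bound \<open>2 * B\<close> is at most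
    \<open>2 * B * sqrt k * norm z\<close>.\<close>
  define A where "A = 3 + 2 * B"
  have A0: "0 \<le> A" using B0 by (simp add: A_def)
  have gA: "\<bar>g n z\<bar> \<le> A * sqrt (k n) * norm z" if "norm z \<le> r" for n z
  proof (cases "sqrt (k n) * norm z \<le> 1")
    case True
    have kk: "sqrt (k n) * sqrt (k n) = k n" and k0: "0 \<le> sqrt (k n)" using k(1)[of n] by auto
    have "norm (l n) = 2 * sqrt (k n) * (sqrt (k n) * norm (X n - Y n))"
      using k(1)[of n] kk by (simp add: l_def mult.assoc[symmetric])
    also have "\<dots> \<le> 2 * sqrt (k n) * 1" using k(3)[of n] k0 by (intro mult_left_mono) auto
    finally have "norm (l n) * norm z \<le> 2 * sqrt (k n) * norm z" by (intro mult_right_mono) auto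
    then have "\<bar>l n \<bullet> z\<bar> \<le> 2 * sqrt (k n) * norm z" using Cauchy_Schwarz_ineq2[of "l n" z] by linarith
    moreover have "k n * (norm z)\<^sup>2 = sqrt (k n) * norm z * (sqrt (k n) * norm z)"
      using kk by (simp add: power2_eq_square mult_ac)
    moreover have "sqrt (k n) * norm z * (sqrt (k n) * norm z) \<le> sqrt (k n) * norm z * 1"
      using True k0 by (intro mult_left_mono) auto
    moreover have "0 \<le> 2 * B * (sqrt (k n) * norm z)" using B0 k0 by simp
    ultimately have "\<bar>g n z\<bar> \<le> 3 * (sqrt (k n) * norm z) + 2 * B * (sqrt (k n) * norm z)"
      using gq[OF that, of n] by linarith
    then show ?thesis by (simp add: A_def distrib_right mult.assoc)
  next
    case False
    then have "2 * B * 1 \<le> 2 * B * (sqrt (k n) * norm z)"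
      using B0 by (intro mult_left_mono) linarith+
    then have "\<bar>g n z\<bar> \<le> 3 * (sqrt (k n) * norm z) + 2 * B * (sqrt (k n) * norm z)"
      using gB[OF that, of n] False by linarith
    then show ?thesis by (simp add: A_def distrib_right mult.assoc)
  qed
  have g0: "g n 0 = 0" for n by (simp add: g_def)
  have gc: "continuous_on (cball 0 r) (g n)" for n
  proof -
    have "continuous_on (cball 0 r) (\<lambda>z. w (X n + z))"
      by (rule continuous_on_compose2[OF cont(1)]; (intro continuous_intros | rule image_subsetI, rule cl(1), simp))
    moreover have "continuous_on (cball 0 r) (\<lambda>z. v (Y n + z))"
      by (rule continuous_on_compose2[OF cont(2)]; (intro continuous_intros | rule image_subsetI, rule cl(2), simp))
    ultimately show ?thesis unfolding g_def by (intro continuous_intros)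
  qed
  note gl1 = r(1,2) cl(1) gc gB cont(2) meas vB g0
  note gl2 = r(1,2) cl(2) gc gB cont(2) meas vB g0
  have q1: "\<exists>C. quad_at (X n) (l n) C (\<psi>1 n)" for n
    unfolding \<psi>1_def by (rule quad_at_glue[OF gl1 gq])
  have q2: "\<exists>C. quad_at (Y n) (l n) C (\<psi>2 n)" for n
    unfolding \<psi>2_def by (rule quad_at_glue[OF gl2 gq])
  have i1: "\<psi>1 n (X n + z) - \<psi>1 n (X n) = glue r (g n) v (v (Y n)) (X n) (X n + z)" for n z
    using g0[of n] by (simp add: \<psi>1_def glue_def)
  have i2: "\<psi>2 n (Y n + z) - \<psi>2 n (Y n) = glue r (g n) v (v (Y n)) (Y n) (Y n + z)" for n z
    using g0[of n] by (simp add: \<psi>2_def glue_def)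
  have far: "(\<lambda>n. LINT p|lebesgue. far_kernel s r (p - a n) * v p) \<longlonglongrightarrow> (LINT p|lebesgue. far_kernel s r (p - xh) * v p)"
    and farI: "integrable lebesgue (\<lambda>p. far_kernel s r (p - a n) * v p)"
    if "a \<longlonglongrightarrow> xh" for a :: "nat \<Rightarrow> 'a" and n
    using integral_far_kernel_tendsto[OF s(1) r(1) that, of "\<lambda>_. v" v "\<lambda>_. B"] meas bd(2) integrable_decay[OF s]
      integrable_far_kernel[OF s(1) r(1) that, of "\<lambda>_. v" v "\<lambda>_. B" n] by auto
  have L: "(\<lambda>n. frac_lap s (\<psi>1 n) (X n) - frac_lap s (\<psi>2 n) (Y n)) \<longlonglongrightarrow> 0"
  proof -
    have "frac_lap s (\<psi>1 n) (X n) - frac_lap s (\<psi>2 n) (Y n) = - c *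
      ((LINT p|lebesgue. far_kernel s r (p - X n) * v p) - (LINT p|lebesgue. far_kernel s r (p - Y n) * v p))" for n
    proof -
      obtain C1 C2 where "quad_at (X n) (l n) C1 (\<psi>1 n)" "quad_at (Y n) (l n) C2 (\<psi>2 n)" using q1 q2 by blast
      then show ?thesis unfolding c_def
        by (rule frac_lap_glue_diff[OF s _ i1 _ i2 farI[OF XY(1)] farI[OF XY(2)]])
    qed
    moreover have "(\<lambda>n. - c * ((LINT p|lebesgue. far_kernel s r (p - X n) * v p) - (LINT p|lebesgue. far_kernel s r (p - Y n) * v p)))
      \<longlonglongrightarrow> - c * ((LINT p|lebesgue. far_kernel s r (p - xh) * v p) - (LINT p|lebesgue. far_kernel s r (p - xh) * v p))"
      by (intro tendsto_intros far XY)
    ultimately show ?thesis by simp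
  qed
  define A' where "A' = c / 2 * ((A\<^sup>2 + 4 * (2 * B)\<^sup>2 / r\<^sup>2) * kernel_mass TYPE('a) s)"
  have A'0: "0 \<le> A'"
    unfolding A'_def using c kernel_mass_nonneg[where 'a = 'a, of s] by (intro mult_nonneg_nonneg add_nonneg_nonneg) auto
  have B1: "Bform s (\<psi>1 n) (\<psi>1 n) (X n) \<le> A' * k n" for n
  proof -
    have "(\<psi>1 n (X n + z) - \<psi>1 n (X n))\<^sup>2 \<le> (A\<^sup>2 + 4 * (2 * B)\<^sup>2 / r\<^sup>2) * k n * msq z" for z
      unfolding i1 by (rule glue_square_le[OF gl1 gA k(1)])
    from Bform_self_le[OF s this] show ?thesis by (simp add: A'_def c_def mult_ac)
  qed
  have B2: "Bform s (\<psi>2 n) (\<psi>2 n) (Y n) \<le> A' * k n" for n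
  proof -
    have "(\<psi>2 n (Y n + z) - \<psi>2 n (Y n))\<^sup>2 \<le> (A\<^sup>2 + 4 * (2 * B)\<^sup>2 / r\<^sup>2) * k n * msq z" for z
      unfolding i2 by (rule glue_square_le[OF gl2 gA k(1)])
    from Bform_self_le[OF s this] show ?thesis by (simp add: A'_def c_def mult_ac)
  qed
  have w1: "w p \<le> \<psi>1 n p" for n p
  proof -
    \<comment> \<open>The global inequality \<open>w p - v p \<le> w (X n) - v (Y n)\<close> places
      the far piece \<open>v p - v (Y n)\<close> above the increment of \<open>w\<close> at the same
      absolute point.\<close>
    have "w p - w (X n) \<le> glue r (g n) v (v (Y n)) (X n) p"
      by (rule glue_ge[OF r(1)]) (use gw[of n "p - X n"] dg[of p n] in auto)
    then show ?thesis by (simp add: \<psi>1_def)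
  qed
  have w2: "\<psi>2 n p \<le> v p" for n p
  proof -
    have "glue r (g n) v (v (Y n)) (Y n) p \<le> v p - v (Y n)"
      by (rule glue_le[OF r(1)]) (use gv[of "p - Y n" n] in auto)
    then show ?thesis by (simp add: \<psi>2_def)
  qed
  have Bh: "(\<lambda>n. Bform s (\<psi>1 n) h (X n) - Bform s (\<psi>2 n) h (Y n)) \<longlonglongrightarrow> 0"
    if h: "Ck_on 2 h UNIV" "h \<in> L1w s" for h
  proof -
    obtain D p where "0 \<le> D" "\<forall>x\<in>cball xh (2 * r). (h has_derivative (\<lambda>z. p x \<bullet> z)) (at x)"
      "\<forall>x\<in>cball xh (2 * r). \<forall>y\<in>cball xh (2 * r). norm (p x - p y) \<le> D * norm (x - y)"
      using C2_gradient_lipschitz[OF h(1) open_UNIV subset_UNIV, of xh "2 * r"] by blast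
    note D = this
    have h2: "\<bar>(h (X n + z) - h (X n)) - (h (Y n + z) - h (Y n))\<bar> \<le> D * norm (X n - Y n) * norm z"
      if "norm z \<le> r" for n z
      using second_difference_le[OF D, of "X n" "Y n" z] cb[OF that, of n] cb[of 0 n] r by simp
    have hc: "continuous_on UNIV h" using h(1) by (simp add: numeral_2_eq_2 differentiable_imp_continuous_on)
    then have "h \<in> borel_measurable borel" by (rule borel_measurable_continuous_onI)
    then have hm: "h \<in> borel_measurable lebesgue" by (auto intro: measurable_completion)
    have hlim: "(\<lambda>n. h (a n)) \<longlonglongrightarrow> h xh" if "a \<longlonglongrightarrow> xh" for a :: "nat \<Rightarrow> 'a"
      by (rule continuous_on_tendsto_compose[OF hc that]) auto
    have vlim: "(\<lambda>n. v (Y n)) \<longlonglongrightarrow> v xh"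
      by (rule continuous_on_tendsto_compose[OF cont(2) XY(2)]) (use clX xh closure_subset in auto)
    \<comment> \<open>The reference value is \<open>v (Y n)\<close> for both centres, as in the two
      test functions, so the far integrals for \<open>a = X\<close> and \<open>a = Y\<close> have
      the same limit.\<close>
    let ?q = "\<lambda>a n p. (v p - v (Y n)) * (h p - h (a n))"
    have farh: "(\<lambda>n. LINT p|lebesgue. far_kernel s r (p - a n) * ?q a n p)
        \<longlonglongrightarrow> (LINT p|lebesgue. far_kernel s r (p - xh) * ((v p - v xh) * (h p - h xh)))"
      and farhI: "integrable lebesgue (\<lambda>p. far_kernel s r (p - a n) * ?q a n p)"
      if a: "a \<longlonglongrightarrow> xh" for a :: "nat \<Rightarrow> 'a" and n
    proof -
      obtain M where M: "\<And>n. \<bar>h (a n)\<bar> \<le> M"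
        using hlim[OF a] convergent_imp_Bseq[of "\<lambda>n. h (a n)"] unfolding convergent_def Bseq_def real_norm_def by blast
      have m: "?q a n \<in> borel_measurable lebesgue" for n using meas hm by measurable
      have lim: "(\<lambda>n. ?q a n p) \<longlonglongrightarrow> (v p - v xh) * (h p - h xh)" for p
        by (intro tendsto_intros vlim hlim[OF a])
      have bd': "\<bar>?q a n p\<bar> \<le> 2 * B * (\<bar>h p\<bar> + M)" for n p
        unfolding abs_mult using vB[of p n] M[of n] B0 by (intro mult_mono) auto
      have "integrable lebesgue (\<lambda>p. \<bar>h p * decay s p\<bar>)" using h(2) unfolding L1w_iff by (rule integrable_abs)
      then have "integrable lebesgue (\<lambda>p. 2 * B * \<bar>h p * decay s p\<bar> + 2 * B * M * decay s p)"
        by (intro Bochner_Integration.integrable_add integrable_mult_right integrable_decay[OF s])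
      moreover have "2 * B * \<bar>h p * decay s p\<bar> + 2 * B * M * decay s p = 2 * B * (\<bar>h p\<bar> + M) * decay s p" for p
        using decay_pos[of s p] by (simp add: abs_mult abs_of_pos algebra_simps)
      ultimately have int: "integrable lebesgue (\<lambda>p. 2 * B * (\<bar>h p\<bar> + M) * decay s p)" by simp
      show "(\<lambda>n. LINT p|lebesgue. far_kernel s r (p - a n) * ?q a n p)
        \<longlonglongrightarrow> (LINT p|lebesgue. far_kernel s r (p - xh) * ((v p - v xh) * (h p - h xh)))"
        by (rule integral_far_kernel_tendsto[OF s(1) r(1) a m lim bd' int])
      show "integrable lebesgue (\<lambda>p. far_kernel s r (p - a n) * ?q a n p)"
        by (rule integrable_far_kernel[OF s(1) r(1) a m lim bd' int])
    qed
    let ?N = "\<lambda>a n. LINT z|lebesgue. cutoff r z * g n z * (h (a n + z) - h (a n)) * frac_kernel s z"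
    let ?F = "\<lambda>a n. LINT p|lebesgue. far_kernel s r (p - a n) * ?q a n p"
    have adm: "form_admissible s x h" for x by (rule form_admissible_C2[OF s h])
    have eq1: "Bform s (\<psi>1 n) h (X n) = c / 2 * (?N X n + ?F X n)"
      and N1: "integrable lebesgue (\<lambda>z. cutoff r z * g n z * (h (X n + z) - h (X n)) * frac_kernel s z)" for n
      using q1[of n] Bform_glue[OF _ i1 adm farhI[OF XY(1)], of n] integrable_near_part[OF _ i1 adm farhI[OF XY(1)], of n]
      unfolding c_def by blast+
    have eq2: "Bform s (\<psi>2 n) h (Y n) = c / 2 * (?N Y n + ?F Y n)"
      and N2: "integrable lebesgue (\<lambda>z. cutoff r z * g n z * (h (Y n + z) - h (Y n)) * frac_kernel s z)" for n
      using q2[of n] Bform_glue[OF _ i2 adm farhI[OF XY(2)], of n] integrable_near_part[OF _ i2 adm farhI[OF XY(2)], of n]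
      unfolding c_def by blast+
    have near: "\<bar>?N X n - ?N Y n\<bar> \<le> A * D * kernel_mass TYPE('a) s * (sqrt (k n) * norm (X n - Y n))" for n
    proof -
      have "0 \<le> A * sqrt (k n)" "0 \<le> D * norm (X n - Y n)" using A0 D(1) k(1)[of n] by auto
      from near_part_diff_le[OF s r(1,2) N1 N2 gA this(1) h2 this(2)]
      show ?thesis by (simp add: mult_ac)
    qed
    have "(\<lambda>n. ?N X n - ?N Y n) \<longlonglongrightarrow> 0"
    proof (rule Lim_null_comparison)
      show "\<forall>\<^sub>F n in sequentially. norm (?N X n - ?N Y n) \<le> A * D * kernel_mass TYPE('a) s * (sqrt (k n) * norm (X n - Y n))"
        using near by (simp add: always_eventually)
      show "(\<lambda>n. A * D * kernel_mass TYPE('a) s * (sqrt (k n) * norm (X n - Y n))) \<longlonglongrightarrow> 0"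
        using tendsto_mult_left[OF k(2), of "A * D * kernel_mass TYPE('a) s"] by simp
    qed
    moreover have "(\<lambda>n. ?F X n - ?F Y n) \<longlonglongrightarrow> 0"
      using tendsto_diff[OF farh[OF XY(1)] farh[OF XY(2)]] by simp
    ultimately have "(\<lambda>n. c / 2 * ((?N X n - ?N Y n) + (?F X n - ?F Y n))) \<longlonglongrightarrow> c / 2 * (0 + 0)"
      by (intro tendsto_mult_left tendsto_add)
    moreover have "Bform s (\<psi>1 n) h (X n) - Bform s (\<psi>2 n) h (Y n) = c / 2 * ((?N X n - ?N Y n) + (?F X n - ?F Y n))" for n
      unfolding eq1 eq2 by (simp add: right_diff_distrib distrib_left)
    ultimately show ?thesis by (simp only: add_0_right mult_zero_right)
  qed
  have c1: "continuous_on (closure \<Omega>) (\<psi>1 n)" for n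
    unfolding \<psi>1_def by (intro continuous_on_add continuous_on_const continuous_on_glue[OF gl1])
  have c2: "continuous_on (closure \<Omega>) (\<psi>2 n)" for n
    unfolding \<psi>2_def by (intro continuous_on_add continuous_on_const continuous_on_glue[OF gl2])
  have b: "\<psi>1 n (X n) = w (X n)" "\<psi>2 n (Y n) = v (Y n)" for n
    using g0[of n] by (simp_all add: \<psi>1_def \<psi>2_def glue_def)
  show ?thesis
    by (rule that[of xh r X Y k l \<psi>1 \<psi>2 A', OF xh r(1,3) XY k(1,2) q1 q2 c1 c2 w1 w2 b L B1 B2 A'0 Bh])
qed

section \<open>Comparison\<close>

text \<open>Short increments are controlled by a Lipschitz constant valid on the whole ball, long
  ones by boundedness. The energy bound \<open>M\<close> is therefore uniform over the ball, and
  since \<open>k n \<ge> 1\<close> it is absorbed into \<open>M * k n\<close>.\<close>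

lemma C2_bounded_locally_quad_at:
  fixes \<rho> :: "'a::euclidean_space \<Rightarrow> real"
  assumes s: "0 < s" "s < 1" and \<Omega>: "open \<Omega>" "cball xh (2 * r) \<subseteq> \<Omega>" "0 < r"
    and \<rho>: "\<rho> \<in> borel_measurable lebesgue" "\<And>p. \<bar>\<rho> p\<bar> \<le> B" "Ck_on 2 \<rho> \<Omega>"
  obtains l M where "0 \<le> M" "\<And>x. norm (x - xh) \<le> r \<Longrightarrow> \<exists>C. quad_at x (l x) C \<rho>"
    "\<And>x. norm (x - xh) \<le> r \<Longrightarrow> Bform s \<rho> \<rho> x \<le> M"
proof -
  obtain D p where "0 \<le> D" "\<forall>x\<in>cball xh (2 * r). (\<rho> has_derivative (\<lambda>z. p x \<bullet> z)) (at x)"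
    "\<forall>x\<in>cball xh (2 * r). \<forall>y\<in>cball xh (2 * r). norm (p x - p y) \<le> D * norm (x - y)"
    using C2_gradient_lipschitz[OF \<rho>(3) \<Omega>(1,2)] by blast
  note D = this
  have cb: "x \<in> cball xh (2 * r)" "x + z \<in> cball xh (2 * r)" if "norm (x - xh) \<le> r" "norm z \<le> r" for x z
    using norm_triangle_ineq[of "x - xh" z] that \<Omega>(3) by (auto simp: dist_norm norm_minus_commute algebra_simps)
  have quad: "\<exists>C. quad_at x (p x) C \<rho>" if "norm (x - xh) \<le> r" for x
  proof (rule quad_atI_bounded[OF \<rho>(1,2) \<Omega>(3)])
    show "\<bar>\<rho> (x + z) - \<rho> x - p x \<bullet> z\<bar> \<le> D * (norm z)\<^sup>2" if "norm z < r" for z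
      using first_order_expansion_le[OF D, of x z] cb[OF \<open>norm (x - xh) \<le> r\<close>, of z] that by simp
  qed
  define L where "L = norm (p xh) + 3 * D * (2 * r)"
  define \<delta> where "\<delta> = min 1 r"
  have \<delta>: "0 < \<delta>" "\<delta> \<le> 1" "\<delta> \<le> r" using \<Omega>(3) by (auto simp: \<delta>_def)
  define Q where "Q = L\<^sup>2 + (2 * B)\<^sup>2 / \<delta>\<^sup>2"
  have sq: "(\<rho> (x + z) - \<rho> x)\<^sup>2 \<le> Q * msq z" if x: "norm (x - xh) \<le> r" for x z
  proof (cases "norm z \<le> \<delta>")
    case True
    then have "\<bar>\<rho> (x + z) - \<rho> x\<bar> \<le> L * norm z"
      unfolding L_def using \<delta> lipschitz_increment_le[OF D, of x z] cb[OF x, of z] by simp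
    then have "\<bar>\<rho> (x + z) - \<rho> x\<bar>\<^sup>2 \<le> (L * norm z)\<^sup>2" by (intro power_mono) auto
    also have "\<dots> = L\<^sup>2 * msq z"
      using True \<delta> power_le_one[of "norm z" 2] by (simp add: power_mult_distrib)
    also have "\<dots> \<le> Q * msq z" unfolding Q_def by (intro mult_right_mono) auto
    finally show ?thesis by simp
  next
    case False
    have "\<bar>\<rho> (x + z) - \<rho> x\<bar>\<^sup>2 \<le> (2 * B)\<^sup>2"
      using \<rho>(2)[of "x + z"] \<rho>(2)[of x] by (intro power_mono) linarith+
    also have "\<dots> = (2 * B)\<^sup>2 / \<delta>\<^sup>2 * \<delta>\<^sup>2" using \<delta> by simp
    also have "\<dots> \<le> (2 * B)\<^sup>2 / \<delta>\<^sup>2 * msq z"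
      using False \<delta> by (intro mult_left_mono) (auto intro!: power_mono power_le_one)
    also have "\<dots> \<le> Q * msq z" unfolding Q_def by (intro mult_right_mono) auto
    finally show ?thesis by simp
  qed
  let ?M = "frac_const DIM('a) s / 2 * (Q * kernel_mass TYPE('a) s)"
  have "0 \<le> ?M"
    using frac_const_pos[OF s, of "DIM('a)"] kernel_mass_nonneg[where 'a = 'a, of s]
    unfolding Q_def by (intro mult_nonneg_nonneg add_nonneg_nonneg) auto
  then show ?thesis
    using that[of ?M p] quad Bform_self_le[OF s sq] by blast
qed

text \<open>A real number strictly between the extended supremum and 0 gives the margin. The
  supremum is taken in \<open>ereal\<close>, so neither boundedness nor a nonempty set has to be
  known beforehand.\<close>

lemma SUP_ereal_less_0_bound:
  assumes "(SUP x\<in>S. ereal (f x)) < 0"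
  obtains \<eta> where "0 < \<eta>" "\<And>x. x \<in> S \<Longrightarrow> f x \<le> - \<eta>"
proof -
  obtain t where t: "(SUP x\<in>S. ereal (f x)) < ereal t" "ereal t < 0"
    using ereal_dense2[OF assms] by blast
  have "f x \<le> - (- t)" if "x \<in> S" for x
  proof -
    have "ereal (f x) \<le> (SUP x\<in>S. ereal (f x))" using that by (rule SUP_upper)
    also have "\<dots> < ereal t" by (rule t)
    finally show ?thesis by simp
  qed
  then show ?thesis using that[of "- t"] t(2) by simp
qed

lemma squeeze_contradiction:
  fixes L1 L2 P Q :: "nat \<Rightarrow> real"
  assumes "\<And>n. \<sigma> * L1 n + P n \<le> - \<delta>" "\<And>n. 0 \<le> \<sigma> * L2 n + Q n" "0 < \<delta>"
    and "(\<lambda>n. L1 n - L2 n) \<longlonglongrightarrow> 0" "(\<lambda>n. P n - Q n) \<longlonglongrightarrow> 0"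
  shows False
proof -
  have "(\<lambda>n. \<sigma> * (L1 n - L2 n) + (P n - Q n)) \<longlonglongrightarrow> \<sigma> * 0 + 0"
    using assms by (intro tendsto_intros)
  moreover have "\<sigma> * (L1 n - L2 n) + (P n - Q n) \<le> - \<delta>" for n
    using assms(1,2)[of n] by (simp add: algebra_simps)
  ultimately have "\<sigma> * 0 + 0 \<le> - \<delta>" by (intro LIMSEQ_le_const2) auto
  then show False using assms(3) by simp
qed

lemma modulus_tendsto_0:
  assumes "modulus_of_continuity \<omega>" "t \<longlonglongrightarrow> 0" "\<And>n. 0 \<le> t n"
  shows "(\<lambda>n. \<omega> (t n)) \<longlonglongrightarrow> 0"
proof -
  have "continuous_on {0..} \<omega>" "\<omega> 0 = 0" using assms(1) by (auto simp: modulus_of_continuity_def)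
  then show ?thesis
    using continuous_on_tendsto_compose[of "{0..}" \<omega> t 0 sequentially] assms by auto
qed

section \<open>Realizing prescribed values of the gradient and of the form\<close>

lemma Ck_on_peak:
  fixes e :: "'a::euclidean_space"
  assumes "open \<Omega>" "\<Omega> \<inter> ball e 1 = {}"
  shows "Ck_on k (\<lambda>v. t * indicator (ball e 1) v :: real) \<Omega>"
proof (rule Ck_on_cong[OF assms(1)])
  show "Ck_on k (\<lambda>_. 0) \<Omega>" by (intro Ck_on_real_polynomial_function real_polynomial_function.intros(2))
qed (use assms(2) in \<open>auto simp: indicator_def disjoint_iff simp del: mem_ball\<close>)

text \<open>A peak of height \<open>t\<close> on a far ball vanishes on \<open>\<Omega>\<close>, so
  it is smooth there, and its energy at \<open>x\<close> is
  \<open>c / 2 * t\<^sup>2 * \<kappa>\<close>; solving for \<open>t\<close> yields any prescribed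
  \<open>T\<close>. This turns the modulus hypothesis into a statement about nonnegative
  numbers.\<close>

lemma Ds_surjective:
  fixes \<Omega> :: "'a::euclidean_space set"
  assumes s: "0 < s" "s < 1" and \<Omega>: "open \<Omega>" "bounded \<Omega>" "x \<in> \<Omega>" and T: "0 \<le> T"
  obtains v where "Ck_on 1 v \<Omega>" "v \<in> L1w s" "Bform_finite s v v x" "Ds s v x = T"
proof -
  obtain e b :: 'a and R where far: "\<And>v w. v \<in> closure \<Omega> \<Longrightarrow> w \<in> ball e 1 \<Longrightarrow> 1 \<le> norm (w - v)"
    using ex_far_direction[OF \<Omega>(2)] by metis
  have cl: "y \<in> closure \<Omega>" if "y \<in> \<Omega>" for y using that closure_subset by blast
  have disj: "\<Omega> \<inter> ball e 1 = {}" using far[OF cl] by fastforce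
  note pk = s far[OF cl[OF \<Omega>(3)]] zero_less_one
  define c where "c = frac_const DIM('a) s"
  have c: "0 < c" unfolding c_def by (rule frac_const_pos[OF s])
  define \<kappa> where "\<kappa> = ball_mass s e 1 x"
  have \<kappa>: "0 < \<kappa>" unfolding \<kappa>_def by (rule ball_mass_pos[OF pk])
  define t where "t = T / sqrt (c / 2 * \<kappa>)"
  define v where "v p = t * indicator (ball e 1) p" for p
  have q: "quad_at x 0 \<bar>t\<bar> v" unfolding v_def[abs_def] by (rule quad_at_peak[OF pk])
  have z: "quad_at x 0 0 (\<lambda>_::'a. 0 :: real)" by (auto simp: quad_at_def)
  obtain \<beta> where "\<bar>\<beta>\<bar> \<le> (norm (0::'a) + 0) * ball_mass s e 1 x"
    "Bform s (\<lambda>p. 0 + t * indicator (ball e 1) p) (\<lambda>p. 0 + t * indicator (ball e 1) p) x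
      = Bform s (\<lambda>_. 0) (\<lambda>_. 0) x + c / 2 * (2 * (t * \<beta>) + t\<^sup>2 * ball_mass s e 1 x)"
    unfolding c_def by (rule Bform_add_peak[where \<delta> = 1 and t = t, OF pk z])
  then have "Bform s v v x = c / 2 * (t\<^sup>2 * \<kappa>)"
    by (simp add: v_def[abs_def] \<kappa>_def Bform_eq)
  also have "\<dots> = T\<^sup>2" using c \<kappa> by (simp add: t_def power_divide)
  finally have "Ds s v x = T" using T by (simp add: Ds_def)
  then show ?thesis
    using that[of v] Ck_on_peak[OF \<Omega>(1) disj, of 1 t] quad_at_L1w[OF s q]
      Bform_finite_quad[OF q quad_at_admissible[OF s q]] unfolding v_def[abs_def] by blast
qed

text \<open>Differentiating in direction \<open>d\<close> maps the coefficients
  \<open>(A, B)\<close> to \<open>(- B * (d \<bullet> b), A * (d \<bullet> b))\<close>, so the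
  family is closed under derivatives and the induction runs with arbitrary coefficients.\<close>

lemma smooth_trig:
  fixes b x :: "'a::euclidean_space"
  shows "smooth (\<lambda>w. A * sin ((w - x) \<bullet> b) + B * cos ((w - x) \<bullet> b))"
  unfolding smooth_def
proof
  fix k
  show "Ck_on k (\<lambda>w. A * sin ((w - x) \<bullet> b) + B * cos ((w - x) \<bullet> b)) UNIV"
  proof (induction k arbitrary: A B)
    case 0
    show ?case by (auto intro!: continuous_intros)
  next
    case (Suc k)
    let ?f = "\<lambda>w. A * sin ((w - x) \<bullet> b) + B * cos ((w - x) \<bullet> b)"
    have D: "(?f has_derivative (\<lambda>d. (- B * (d \<bullet> b)) * sin ((w - x) \<bullet> b) + (A * (d \<bullet> b)) * cos ((w - x) \<bullet> b))) (at w)" for w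
      by (auto intro!: derivative_eq_intros simp: algebra_simps)
    have "frechet_derivative ?f (at w) d = (- B * (d \<bullet> b)) * sin ((w - x) \<bullet> b) + (A * (d \<bullet> b)) * cos ((w - x) \<bullet> b)" for w d
      by (rule fun_cong[OF frechet_derivative_at[OF D[of w], symmetric]])
    moreover have "?f differentiable_on UNIV"
      using D by (auto simp: differentiable_on_def differentiable_def)
    ultimately show ?case by (simp only: Ck_on.simps Suc.IH) simp
  qed
qed

text \<open>The modulus in part (b) compares two forms with the same first argument, so one
  \<open>v\<close> has to serve all points and values; the freedom lies in \<open>h\<close>. With
  \<open>v\<close> the indicator of a far ball, the form at \<open>x\<close> integrates
  \<open>h - h x\<close> over that ball and is linear in the amplitude of \<open>h\<close>.\<close>

lemma Bform_surjective:
  fixes \<Omega> :: "'a::euclidean_space set"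
  assumes s: "0 < s" "s < 1" and \<Omega>: "open \<Omega>" "bounded \<Omega>"
  obtains v where "Ck_on 1 v \<Omega>" "v \<in> L1w s"
    "\<And>x p. x \<in> \<Omega> \<Longrightarrow> \<exists>h. smooth h \<and> h \<in> L1w s \<and> Bform_finite s v h x \<and> Bform s v h x = p"
proof -
  obtain e b :: 'a and R where R: "0 < R" and far: "\<And>v w. v \<in> closure \<Omega> \<Longrightarrow> w \<in> ball e 1 \<Longrightarrow> 1 \<le> norm (w - v)"
    and dir: "\<And>v w. v \<in> closure \<Omega> \<Longrightarrow> w \<in> ball e 1 \<Longrightarrow> 0 < (w - v) \<bullet> b \<and> (w - v) \<bullet> b < R"
    using ex_far_direction[OF \<Omega>(2)] by metis
  have cl: "y \<in> closure \<Omega>" if "y \<in> \<Omega>" for y using that closure_subset by blast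
  have disj: "\<Omega> \<inter> ball e 1 = {}" using far[OF cl] by fastforce
  define v where "v p = (1::real) * indicator (ball e 1) p" for p :: 'a
  have C: "Ck_on 1 v \<Omega>" unfolding v_def[abs_def] by (rule Ck_on_peak[OF \<Omega>(1) disj])
  have vm: "v \<in> borel_measurable lebesgue"
    unfolding v_def using lebesgue_measurable_indicator_ball[of e 1] by measurable
  have vL: "v \<in> L1w s" by (rule bounded_L1w[OF s vm, of 1]) (simp add: v_def indicator_def)
  have sur: "\<exists>h. smooth h \<and> h \<in> L1w s \<and> Bform_finite s v h x \<and> Bform s v h x = p" if x: "x \<in> \<Omega>" for x p
  proof -
    note pk = s far[OF cl[OF x]] zero_less_one
    define c where "c = frac_const DIM('a) s"
    have c: "0 < c" unfolding c_def by (rule frac_const_pos[OF s])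
    define S where "S z = sin (z \<bullet> ((1 / R) *\<^sub>R b))" for z :: 'a
    have "S \<in> borel_measurable borel"
      unfolding S_def by (intro borel_measurable_continuous_onI continuous_intros)
    then have Sm: "S \<in> borel_measurable lebesgue" by (auto intro: measurable_completion)
    define J where "J = (LINT z|lebesgue. S z * (indicator (ball e 1) (x + z) * frac_kernel s z))"
    have J: "0 < J"
      unfolding J_def
    proof (rule weighted_ball_mass_pos[OF pk Sm])
      show "\<bar>S z\<bar> \<le> 1" for z by (simp add: S_def)
      show "0 < S z" if "x + z \<in> ball e 1" for z
      proof -
        have "0 < z \<bullet> b" "z \<bullet> b < R" using dir[OF cl[OF x] that] by simp_all
        then have "0 < z \<bullet> b / R" "z \<bullet> b / R < 1" using R by simp_all
        then show ?thesis using sin_gt_zero[of "z \<bullet> b / R"] pi_gt3 by (simp add: S_def)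
      qed
    qed
    define t where "t = p / (c / 2 * J)"
    define h where "h w = t * S (w - x)" for w
    have h: "smooth h"
      using smooth_trig[of t x "(1 / R) *\<^sub>R b" 0] by (simp add: h_def[abs_def] S_def)
    then have h2: "Ck_on 2 h UNIV" by (simp add: smooth_def)
    have hL: "h \<in> L1w s"
    proof (rule bounded_L1w[OF s])
      show "h \<in> borel_measurable lebesgue"
        unfolding h_def using measurable_lebesgue_shift[OF Sm, of "- x"] by simp
      show "\<bar>h w\<bar> \<le> \<bar>t\<bar>" for w
        using mult_left_mono[of "\<bar>S (w - x)\<bar>" 1 "\<bar>t\<bar>"] by (simp add: h_def abs_mult S_def)
    qed
    have fin: "Bform_finite s v h x"
      unfolding v_def[abs_def] by (rule Bform_finite_quad[OF quad_at_peak[OF pk] form_admissible_C2[OF s h2 hL]])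
    have "v x = 0" using disj x by (auto simp: v_def indicator_def disjoint_iff simp del: mem_ball)
    then have "(\<lambda>z. (v (x + z) - v x) * (h (x + z) - h x) * frac_kernel s z)
        = (\<lambda>z. t * (S z * (indicator (ball e 1) (x + z) * frac_kernel s z)))"
      by (simp add: fun_eq_iff v_def h_def S_def)
    then have "Bform s v h x = c / 2 * (t * J)" unfolding Bform_eq J_def c_def by simp
    also have "\<dots> = p" using c J by (simp add: t_def)
    finally show ?thesis using h hL fin by blast
  qed
  show ?thesis by (rule that[OF C vL sur])
qed

section \<open>Strict subsolutions and the contradiction\<close>

lemma strict_combination:
  fixes H :: "'b \<times> real \<Rightarrow> real"
  assumes "convex_on UNIV (\<lambda>p. H (x, p))" and \<mu>: "0 < \<mu>" "\<mu> < 1"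
    and "\<sigma> * a + H (x, p) \<le> 0" "\<sigma> * b + H (x, q) \<le> - \<eta>"
  shows "\<sigma> * (\<mu> * a + (1 - \<mu>) * b) + H (x, \<mu> * p + (1 - \<mu>) * q) \<le> - ((1 - \<mu>) * \<eta>)"
proof -
  have "H (x, \<mu> * p + (1 - \<mu>) * q) \<le> \<mu> * H (x, p) + (1 - \<mu>) * H (x, q)"
    using convex_onD[OF assms(1), of "1 - \<mu>" p q] \<mu> by simp
  moreover have "\<mu> * (\<sigma> * a + H (x, p)) \<le> 0" using assms(4) \<mu> by (simp add: mult_le_0_iff)
  moreover have "(1 - \<mu>) * (\<sigma> * b + H (x, q)) \<le> (1 - \<mu>) * (- \<eta>)"
    using assms(5) \<mu> by (intro mult_left_mono) auto
  ultimately show ?thesis by (simp add: algebra_simps)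
qed

context
  fixes s :: real and \<Omega> :: "'a::euclidean_space set" and u1 u2 \<rho> :: "'a \<Rightarrow> real"
  assumes s: "0 < s" "s < 1" and \<Omega>: "open \<Omega>" "bounded \<Omega>"
    and m: "u2 \<in> borel_measurable lebesgue" "\<rho> \<in> borel_measurable lebesgue"
    and bd: "bounded (range u1)" "bounded (range u2)" "bounded (range \<rho>)"
    and cont: "continuous_on (closure \<Omega>) u1" "continuous_on (closure \<Omega>) u2" "continuous_on (closure \<Omega>) \<rho>"
    and off: "\<forall>a. a \<notin> \<Omega> \<longrightarrow> u1 a \<le> u2 a" and \<rho>: "Ck_on 2 \<rho> \<Omega>" "\<forall>a. \<rho> a \<le> u1 a"
begin

text \<open>The strict subsolution \<open>\<mu> u\<^sub>1 + (1 - \<mu>) \<rho>\<close> is doubled against \<open>u\<^sub>2\<close>; solving its test function for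
  \<open>u\<^sub>1\<close> gives \<open>f\<close>.\<close>

lemma doubling_strict_subsolution:
  assumes S: "\<forall>\<Omega>'. compactly_contained \<Omega>' \<Omega> \<longrightarrow> (SUP x\<in>\<Omega>'. ereal (S x)) < 0"
    and pos: "x0 \<in> \<Omega>" "u2 x0 < u1 x0"
  obtains \<mu> \<eta> X Y k m l f \<psi> A where "0 < \<mu>" "\<mu> < 1" "0 < \<eta>" "\<And>n::nat. X n \<in> \<Omega>" "\<And>n. Y n \<in> \<Omega>" "\<And>n. S (X n) \<le> - \<eta>"
    "\<And>n. 1 \<le> (k n :: real)" "(\<lambda>n. sqrt (k n) * norm (X n - Y n)) \<longlonglongrightarrow> 0"
    "\<And>n. \<exists>C. quad_at (X n) (m n) C (f n)" "\<And>n. \<exists>C. quad_at (Y n) (l n) C (\<psi> n)" "\<And>n. \<exists>l C. quad_at (X n) l C \<rho>"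
    "\<And>n. continuous_on (closure \<Omega>) (f n)" "\<And>n. continuous_on (closure \<Omega>) (\<psi> n)"
    "\<And>n p. u1 p \<le> f n p" "\<And>n p. \<psi> n p \<le> u2 p" "\<And>n. u1 (X n) = f n (X n)" "\<And>n. u2 (Y n) = \<psi> n (Y n)"
    "(\<lambda>n. \<mu> * frac_lap s (f n) (X n) + (1 - \<mu>) * frac_lap s \<rho> (X n) - frac_lap s (\<psi> n) (Y n)) \<longlonglongrightarrow> 0"
    "0 \<le> A" "\<And>n. Bform s (f n) (f n) (X n) \<le> A * k n / \<mu>\<^sup>2" "\<And>n. Bform s \<rho> \<rho> (X n) \<le> A * k n"
    "\<And>n. Bform s (\<psi> n) (\<psi> n) (Y n) \<le> A * k n"
    "\<And>h. Ck_on 2 h UNIV \<Longrightarrow> h \<in> L1w s \<Longrightarrow>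
      (\<lambda>n. \<mu> * Bform s (f n) h (X n) + (1 - \<mu>) * Bform s \<rho> h (X n) - Bform s (\<psi> n) h (Y n)) \<longlonglongrightarrow> 0"
proof -
  obtain B1 B2 B3 where "\<And>p. \<bar>u1 p\<bar> \<le> B1" "\<And>p. \<bar>u2 p\<bar> \<le> B2" "\<And>p. \<bar>\<rho> p\<bar> \<le> B3"
    using bd unfolding bounded_iff by auto
  then obtain B where B: "\<And>p. \<bar>u1 p\<bar> \<le> B" "\<And>p. \<bar>u2 p\<bar> \<le> B" "\<And>p. \<bar>\<rho> p\<bar> \<le> B"
    using that by (metis (no_types, opaque_lifting) linorder_le_cases order_trans max.cobounded1 max.cobounded2)
  define d where "d = u1 x0 - \<rho> x0"
  define e where "e = u1 x0 - u2 x0"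
  have de: "0 \<le> d" "0 < e" using spec[OF \<rho>(2), of x0] pos(2) by (auto simp: d_def e_def)
  define q where "q = d + e + 1"
  have q: "0 < q" "d < q" "e < q" using de by (auto simp: q_def)
  \<comment> \<open>At \<open>x0\<close> the combination exceeds \<open>u2\<close> by
    \<open>e - (1 - \<mu>) * d\<close>. The choice \<open>1 - \<mu> = e / (d + e + 1)\<close> makes
    this positive; the summand 1 keeps \<open>\<mu> > 0\<close> also when
    \<open>d = 0\<close>.\<close>
  define \<mu> where "\<mu> = 1 - e / q"
  have "e / q * d < e" using mult_strict_left_mono[OF q(2) de(2)] q(1) by (simp add: pos_divide_less_eq)
  moreover have "0 < e / q" "e / q < 1" using de q by auto
  ultimately have \<mu>: "0 < \<mu>" "\<mu> < 1" "(1 - \<mu>) * d < e" by (auto simp: \<mu>_def)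
  define w where "w p = \<mu> * u1 p + (1 - \<mu>) * \<rho> p" for p
  have wu1: "w p \<le> u1 p" for p
    using mult_left_mono[OF spec[OF \<rho>(2), of p], of "1 - \<mu>"] \<mu> by (simp add: w_def algebra_simps)
  have wB: "\<bar>w p\<bar> \<le> B" for p
  proof -
    have "\<mu> * u1 p \<le> \<mu> * B" "(1 - \<mu>) * \<rho> p \<le> (1 - \<mu>) * B" "\<mu> * (- B) \<le> \<mu> * u1 p" "(1 - \<mu>) * (- B) \<le> (1 - \<mu>) * \<rho> p"
      using B(1)[of p] B(3)[of p] \<mu> by (intro mult_left_mono; linarith)+
    then show ?thesis unfolding w_def by (simp add: abs_le_iff algebra_simps)
  qed
  have wc: "continuous_on (closure \<Omega>) w" unfolding w_def by (intro continuous_intros cont)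
  have woff: "\<forall>a. a \<notin> \<Omega> \<longrightarrow> w a \<le> u2 a" using order_trans[OF wu1] off by blast
  have wpos: "u2 x0 < w x0" using \<mu>(3) by (simp add: w_def d_def e_def algebra_simps)
  show ?thesis
  proof (cases rule: coupled_test_functions[OF s \<Omega> m(1) wB B(2) wc cont(2) woff pos(1) wpos, case_names coupled])
    case (coupled xh r X Y k l \<psi>1 \<psi>2 A0)
    note r = coupled(2,3) and XY = coupled(4-7) and k = coupled(8,9) and q1 = coupled(10) and q2 = coupled(11)
      and c1 = coupled(12) and c2 = coupled(13) and w1 = coupled(14) and w2 = coupled(15) and b1 = coupled(16)
      and b2 = coupled(17) and L = coupled(18) and A0 = coupled(19-21) and Bh = coupled(22)
    obtain lr M where M: "0 \<le> M" and lr: "\<And>x. norm (x - xh) \<le> r \<Longrightarrow> \<exists>C. quad_at x (lr x) C \<rho>"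
      and BM: "\<And>x. norm (x - xh) \<le> r \<Longrightarrow> Bform s \<rho> \<rho> x \<le> M"
      by (rule C2_bounded_locally_quad_at[OF s \<Omega>(1) r(2,1) m(2) B(3) \<rho>(1)], rule that; assumption)
    have sub: "cball xh r \<subseteq> \<Omega>" using r by (intro order_trans[OF subset_cball r(2)]) auto
    have XO: "X n \<in> \<Omega>" "Y n \<in> \<Omega>" for n
      using sub XY(3,4)[of n] by (auto simp: dist_norm norm_minus_commute subset_iff)
    \<comment> \<open>All doubling points lie in this ball, so one margin \<open>\<eta>\<close>
      serves for every \<open>n\<close>.\<close>
    have "compactly_contained (cball xh r) \<Omega>" unfolding compactly_contained_def using sub by simp
    with S have "(SUP x\<in>cball xh r. ereal (S x)) < 0" by blast
    from SUP_ereal_less_0_bound[OF this]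
    obtain \<eta> where \<eta>: "0 < \<eta>" "\<And>x. x \<in> cball xh r \<Longrightarrow> S x \<le> - \<eta>" by blast
    have SX: "S (X n) \<le> - \<eta>" for n using \<eta>(2) XY(3)[of n] by (simp add: dist_norm norm_minus_commute)
    \<comment> \<open>Coefficients of the solution of
      \<open>\<mu> * f n + (1 - \<mu>) * \<rho> = \<psi>1 n\<close>. Since \<open>\<psi>1 n\<close>
      touches the same combination of \<open>u1\<close> and \<open>\<rho>\<close> from above,
      \<open>f n\<close> touches \<open>u1\<close> from above.\<close>
    define a b where "a = 1 / \<mu>" and "b = - (1 - \<mu>) / \<mu>"
    define f where "f n p = a * \<psi>1 n p + b * \<rho> p" for n p
    have inv: "\<mu> * f n p + (1 - \<mu>) * \<rho> p = \<psi>1 n p" for n p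
      using \<mu>(1) by (simp add: f_def a_def b_def field_simps)
    have qf: "\<exists>C. quad_at (X n) (a *\<^sub>R l n + b *\<^sub>R lr (X n)) C (f n)" for n
      using q1[of n] lr[OF XY(3)[of n]] quad_at_lin[of "X n"] unfolding f_def[abs_def] by blast
    have fc: "continuous_on (closure \<Omega>) (f n)" for n
      unfolding f_def by (intro continuous_intros c1 cont)
    have "\<mu> * u1 p + (1 - \<mu>) * \<rho> p \<le> \<mu> * f n p + (1 - \<mu>) * \<rho> p" for n p
      using w1[of p n] inv[of n p] by (simp add: w_def)
    then have uf: "u1 p \<le> f n p" for n p using \<mu>(1) by simp
    have "\<mu> * u1 (X n) = \<mu> * f n (X n)" for n
      using b1[of n] inv[of n "X n"] unfolding w_def by linarith
    then have ufX: "u1 (X n) = f n (X n)" for n using \<mu>(1) by simp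
    have psi: "\<psi>1 n = (\<lambda>p. \<mu> * f n p + (1 - \<mu>) * \<rho> p)" for n using inv by (simp add: fun_eq_iff)
    have Llin: "frac_lap s (\<psi>1 n) (X n) = \<mu> * frac_lap s (f n) (X n) + (1 - \<mu>) * frac_lap s \<rho> (X n)" for n
      using qf[of n] lr[OF XY(3)[of n]] frac_lap_lin[OF s] unfolding psi by blast
    have Bflin: "Bform s (\<psi>1 n) h (X n) = \<mu> * Bform s (f n) h (X n) + (1 - \<mu>) * Bform s \<rho> h (X n)"
      if "Ck_on 2 h UNIV" "h \<in> L1w s" for h n
    proof -
      have h: "form_admissible s (X n) h" by (rule form_admissible_C2[OF s that])
      obtain C C' where "quad_at (X n) (a *\<^sub>R l n + b *\<^sub>R lr (X n)) C (f n)" "quad_at (X n) (lr (X n)) C' \<rho>"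
        using qf[of n] lr[OF XY(3)[of n]] by blast
      from this[THEN Bform_finite_quad[OF _ h]] show ?thesis unfolding psi by (rule Bform_lin)
    qed
    define A where "A = 2 * A0 + 2 * M"
    have kM: "M \<le> M * k n" for n using mult_left_mono[OF k(1)[of n] M] by simp
    have k0: "0 \<le> A0 * k n" for n using A0(3) k(1)[of n] by simp
    have Bff: "Bform s (f n) (f n) (X n) \<le> A * k n / \<mu>\<^sup>2" for n
    proof -
      obtain C C' where *: "quad_at (X n) (l n) C (\<psi>1 n)" "quad_at (X n) (lr (X n)) C' \<rho>"
        using q1[of n] lr[OF XY(3)[of n]] by blast
      have fin: "Bform_finite s (\<psi>1 n) (\<psi>1 n) (X n)" "Bform_finite s \<rho> \<rho> (X n)"
        using *[THEN Bform_finite_quad] *[THEN quad_at_admissible[OF s]] by blast+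
      have "Bform s (f n) (f n) (X n) \<le> 2 * a\<^sup>2 * Bform s (\<psi>1 n) (\<psi>1 n) (X n) + 2 * b\<^sup>2 * Bform s \<rho> \<rho> (X n)"
        unfolding f_def[abs_def] by (rule Bform_self_lin_le[OF s fin])
      also have "\<dots> \<le> 2 * a\<^sup>2 * (A0 * k n) + 2 * a\<^sup>2 * (M * k n)"
      proof (intro add_mono mult_mono)
        have "(1 - \<mu>)\<^sup>2 \<le> 1" using \<mu> by (intro power_le_one) auto
        then show "b\<^sup>2 \<le> a\<^sup>2" unfolding a_def b_def power_divide power2_minus using \<mu>
          by (intro divide_right_mono) auto
        show "Bform s \<rho> \<rho> (X n) \<le> M * k n" using BM[OF XY(3)[of n]] kM[of n] by linarith
      qed (use A0 Bform_nonneg[OF s] in auto)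
      also have "\<dots> = A * k n / \<mu>\<^sup>2" by (simp add: A_def a_def power_divide algebra_simps add_divide_distrib)
      finally show ?thesis .
    qed
    have Br: "Bform s \<rho> \<rho> (X n) \<le> A * k n" for n
      using BM[OF XY(3)[of n]] kM[of n] k0[of n] M unfolding A_def by (simp add: distrib_right)
    have Bp: "Bform s (\<psi>2 n) (\<psi>2 n) (Y n) \<le> A * k n" for n
      using A0(2)[of n] kM[of n] k0[of n] M unfolding A_def by (simp add: distrib_right)
    have A: "0 \<le> A" using A0 M by (simp add: A_def)
    have qr: "\<exists>l C. quad_at (X n) l C \<rho>" for n using lr[OF XY(3)[of n]] by blast
    show ?thesis
      by (rule that[of \<mu> \<eta> X Y k "\<lambda>n. a *\<^sub>R l n + b *\<^sub>R lr (X n)" f l \<psi>2 A, OF \<mu>(1,2) \<eta>(1) XO SX k qf q2 qr fc c2 uf w2 ufX b2[symmetric]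
          L[unfolded Llin] A Bff Br Bp])
        (use Bh Bflin in auto)
  qed
qed

text \<open>\<open>Ds\<close> of a combination is not the combination of the \<open>Ds\<close>
  values, so convexity of \<open>H\<close> is applied to numbers: \<open>visc_quad_at_Ds\<close>
  admits any value above \<open>Ds s (f n) (X n)\<close> for \<open>u1\<close> and any value above
  \<open>Ds s (\<psi> n) (Y n)\<close> for \<open>u2\<close>, and these are chosen to produce the
  same \<open>T n\<close> in both inequalities.\<close>

lemma comparison_Ds:
  fixes H :: "'a \<times> real \<Rightarrow> real"
  assumes H: "continuous_on UNIV H" and conv: "\<forall>x\<in>\<Omega>. convex_on UNIV (\<lambda>p. H (x, p))"
    and sub: "visc_sub_D s \<sigma> H \<Omega> u1" and super: "visc_super_D s \<sigma> H \<Omega> u2"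
    and \<omega>: "modulus_of_continuity \<omega>"
      "\<And>x y v. x \<in> \<Omega> \<Longrightarrow> y \<in> \<Omega> \<Longrightarrow> Ck_on 1 v \<Omega> \<Longrightarrow> v \<in> L1w s \<Longrightarrow> Bform_finite s v v x \<Longrightarrow>
          \<bar>H (x, Ds s v x) - H (y, Ds s v x)\<bar> \<le> \<omega> (norm (x - y) * (1 + Ds s v x))"
    and S: "\<forall>\<Omega>'. compactly_contained \<Omega>' \<Omega> \<longrightarrow> (SUP x\<in>\<Omega>'. ereal (\<sigma> * frac_lap s \<rho> x + H (x, Ds s \<rho> x))) < 0"
    and x0: "x0 \<in> \<Omega>"
  shows "u1 x0 \<le> u2 x0"
proof (rule ccontr)
  assume "\<not> ?thesis"
  then have pos: "u2 x0 < u1 x0" by simp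
  show False
  proof (cases rule: doubling_strict_subsolution[OF S x0 pos, case_names doubled])
    case (doubled \<mu> \<eta> X Y k m l f \<psi> A)
    note \<mu> = doubled(1,2) and \<eta> = doubled(3) and XY = doubled(4,5) and strict\<rho> = doubled(6) and k = doubled(7,8)
      and q = doubled(9,10) and c = doubled(12,13) and t = doubled(14-17) and L = doubled(18)
      and A = doubled(19-22)
    \<comment> \<open>Twice the common energy scale: after the share of \<open>\<rho>\<close> has
      been subtracted at least \<open>sqrt A * sqrt (k n)\<close> is left, and division by
      \<open>\<mu>\<close> then reaches \<open>Ds s (f n) (X n)\<close>.\<close>
    define T where "T n = 2 * sqrt A * sqrt (k n)" for n
    have k0: "0 \<le> k n" "0 \<le> sqrt (k n)" for n using k(1)[of n] by auto
    have T0: "0 \<le> T n" for n unfolding T_def using A(1) k0 by simp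
    have D\<rho>: "0 \<le> Ds s \<rho> (X n)" "Ds s \<rho> (X n) \<le> sqrt A * sqrt (k n)" for n
      using A(3)[of n] Bform_nonneg[OF s] by (auto simp: Ds_def real_sqrt_mult[symmetric])
    have Df: "Ds s (f n) (X n) \<le> sqrt A * sqrt (k n) / \<mu>" for n
    proof -
      have "Ds s (f n) (X n) \<le> sqrt (A * k n / \<mu>\<^sup>2)" using A(2)[of n] by (simp add: Ds_def)
      then show ?thesis using \<mu>(1) by (simp add: real_sqrt_divide real_sqrt_mult)
    qed
    have D\<psi>: "Ds s (\<psi> n) (Y n) \<le> T n" for n
    proof -
      have "Ds s (\<psi> n) (Y n) \<le> sqrt A * sqrt (k n)" using A(4)[of n] by (simp add: Ds_def real_sqrt_mult[symmetric])
      moreover have "0 \<le> sqrt A * sqrt (k n)" using A(1) k0 by simp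
      ultimately show ?thesis by (simp add: T_def)
    qed
    define p where "p n = (T n - (1 - \<mu>) * Ds s \<rho> (X n)) / \<mu>" for n
    have Tp: "T n = \<mu> * p n + (1 - \<mu>) * Ds s \<rho> (X n)" for n using \<mu>(1) by (simp add: p_def)
    have Dp: "Ds s (f n) (X n) \<le> p n" for n
    proof -
      have "(1 - \<mu>) * Ds s \<rho> (X n) \<le> 1 * Ds s \<rho> (X n)" using \<mu> D\<rho>[of n] by (intro mult_right_mono) auto
      then have "sqrt A * sqrt (k n) \<le> T n - (1 - \<mu>) * Ds s \<rho> (X n)" using D\<rho>(2)[of n] by (simp add: T_def)
      then have "sqrt A * sqrt (k n) / \<mu> \<le> p n" unfolding p_def using \<mu>(1) by (intro divide_right_mono) auto
      then show ?thesis using Df[of n] by linarith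
    qed
    have sub': "\<sigma> * frac_lap s (f n) (X n) + H (X n, p n) \<le> 0" for n
    proof -
      obtain C where C: "quad_at (X n) (m n) C (f n)" using q(1) by blast
      have "1 * (\<sigma> * frac_lap s (f n) (X n) + H (X n, p n)) \<le> 0"
      proof (rule visc_quad_at_Ds[where u = u1, OF s \<Omega> XY(1) H _ _ C c(1) _ t(3) Dp])
        fix \<phi> assume "test_function s \<sigma> \<Omega> \<phi>" "\<forall>y. 1 * (u1 y - \<phi> y) \<le> 1 * (u1 (X n) - \<phi> (X n))" "Bform_finite s \<phi> \<phi> (X n)"
        then show "1 * (\<sigma> * frac_lap s \<phi> (X n) + H (X n, Ds s \<phi> (X n))) \<le> 0"
          using sub XY(1)[of n] unfolding visc_sub_def by simp
      qed (use t(1) in auto)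
      then show ?thesis by simp
    qed
    have super': "0 \<le> \<sigma> * frac_lap s (\<psi> n) (Y n) + H (Y n, T n)" for n
    proof -
      obtain C where C: "quad_at (Y n) (l n) C (\<psi> n)" using q(2) by blast
      have "- 1 * (\<sigma> * frac_lap s (\<psi> n) (Y n) + H (Y n, T n)) \<le> 0"
      proof (rule visc_quad_at_Ds[where u = u2, OF s \<Omega> XY(2) H _ _ C c(2) _ t(4) D\<psi>])
        fix \<phi> assume a: "test_function s \<sigma> \<Omega> \<phi>" "\<forall>y. - 1 * (u2 y - \<phi> y) \<le> - 1 * (u2 (Y n) - \<phi> (Y n))" "Bform_finite s \<phi> \<phi> (Y n)"
        have "u2 (Y n) - \<phi> (Y n) \<le> u2 y - \<phi> y" for y using spec[OF a(2), of y] by (simp add: algebra_simps)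
        then have "0 \<le> \<sigma> * frac_lap s \<phi> (Y n) + H (Y n, Ds s \<phi> (Y n))"
          using a super XY(2)[of n] unfolding visc_super_def by blast
        then show "- 1 * (\<sigma> * frac_lap s \<phi> (Y n) + H (Y n, Ds s \<phi> (Y n))) \<le> 0" by simp
      qed (use t(2) in auto)
      then show ?thesis by simp
    qed
    have strict: "\<sigma> * (\<mu> * frac_lap s (f n) (X n) + (1 - \<mu>) * frac_lap s \<rho> (X n)) + H (X n, T n) \<le> - ((1 - \<mu>) * \<eta>)" for n
      unfolding Tp using conv XY(1) by (intro strict_combination \<mu> sub' strict\<rho>) blast
    have Hdiff: "\<bar>H (X n, T n) - H (Y n, T n)\<bar> \<le> \<omega> (norm (X n - Y n) * (1 + T n))" for n
    proof -
      \<comment> \<open>The auxiliary \<open>v\<close> is unrelated to the solutions; it only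
        represents the number \<open>T n\<close> in the modulus hypothesis.\<close>
      obtain v where "Ck_on 1 v \<Omega>" "v \<in> L1w s" "Bform_finite s v v (X n)" "Ds s v (X n) = T n"
        by (rule Ds_surjective[OF s \<Omega> XY(1)[of n] T0[of n]])
      then show ?thesis using \<omega>(2)[OF XY, of v n n] by simp
    qed
    have "(\<lambda>n. norm (X n - Y n) * (1 + T n)) \<longlonglongrightarrow> 0"
    proof (rule Lim_null_comparison)
      show "(\<lambda>n. (1 + 2 * sqrt A) * (sqrt (k n) * norm (X n - Y n))) \<longlonglongrightarrow> 0"
        using tendsto_mult_left[OF k(2), of "1 + 2 * sqrt A"] by simp
      have "norm (norm (X n - Y n) * (1 + T n)) \<le> (1 + 2 * sqrt A) * (sqrt (k n) * norm (X n - Y n))" for n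
      proof -
        have "1 \<le> sqrt (k n)" using k(1)[of n] by simp
        then have "1 + T n \<le> (1 + 2 * sqrt A) * sqrt (k n)" unfolding T_def by (simp add: distrib_right)
        then have "norm (X n - Y n) * (1 + T n) \<le> norm (X n - Y n) * ((1 + 2 * sqrt A) * sqrt (k n))"
          by (intro mult_left_mono) auto
        then show ?thesis using T0[of n] by (simp add: abs_mult mult_ac)
      qed
      then show "\<forall>\<^sub>F n in sequentially. norm (norm (X n - Y n) * (1 + T n)) \<le> (1 + 2 * sqrt A) * (sqrt (k n) * norm (X n - Y n))"
        by (simp add: always_eventually)
    qed
    then have "(\<lambda>n. \<omega> (norm (X n - Y n) * (1 + T n))) \<longlonglongrightarrow> 0"
      using T0 by (intro modulus_tendsto_0[OF \<omega>(1)]) auto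
    then have "(\<lambda>n. H (X n, T n) - H (Y n, T n)) \<longlonglongrightarrow> 0"
      by (rule Lim_null_comparison[rotated]) (use Hdiff in \<open>simp add: always_eventually\<close>)
    then show False
      using squeeze_contradiction[OF strict super' _ L] \<mu> \<eta> by simp
  qed
qed

text \<open>The form is linear in its first argument, so the combination of the values for
  \<open>f n\<close> and \<open>\<rho>\<close> is the value for the coupled test function at
  \<open>X n\<close>, which the coupling brings close to that of \<open>\<psi> n\<close> at
  \<open>Y n\<close>. The viscosity inequalities are therefore used with the form values
  themselves.\<close>

lemma comparison_Bform:
  fixes H :: "'a \<times> real \<Rightarrow> real"
  assumes H: "continuous_on UNIV H" and conv: "\<forall>x\<in>\<Omega>. convex_on UNIV (\<lambda>p. H (x, p))"
    and h: "smooth h" "h \<in> L1w s"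
    and sub: "visc_sub_B s \<sigma> h H \<Omega> u1" and super: "visc_super_B s \<sigma> h H \<Omega> u2"
    and \<omega>: "modulus_of_continuity \<omega>"
      "\<And>x y v h1 h2. x \<in> \<Omega> \<Longrightarrow> y \<in> \<Omega> \<Longrightarrow> Ck_on 1 v \<Omega> \<Longrightarrow> v \<in> L1w s \<Longrightarrow>
          smooth h1 \<Longrightarrow> h1 \<in> L1w s \<Longrightarrow> smooth h2 \<Longrightarrow> h2 \<in> L1w s \<Longrightarrow>
          Bform_finite s v h1 x \<Longrightarrow> Bform_finite s v h2 y \<Longrightarrow>
          \<bar>H (x, Bform s v h1 x) - H (y, Bform s v h2 y)\<bar>
            \<le> \<omega> (norm (x - y) + \<bar>Bform s v h1 x - Bform s v h2 y\<bar>)"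
    and S: "\<forall>\<Omega>'. compactly_contained \<Omega>' \<Omega> \<longrightarrow> (SUP x\<in>\<Omega>'. ereal (\<sigma> * frac_lap s \<rho> x + H (x, Bform s \<rho> h x))) < 0"
    and x0: "x0 \<in> \<Omega>"
  shows "u1 x0 \<le> u2 x0"
proof (rule ccontr)
  assume "\<not> ?thesis"
  then have pos: "u2 x0 < u1 x0" by simp
  have h2: "Ck_on 2 h UNIV" using h(1) by (simp add: smooth_def)
  have adm: "form_admissible s x h" for x by (rule form_admissible_C2[OF s h2 h(2)])
  show False
  proof (cases rule: doubling_strict_subsolution[OF S x0 pos, case_names doubled])
    case (doubled \<mu> \<eta> X Y k m l f \<psi> A)
    note \<mu> = doubled(1,2) and \<eta> = doubled(3) and XY = doubled(4,5) and strict\<rho> = doubled(6) and k = doubled(7,8)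
      and q = doubled(9,10) and c = doubled(12,13) and t = doubled(14-17) and L = doubled(18) and Bl = doubled(23)
    define p where "p n = \<mu> * Bform s (f n) h (X n) + (1 - \<mu>) * Bform s \<rho> h (X n)" for n
    define r where "r n = Bform s (\<psi> n) h (Y n)" for n
    have pr: "(\<lambda>n. p n - r n) \<longlonglongrightarrow> 0" unfolding p_def r_def by (rule Bl[OF h2 h(2)])
    have sub': "\<sigma> * frac_lap s (f n) (X n) + H (X n, Bform s (f n) h (X n)) \<le> 0" for n
    proof -
      obtain C where C: "quad_at (X n) (m n) C (f n)" using q(1) by blast
      have "1 * (\<sigma> * frac_lap s (f n) (X n) + H (X n, Bform s (f n) h (X n))) \<le> 0"
      proof (rule visc_quad_at[where u = u1 and G = "\<lambda>\<phi>. Bform s \<phi> h" and fin = "\<lambda>\<phi>. Bform_finite s \<phi> h",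
            OF s \<Omega> XY(1) H _ _ C c(1) _ t(3)])
        fix \<phi> assume "test_function s \<sigma> \<Omega> \<phi>" "\<forall>y. 1 * (u1 y - \<phi> y) \<le> 1 * (u1 (X n) - \<phi> (X n))" "Bform_finite s \<phi> h (X n)"
        then show "1 * (\<sigma> * frac_lap s \<phi> (X n) + H (X n, Bform s \<phi> h (X n))) \<le> 0"
          using sub XY(1)[of n] unfolding visc_sub_def by simp
      next
        fix F C' assume "\<And>i. quad_at (X n) (m n) C' (F i)" "\<And>v. (\<lambda>i. F i v) \<longlonglongrightarrow> f n v"
        then show "(\<lambda>i. Bform s (F i) h (X n)) \<longlonglongrightarrow> Bform s (f n) h (X n)" by (rule Bform_tendsto[OF _ _ adm])
      next
        fix \<phi> C' assume "quad_at (X n) (m n) C' \<phi>"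
        then show "Bform_finite s \<phi> h (X n)" by (rule Bform_finite_quad[OF _ adm])
      qed (use t(1) in auto)
      then show ?thesis by simp
    qed
    have super': "0 \<le> \<sigma> * frac_lap s (\<psi> n) (Y n) + H (Y n, r n)" for n
    proof -
      obtain C where C: "quad_at (Y n) (l n) C (\<psi> n)" using q(2) by blast
      have "- 1 * (\<sigma> * frac_lap s (\<psi> n) (Y n) + H (Y n, Bform s (\<psi> n) h (Y n))) \<le> 0"
      proof (rule visc_quad_at[where u = u2 and G = "\<lambda>\<phi>. Bform s \<phi> h" and fin = "\<lambda>\<phi>. Bform_finite s \<phi> h",
            OF s \<Omega> XY(2) H _ _ C c(2) _ t(4)])
        fix \<phi> assume a: "test_function s \<sigma> \<Omega> \<phi>" "\<forall>y. - 1 * (u2 y - \<phi> y) \<le> - 1 * (u2 (Y n) - \<phi> (Y n))" "Bform_finite s \<phi> h (Y n)"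
        have "u2 (Y n) - \<phi> (Y n) \<le> u2 y - \<phi> y" for y using spec[OF a(2), of y] by (simp add: algebra_simps)
        then have "0 \<le> \<sigma> * frac_lap s \<phi> (Y n) + H (Y n, Bform s \<phi> h (Y n))"
          using a super XY(2)[of n] unfolding visc_super_def by blast
        then show "- 1 * (\<sigma> * frac_lap s \<phi> (Y n) + H (Y n, Bform s \<phi> h (Y n))) \<le> 0" by simp
      next
        fix F C' assume "\<And>i. quad_at (Y n) (l n) C' (F i)" "\<And>v. (\<lambda>i. F i v) \<longlonglongrightarrow> \<psi> n v"
        then show "(\<lambda>i. Bform s (F i) h (Y n)) \<longlonglongrightarrow> Bform s (\<psi> n) h (Y n)" by (rule Bform_tendsto[OF _ _ adm])
      next
        fix \<phi> C' assume "quad_at (Y n) (l n) C' \<phi>"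
        then show "Bform_finite s \<phi> h (Y n)" by (rule Bform_finite_quad[OF _ adm])
      qed (use t(2) in auto)
      then show ?thesis by (simp add: r_def)
    qed
    have strict: "\<sigma> * (\<mu> * frac_lap s (f n) (X n) + (1 - \<mu>) * frac_lap s \<rho> (X n)) + H (X n, p n) \<le> - ((1 - \<mu>) * \<eta>)" for n
      unfolding p_def using conv XY(1) by (intro strict_combination \<mu> sub' strict\<rho>) blast
    have Hdiff: "\<bar>H (X n, p n) - H (Y n, r n)\<bar> \<le> \<omega> (norm (X n - Y n) + \<bar>p n - r n\<bar>)" for n
    proof -
      \<comment> \<open>The two values differ and belong to different points, so one
        \<open>v\<close> is paired with two functions \<open>h1\<close> and \<open>h2\<close> that
        realize \<open>p n\<close> at \<open>X n\<close> and \<open>r n\<close> at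
        \<open>Y n\<close>.\<close>
      obtain v where v: "Ck_on 1 v \<Omega>" "v \<in> L1w s"
        "\<And>x p. x \<in> \<Omega> \<Longrightarrow> \<exists>h. smooth h \<and> h \<in> L1w s \<and> Bform_finite s v h x \<and> Bform s v h x = p"
        by (rule Bform_surjective[OF s \<Omega>], rule that; assumption)
      obtain h1 where h1: "smooth h1" "h1 \<in> L1w s" "Bform_finite s v h1 (X n)" "Bform s v h1 (X n) = p n"
        using v(3)[OF XY(1)] by blast
      obtain h2 where h2: "smooth h2" "h2 \<in> L1w s" "Bform_finite s v h2 (Y n)" "Bform s v h2 (Y n) = r n"
        using v(3)[OF XY(2)] by blast
      show ?thesis using \<omega>(2)[OF XY v(1,2) h1(1,2) h2(1,2) h1(3) h2(3)] by (simp add: h1(4) h2(4))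
    qed
    have "(\<lambda>n. norm (X n - Y n)) \<longlonglongrightarrow> 0"
    proof (rule Lim_null_comparison[OF _ k(2)])
      have "1 * norm (X n - Y n) \<le> sqrt (k n) * norm (X n - Y n)" for n
        using k(1)[of n] by (intro mult_right_mono) auto
      then show "\<forall>\<^sub>F n in sequentially. norm (norm (X n - Y n)) \<le> sqrt (k n) * norm (X n - Y n)"
        by (simp add: always_eventually)
    qed
    from tendsto_add[OF this tendsto_rabs[OF pr]]
    have "(\<lambda>n. \<omega> (norm (X n - Y n) + \<bar>p n - r n\<bar>)) \<longlonglongrightarrow> 0"
      by (intro modulus_tendsto_0[OF \<omega>(1)]) auto
    then have "(\<lambda>n. H (X n, p n) - H (Y n, r n)) \<longlonglongrightarrow> 0"
      by (rule Lim_null_comparison[rotated]) (use Hdiff in \<open>simp add: always_eventually\<close>)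
    then show False
      using squeeze_contradiction[OF strict super' _ L] \<mu> \<eta> by simp
  qed
qed

end

theorem theorem1p1:
  fixes s \<sigma> :: real
    and \<Omega> :: "(real ^ 'n) set"
    and H :: "(real ^ 'n) \<times> real \<Rightarrow> real"
    and u1 u2 :: "real ^ 'n \<Rightarrow> real"
  assumes "0 < s" and "s < 1" and "\<sigma> \<ge> 0"
    and "open \<Omega>" and "connected \<Omega>" and "bounded \<Omega>"
    and "continuous_on UNIV H"
    and "\<forall>x\<in>\<Omega>. convex_on UNIV (\<lambda>p. H (x, p))"
    and "u1 \<in> borel_measurable lebesgue" and "u2 \<in> borel_measurable lebesgue"
    and "bounded (range u1)" and "bounded (range u2)"
    and "continuous_on (closure \<Omega>) u1" and "continuous_on (closure \<Omega>) u2"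
    and "\<forall>x. x \<notin> \<Omega> \<longrightarrow> u1 x \<le> u2 x"
  shows
    "(visc_sub_D s \<sigma> H \<Omega> u1 \<and> visc_super_D s \<sigma> H \<Omega> u2 \<and>
      (\<exists>\<omega>1. modulus_of_continuity \<omega>1 \<and>
        (\<forall>x\<in>\<Omega>. \<forall>y\<in>\<Omega>. \<forall>v. Ck_on 1 v \<Omega> \<and> v \<in> L1w s \<and> Bform_finite s v v x \<longrightarrow>
          \<bar>H (x, Ds s v x) - H (y, Ds s v x)\<bar> \<le> \<omega>1 (norm (x - y) * (1 + Ds s v x)))) \<and>
      (\<exists>\<rho>1. \<rho>1 \<in> borel_measurable lebesgue \<and> bounded (range \<rho>1) \<and>
        continuous_on (closure \<Omega>) \<rho>1 \<and> Ck_on 2 \<rho>1 \<Omega> \<and> (\<forall>x. \<rho>1 x \<le> u1 x) \<and>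
        (\<forall>\<Omega>'. compactly_contained \<Omega>' \<Omega> \<longrightarrow>
          (SUP x\<in>\<Omega>'. ereal (\<sigma> * frac_lap s \<rho>1 x + H (x, Ds s \<rho>1 x))) < 0))
      \<longrightarrow> (\<forall>x\<in>\<Omega>. u1 x \<le> u2 x))
     \<and>
     (\<forall>h. smooth h \<and> h \<in> L1w s \<and>
      visc_sub_B s \<sigma> h H \<Omega> u1 \<and> visc_super_B s \<sigma> h H \<Omega> u2 \<and>
      (\<exists>\<omega>2. modulus_of_continuity \<omega>2 \<and>
        (\<forall>x\<in>\<Omega>. \<forall>y\<in>\<Omega>. \<forall>v h1 h2. Ck_on 1 v \<Omega> \<and> v \<in> L1w s \<and>
          smooth h1 \<and> h1 \<in> L1w s \<and> smooth h2 \<and> h2 \<in> L1w s \<and>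
          Bform_finite s v h1 x \<and> Bform_finite s v h2 y \<longrightarrow>
          \<bar>H (x, Bform s v h1 x) - H (y, Bform s v h2 y)\<bar>
            \<le> \<omega>2 (norm (x - y) + \<bar>Bform s v h1 x - Bform s v h2 y\<bar>))) \<and>
      (\<exists>\<rho>2. \<rho>2 \<in> borel_measurable lebesgue \<and> bounded (range \<rho>2) \<and>
        continuous_on (closure \<Omega>) \<rho>2 \<and> Ck_on 2 \<rho>2 \<Omega> \<and> (\<forall>x. \<rho>2 x \<le> u1 x) \<and>
        (\<forall>\<Omega>'. compactly_contained \<Omega>' \<Omega> \<longrightarrow>
          (SUP x\<in>\<Omega>'. ereal (\<sigma> * frac_lap s \<rho>2 x + H (x, Bform s \<rho>2 h x))) < 0))
      \<longrightarrow> (\<forall>x\<in>\<Omega>. u1 x \<le> u2 x))"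
proof (intro conjI impI allI ballI; elim conjE exE)
  fix x \<omega> \<rho>
  assume sub: "visc_sub_D s \<sigma> H \<Omega> u1" and super: "visc_super_D s \<sigma> H \<Omega> u2"
    and \<omega>: "modulus_of_continuity \<omega>"
      "\<forall>x\<in>\<Omega>. \<forall>y\<in>\<Omega>. \<forall>v. Ck_on 1 v \<Omega> \<and> v \<in> L1w s \<and> Bform_finite s v v x \<longrightarrow>
          \<bar>H (x, Ds s v x) - H (y, Ds s v x)\<bar> \<le> \<omega> (norm (x - y) * (1 + Ds s v x))"
    and \<rho>: "\<rho> \<in> borel_measurable lebesgue" "bounded (range \<rho>)" "continuous_on (closure \<Omega>) \<rho>" "Ck_on 2 \<rho> \<Omega>"
      "\<forall>x. \<rho> x \<le> u1 x"
      "\<forall>\<Omega>'. compactly_contained \<Omega>' \<Omega> \<longrightarrow> (SUP x\<in>\<Omega>'. ereal (\<sigma> * frac_lap s \<rho> x + H (x, Ds s \<rho> x))) < 0"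
    and x: "x \<in> \<Omega>"
  show "u1 x \<le> u2 x"
    by (rule comparison_Ds[OF assms(1,2,4,6,10) \<rho>(1) assms(11,12) \<rho>(2) assms(13,14) \<rho>(3) assms(15) \<rho>(4,5)
          assms(7,8) sub super \<omega>(1) _ \<rho>(6) x])
      (use \<omega>(2) in auto)
next
  fix h x \<omega> \<rho>
  assume h: "smooth h" "h \<in> L1w s" and sub: "visc_sub_B s \<sigma> h H \<Omega> u1" and super: "visc_super_B s \<sigma> h H \<Omega> u2"
    and \<omega>: "modulus_of_continuity \<omega>"
      "\<forall>x\<in>\<Omega>. \<forall>y\<in>\<Omega>. \<forall>v h1 h2. Ck_on 1 v \<Omega> \<and> v \<in> L1w s \<and>
          smooth h1 \<and> h1 \<in> L1w s \<and> smooth h2 \<and> h2 \<in> L1w s \<and>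
          Bform_finite s v h1 x \<and> Bform_finite s v h2 y \<longrightarrow>
          \<bar>H (x, Bform s v h1 x) - H (y, Bform s v h2 y)\<bar>
            \<le> \<omega> (norm (x - y) + \<bar>Bform s v h1 x - Bform s v h2 y\<bar>)"
    and \<rho>: "\<rho> \<in> borel_measurable lebesgue" "bounded (range \<rho>)" "continuous_on (closure \<Omega>) \<rho>" "Ck_on 2 \<rho> \<Omega>"
      "\<forall>x. \<rho> x \<le> u1 x"
      "\<forall>\<Omega>'. compactly_contained \<Omega>' \<Omega> \<longrightarrow> (SUP x\<in>\<Omega>'. ereal (\<sigma> * frac_lap s \<rho> x + H (x, Bform s \<rho> h x))) < 0"
    and x: "x \<in> \<Omega>"
  show "u1 x \<le> u2 x"
    by (rule comparison_Bform[OF assms(1,2,4,6,10) \<rho>(1) assms(11,12) \<rho>(2) assms(13,14) \<rho>(3) assms(15) \<rho>(4,5)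
          assms(7,8) h sub super \<omega>(1) _ \<rho>(6) x])
      (use \<omega>(2) in auto)
qed

end
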